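(* Let $K$ be a pathwise connected poset. For all finite-dimensional Hilbert net bundles $\mathcal{E},\mathcal{E}'\in V_{net}(K)$ of ranks $d,d'$ and all $i=1,\dots,d+d'$, $$\mathrm{k}_i(\mathcal{E}\oplus\mathcal{E}')=\sum_{l+m=i}\mathrm{k}_l(\mathcal{E})\,\mathrm{k}_m(\mathcal{E}').$$ Thus the total Chern K-class factorizes through a morphism $$\mathrm{k}:V^s_{net}(K)\to1+h\,\widetilde{\mathbf{K}}^0(K)[[h]],\qquad \mathrm{k}(\mathcal{E}\oplus\mathcal{E}')=\mathrm{k}(\mathcal{E})\,\mathrm{k}(\mathcal{E}'),$$ such that $\eta^*\mathrm{k}(\mathcal{E})=\mathrm{k}(\eta^*\mathcal{E})$ for every morphism $\eta:K'\to K$ of pathwise connected posets.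
   Context: Hilbert net bundle over a poset $K$: $\mathcal{E}=(E,\pi,J,K)$ with $\pi:E\to K$ surjective, each fibre $E_a$ a (complex) Hilbert space, and unitaries $J_{(a',a)}:E_a\to E_{a'}$ for $a\leq a'$ with $J_{(a,a)}=\mathrm{id}$, $J_{(a'',a')}J_{(a',a)}=J_{(a'',a)}$. Isomorphisms are families of unitaries $E_a\to\hat E_a$ intertwining the net structures. $V_{net}(K)$ is the category of finite-dimensional Hilbert net bundles; direct sum, tensor product and antisymmetric (exterior) powers $\lambda^k\mathcal{E}$ are fibrewise, $\lambda^0\mathcal{E}$ is the trivial rank one bundle. The rank of $\mathcal{E}$ is the (constant) fibre dimension. $\mathcal{T}_k$ is the trivial bundle $K\times\mathbb{C}^k$ with identity net structure. The pullback along an order-preserving map $\eta:K'\to K$ has fibres $E_{\eta(a')}$ and net structure $J_{(\eta(a''),\eta(a'))}$. $K$ is pathwise connected if any two elements are joined by a finite chain of pairwise consecutive comparable elements. $\mathbf{K}^0(K)$ is the Grothendieck ring of the semiring of isomorphism classes of finite-dimensional Hilbert net bundles; $[\mathcal{E}]$ is the class of $\mathcal{E}$; $\widetilde{\mathbf{K}}^0(K)$ is the kernel of the rank map $\mathbf{K}^0(K)\to\mathbb{Z}$. $\mathcal{E}$ and $\mathcal{F}$ are stably equivalent if $\mathcal{E}\oplus\mathcal{T}_j\simeq\mathcal{F}\oplus\mathcal{T}_k$ for some $j,k$; $V^s_{net}(K)$ is the semigroup (under direct sum) of stable equivalence classes. Chern K-classes of a rank $d$ bundle: $\mathrm{k}_i(\mathcal{E})=\sum_{k=0}^i(-1)^k\binom{d-k}{i-k}[\lambda^k\mathcal{E}]$,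 $i=1,\dots,d$ (these lie in $\widetilde{\mathbf{K}}^0(K)$); $\mathrm{k}_0(\mathcal{E})=1$ and $\mathrm{k}_i(\mathcal{E})=0$ for $i>d$. Total Chern K-class: $\mathrm{k}(\mathcal{E})=1+\sum_{i=1}^d\mathrm{k}_i(\mathcal{E})h^i$. For a ring $R$, $1+hR[[h]]$ denotes here the multiplicative semigroup of polynomials $1+\sum_{k=1}^rx_kh^k$, $x_k\in R$, $r\in\mathbb{N}$. *)

theory Defs
  imports
    "Jordan_Normal_Form.VS_Connect"
    "HOL-Combinatorics.Permutations"
    "HOL-Computational_Algebra.Polynomial"
begin

section \<open>Finite-dimensional Hilbert spaces\<close>

record 'v hilb = "(complex, 'v) module" +
  ip :: "'v \<Rightarrow> 'v \<Rightarrow> complex"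

text \<open>Vector spaces are taken from the AFP entry VectorSpace; \<open>class_ring\<close> is the field of
  complex numbers as a record. The inner product is antilinear in its first argument.
  Completeness is automatic in finite dimension.\<close>

locale fd_hilbert = vectorspace "class_ring :: complex ring" H for H :: "'v hilb" (structure) +
  assumes finite_dim: "vectorspace.fin_dim (class_ring :: complex ring) H"
    and ip_cnj: "\<And>x y. x \<in> carrier H \<Longrightarrow> y \<in> carrier H \<Longrightarrow> ip H x y = cnj (ip H y x)"
    and ip_add: "\<And>x y z. x \<in> carrier H \<Longrightarrow> y \<in> carrier H \<Longrightarrow> z \<in> carrier H \<Longrightarrow>
      ip H x (y \<oplus>\<^bsub>H\<^esub> z) = ip H x y + ip H x z"
    and ip_smult: "\<And>c x y. x \<in> carrier H \<Longrightarrow> y \<in> carrier H \<Longrightarrow>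
      ip H x (c \<odot>\<^bsub>H\<^esub> y) = c * ip H x y"
    and ip_pos: "\<And>x. x \<in> carrier H \<Longrightarrow> x \<noteq> \<zero>\<^bsub>H\<^esub> \<Longrightarrow> Re (ip H x x) > 0"

abbreviation hdim :: "'v hilb \<Rightarrow> nat" where
  "hdim H \<equiv> vectorspace.dim (class_ring :: complex ring) H"

definition unitary :: "'v hilb \<Rightarrow> 'w hilb \<Rightarrow> ('v \<Rightarrow> 'w) \<Rightarrow> bool" where
  "unitary H H' U \<longleftrightarrow> U \<in> LinearCombinations.module_hom (class_ring :: complex ring) H H' \<and>
     bij_betw U (carrier H) (carrier H') \<and>
     (\<forall>x\<in>carrier H. \<forall>y\<in>carrier H. ip H' (U x) (U y) = ip H x y)"

definition onb :: "'v hilb \<Rightarrow> 'v set \<Rightarrow> bool" where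
  "onb H B \<longleftrightarrow> finite B \<and> B \<subseteq> carrier H \<and>
     (\<forall>e\<in>B. \<forall>f\<in>B. ip H e f = (if e = f then 1 else 0)) \<and>
     (\<forall>x\<in>carrier H. (\<forall>e\<in>B. ip H e x = 0) \<longrightarrow> x = \<zero>\<^bsub>H\<^esub>)"

definition is_total :: "'v hilb \<Rightarrow> 't set \<Rightarrow> ('t \<Rightarrow> 'v) \<Rightarrow> bool" where
  "is_total H X \<phi> \<longleftrightarrow> (\<forall>t\<in>X. \<phi> t \<in> carrier H) \<and>
     (\<forall>x\<in>carrier H. (\<forall>t\<in>X. ip H (\<phi> t) x = 0) \<longrightarrow> x = \<zero>\<^bsub>H\<^esub>)"

subsection \<open>Orthonormal bases\<close>

context fd_hilbert
begin

lemma smc [simp, intro]: "x \<in> carrier H \<Longrightarrow> c \<odot>\<^bsub>H\<^esub> x \<in> carrier H"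
  using smult_closed[of c x] by simp

lemma zero_smult: "x \<in> carrier H \<Longrightarrow> 0 \<odot>\<^bsub>H\<^esub> x = \<zero>\<^bsub>H\<^esub>"
  using lmult_0[of x] by simp

lemma ip_zero [simp]: "x \<in> carrier H \<Longrightarrow> ip H x \<zero>\<^bsub>H\<^esub> = 0"
  using ip_smult[of x "\<zero>\<^bsub>H\<^esub>" 0] zero_smult[of "\<zero>\<^bsub>H\<^esub>"] by simp

lemma ip_zero_left [simp]: "x \<in> carrier H \<Longrightarrow> ip H \<zero>\<^bsub>H\<^esub> x = 0"
  using ip_cnj[of "\<zero>\<^bsub>H\<^esub>" x] by simp

lemma ip_add_left: "x \<in> carrier H \<Longrightarrow> y \<in> carrier H \<Longrightarrow> z \<in> carrier H \<Longrightarrow>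
  ip H (y \<oplus>\<^bsub>H\<^esub> z) x = ip H y x + ip H z x"
  using ip_cnj[of "y \<oplus>\<^bsub>H\<^esub> z" x] ip_cnj[of y x] ip_cnj[of z x] ip_add[of x y z] by simp

lemma ip_smult_left: "x \<in> carrier H \<Longrightarrow> y \<in> carrier H \<Longrightarrow>
  ip H (c \<odot>\<^bsub>H\<^esub> y) x = cnj c * ip H y x"
  using ip_cnj[of "c \<odot>\<^bsub>H\<^esub> y" x] ip_cnj[of y x] ip_smult[of x y c] by simp

lemma ip_self_zero: "x \<in> carrier H \<Longrightarrow> ip H x x = 0 \<Longrightarrow> x = \<zero>\<^bsub>H\<^esub>"
  using ip_pos[of x] by force

lemma ip_self_real: "x \<in> carrier H \<Longrightarrow> ip H x x = of_real (Re (ip H x x))"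
  using ip_cnj[of x x] by (metis Reals_cnj_iff of_real_Re)

lemma diff_zero:
  assumes "x \<in> carrier H" "y \<in> carrier H" "x \<oplus>\<^bsub>H\<^esub> (-1) \<odot>\<^bsub>H\<^esub> y = \<zero>\<^bsub>H\<^esub>"
  shows "x = y"
proof -
  have "y \<oplus>\<^bsub>H\<^esub> (-1) \<odot>\<^bsub>H\<^esub> y = (1 + -1) \<odot>\<^bsub>H\<^esub> y"
    using smult_l_distr[of 1 "-1" y] smult_one[of y] assms by simp
  also have "\<dots> = \<zero>\<^bsub>H\<^esub>" using zero_smult assms by simp
  finally have "x \<oplus>\<^bsub>H\<^esub> (-1) \<odot>\<^bsub>H\<^esub> y = y \<oplus>\<^bsub>H\<^esub> (-1) \<odot>\<^bsub>H\<^esub> y" using assms by simp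
  thus ?thesis using assms by (simp add: M.add.right_cancel)
qed

lemma ip_diff:
  assumes "x \<in> carrier H" "y \<in> carrier H" "z \<in> carrier H"
  shows "ip H z (x \<oplus>\<^bsub>H\<^esub> (-1) \<odot>\<^bsub>H\<^esub> y) = ip H z x - ip H z y"
  using assms by (simp add: ip_add ip_smult)

lemma finsum_closed': "(\<And>a. a \<in> A \<Longrightarrow> f a \<in> carrier H) \<Longrightarrow> finsum H f A \<in> carrier H"
  by (rule finsum_closed) auto

lemma ip_finsum:
  assumes "x \<in> carrier H" "finite A" "\<And>a. a \<in> A \<Longrightarrow> f a \<in> carrier H"
  shows "ip H x (finsum H f A) = (\<Sum>a\<in>A. ip H x (f a))"
  using assms(2,3)
proof (induct A rule: finite_induct)
  case (insert a A)
  have "finsum H f (insert a A) = f a \<oplus>\<^bsub>H\<^esub> finsum H f A"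
    using insert by (intro finsum_insert) auto
  thus ?case using insert assms(1) by (simp add: ip_add finsum_closed')
qed (simp add: assms(1))

lemma ortho_card:
  assumes B: "finite B" "B \<subseteq> carrier H" "\<forall>e\<in>B. \<forall>f\<in>B. ip H e f = (if e = f then 1 else 0)"
  shows "lin_indpt B" "card B \<le> dim"
proof -
  show li: "lin_indpt B"
  proof
    assume "lin_dep B"
    from finite_lin_dep[OF B(1) this] B(2) obtain a v where
      a: "lincomb a B = \<zero>\<^bsub>H\<^esub>" "v \<in> B" "a v \<noteq> 0" by auto
    have "ip H v (lincomb a B) = (\<Sum>b\<in>B. ip H v (a b \<odot>\<^bsub>H\<^esub> b))"
      unfolding lincomb_def using B a by (intro ip_finsum) auto
    also have "\<dots> = (\<Sum>b\<in>B. if b = v then a b else 0)"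
      using B a by (intro sum.cong refl) (auto simp: ip_smult subset_iff)
    also have "\<dots> = a v" using B a by simp
    finally show False using a B(2) by auto
  qed
  show "card B \<le> dim" using li_le_dim(2)[OF finite_dim B(2) li] .
qed

lemma onb_subspace:
  assumes S: "S \<subseteq> carrier H" "\<And>x c. x \<in> S \<Longrightarrow> c \<odot>\<^bsub>H\<^esub> x \<in> S"
  obtains B where "finite B" "B \<subseteq> S" "\<forall>e\<in>B. \<forall>f\<in>B. ip H e f = (if e = f then 1 else 0)"
    "\<And>x. x \<in> S \<Longrightarrow> (\<forall>e\<in>B. ip H e x = 0) \<Longrightarrow> x = \<zero>\<^bsub>H\<^esub>"
proof -
  define P where "P B \<longleftrightarrow> finite B \<and> B \<subseteq> S \<and> (\<forall>e\<in>B. \<forall>f\<in>B. ip H e f = (if e = f then 1 else 0))" for B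
  have "P {}" by (simp add: P_def)
  moreover have "\<forall>B. P B \<longrightarrow> card B \<le> dim"
    using ortho_card(2) S(1) unfolding P_def by blast
  ultimately obtain B where B: "P B" "\<And>C. P C \<Longrightarrow> card C \<le> card B"
    using ex_has_greatest_nat[of P "{}" card "Suc dim"] by (auto simp: less_Suc_eq_le)
  have "x = \<zero>\<^bsub>H\<^esub>" if x: "x \<in> S" "\<forall>e\<in>B. ip H e x = 0" for x
  proof (rule ccontr)
    assume nz: "x \<noteq> \<zero>\<^bsub>H\<^esub>"
    have xc: "x \<in> carrier H" using x S by auto
    define r where "r = Re (ip H x x)"
    have r: "r > 0" "ip H x x = of_real r" using ip_pos[OF xc nz] ip_self_real[OF xc] by (auto simp: r_def)
    define y where "y = complex_of_real (1 / sqrt r) \<odot>\<^bsub>H\<^esub> x"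
    have y: "y \<in> S" "y \<in> carrier H" using x S xc by (auto simp: y_def)
    have "ip H y y = of_real (1 / sqrt r) * (of_real (1 / sqrt r) * ip H x x)"
      unfolding y_def using xc by (simp only: ip_smult ip_smult_left smc complex_cnj_complex_of_real)
    also have "\<dots> = of_real (1 / sqrt r * (1 / sqrt r * r))"
      by (simp only: r(2) of_real_mult)
    also have "1 / sqrt r * (1 / sqrt r * r) = 1" using r(1) by (simp add: divide_simps)
    finally have yy: "ip H y y = 1" by simp
    have ey: "ip H e y = 0" "ip H y e = 0" if "e \<in> B" for e
    proof -
      have e: "e \<in> carrier H" using that B(1) S by (auto simp: P_def)
      show *: "ip H e y = 0" unfolding y_def using e xc x that by (simp add: ip_smult)
      show "ip H y e = 0" using ip_cnj[OF y(2) e] * by simp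
    qed
    have "y \<notin> B" using ey yy by force
    have "P (insert y B)" using B(1) y yy ey unfolding P_def by auto
    from B(2)[OF this] have "card (insert y B) \<le> card B" .
    thus False using \<open>y \<notin> B\<close> B(1) by (simp add: P_def)
  qed
  with B(1) show ?thesis using that unfolding P_def by blast
qed

lemma onb_exists: "\<exists>B. onb H B"
proof -
  obtain B where "finite B" "B \<subseteq> carrier H" "\<forall>e\<in>B. \<forall>f\<in>B. ip H e f = (if e = f then 1 else 0)"
    "\<And>x. x \<in> carrier H \<Longrightarrow> (\<forall>e\<in>B. ip H e x = 0) \<Longrightarrow> x = \<zero>\<^bsub>H\<^esub>"
    by (rule onb_subspace[OF subset_refl], erule smc, rule that)
  hence "onb H B" unfolding onb_def by blast
  thus ?thesis ..
qed

lemma total_closed: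
  assumes tot: "is_total H X \<phi>"
    and S: "S \<subseteq> carrier H" "\<zero>\<^bsub>H\<^esub> \<in> S" "\<And>x y. x \<in> S \<Longrightarrow> y \<in> S \<Longrightarrow> x \<oplus>\<^bsub>H\<^esub> y \<in> S"
      "\<And>x c. x \<in> S \<Longrightarrow> c \<odot>\<^bsub>H\<^esub> x \<in> S" "\<And>t. t \<in> X \<Longrightarrow> \<phi> t \<in> S"
    and x: "x \<in> carrier H"
  shows "x \<in> S"
proof -
  obtain B where B: "finite B" "B \<subseteq> S" "\<forall>e\<in>B. \<forall>f\<in>B. ip H e f = (if e = f then 1 else 0)"
    "\<And>x. x \<in> S \<Longrightarrow> (\<forall>e\<in>B. ip H e x = 0) \<Longrightarrow> x = \<zero>\<^bsub>H\<^esub>"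
    by (rule onb_subspace[OF S(1)], erule S(4), rule that)
  have Bc: "b \<in> B \<Longrightarrow> b \<in> carrier H" for b using B S by auto
  define p where "p y = finsum H (\<lambda>e. ip H e y \<odot>\<^bsub>H\<^esub> e) B" for y
  have sumS: "finsum H f A \<in> S" if "finite A" "\<forall>a\<in>A. f a \<in> S" for f and A :: "'v set"
    using that
  proof (induct A rule: finite_induct)
    case (insert a A)
    have "finsum H f (insert a A) = f a \<oplus>\<^bsub>H\<^esub> finsum H f A"
      using insert S(1) by (intro finsum_insert) auto
    thus ?case using insert S by simp
  qed (simp add: S)
  have pS: "p y \<in> S" for y unfolding p_def using B S by (intro sumS) auto
  have pc: "p y \<in> carrier H" for y using pS S by auto
  have ep: "ip H e (p y) = ip H e y" if "e \<in> B" for e y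
  proof -
    have "ip H e (p y) = (\<Sum>b\<in>B. ip H e (ip H b y \<odot>\<^bsub>H\<^esub> b))"
      unfolding p_def using that Bc B by (intro ip_finsum) auto
    also have "\<dots> = (\<Sum>b\<in>B. if b = e then ip H b y else 0)"
      using that B Bc by (intro sum.cong refl) (auto simp: ip_smult)
    finally show ?thesis using that B by simp
  qed
  define w where "w y = y \<oplus>\<^bsub>H\<^esub> (-1) \<odot>\<^bsub>H\<^esub> p y" for y
  have wc: "w y \<in> carrier H" if "y \<in> carrier H" for y using that pc by (simp add: w_def)
  have ew: "ip H e (w y) = 0" if "e \<in> B" "y \<in> carrier H" for e y
    using that ip_diff[of y "p y" e] Bc pc ep by (simp add: w_def)
  have yp: "y = p y" if "y \<in> S" for y
  proof (rule diff_zero)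
    show "y \<in> carrier H" "p y \<in> carrier H" using that S pc by auto
    have "w y \<in> S" unfolding w_def using that S pS by blast
    thus "y \<oplus>\<^bsub>H\<^esub> (-1) \<odot>\<^bsub>H\<^esub> p y = \<zero>\<^bsub>H\<^esub>" using B(4)[of "w y"] ew that S by (auto simp: w_def)
  qed
  have "ip H y (w x) = 0" if "y \<in> S" for y
  proof -
    have yc: "y \<in> carrier H" using that S by auto
    have "ip H (w x) (p y) = (\<Sum>b\<in>B. ip H (w x) (ip H b y \<odot>\<^bsub>H\<^esub> b))"
      unfolding p_def using that Bc B wc x by (intro ip_finsum) auto
    also have "\<dots> = 0"
    proof (rule sum.neutral, rule ballI)
      fix b assume b: "b \<in> B"
      have "ip H (w x) b = 0" using ip_cnj[OF wc[OF x] Bc[OF b]] ew[OF b x] by simp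
      thus "ip H (w x) (ip H b y \<odot>\<^bsub>H\<^esub> b) = 0" using wc x Bc b by (simp add: ip_smult)
    qed
    finally show ?thesis using yp[OF that] ip_cnj[OF yc wc[OF x]] by simp
  qed
  hence "w x = \<zero>\<^bsub>H\<^esub>" using tot wc x S(5) unfolding is_total_def by blast
  hence "x = p x" using diff_zero[of x "p x"] x pc by (simp add: w_def)
  thus ?thesis using pS by metis
qed

lemma is_totalb: "onb H B \<Longrightarrow> is_total H B (\<lambda>e. e)"
  unfolding onb_def is_total_def by auto

lemma total_surj: "(\<And>t. t \<in> X \<Longrightarrow> \<phi> t \<in> carrier H) \<Longrightarrow> carrier H \<subseteq> \<phi> ` X \<Longrightarrow> is_total H X \<phi>"
  unfolding is_total_def using ip_self_zero by blast

lemma onb_expand: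
  assumes B: "onb H B" and x: "x \<in> carrier H"
  shows "x = finsum H (\<lambda>e. ip H e x \<odot>\<^bsub>H\<^esub> e) B"
proof -
  have B': "finite B" "\<And>b. b \<in> B \<Longrightarrow> b \<in> carrier H"
    "\<And>e f. e \<in> B \<Longrightarrow> f \<in> B \<Longrightarrow> ip H e f = (if e = f then 1 else 0)"
    "\<And>x. x \<in> carrier H \<Longrightarrow> (\<forall>e\<in>B. ip H e x = 0) \<Longrightarrow> x = \<zero>\<^bsub>H\<^esub>"
    using B by (auto simp: onb_def)
  define p where "p = finsum H (\<lambda>e. ip H e x \<odot>\<^bsub>H\<^esub> e) B"
  have pc: "p \<in> carrier H" unfolding p_def by (intro finsum_closed') (auto simp: B')
  have ep: "ip H e p = ip H e x" if "e \<in> B" for e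
  proof -
    have "ip H e p = (\<Sum>b\<in>B. ip H e (ip H b x \<odot>\<^bsub>H\<^esub> b))"
      unfolding p_def using that B' by (intro ip_finsum) auto
    also have "\<dots> = (\<Sum>b\<in>B. if b = e then ip H b x else 0)"
      using that B' by (intro sum.cong refl) (auto simp: ip_smult)
    finally show ?thesis using that B' by simp
  qed
  have "x \<oplus>\<^bsub>H\<^esub> (-1) \<odot>\<^bsub>H\<^esub> p = \<zero>\<^bsub>H\<^esub>"
    by (rule B'(4)) (use pc x B' ep in \<open>auto simp: ip_diff\<close>)
  thus ?thesis using diff_zero[OF x pc] by (simp add: p_def)
qed

lemma parseval:
  assumes B: "onb H B" and "x \<in> carrier H" "y \<in> carrier H"
  shows "ip H x y = (\<Sum>e\<in>B. ip H x e * ip H e y)"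
proof -
  have B': "finite B" "\<And>b. b \<in> B \<Longrightarrow> b \<in> carrier H" using B by (auto simp: onb_def)
  have "ip H x y = ip H x (finsum H (\<lambda>e. ip H e y \<odot>\<^bsub>H\<^esub> e) B)"
    using onb_expand[OF B assms(3)] by simp
  also have "\<dots> = (\<Sum>e\<in>B. ip H x (ip H e y \<odot>\<^bsub>H\<^esub> e))"
    using assms B' by (intro ip_finsum) auto
  also have "\<dots> = (\<Sum>e\<in>B. ip H x e * ip H e y)"
    using assms B' by (intro sum.cong) (auto simp: ip_smult)
  finally show ?thesis .
qed

lemma onb_dim:
  assumes B: "onb H B" shows "dim = card B"
proof -
  have B': "finite B" "B \<subseteq> carrier H" "\<forall>e\<in>B. \<forall>f\<in>B. ip H e f = (if e = f then 1 else 0)"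
    using B by (auto simp: onb_def)
  have "x \<in> span B" if "x \<in> carrier H" for x
    using onb_expand[OF B that] B' unfolding finite_span[OF B'(1,2)] lincomb_def by auto
  hence "gen_set B" using span_is_subset2[OF B'(2)] by auto
  hence "basis B" using ortho_card(1)[OF B'] B' by (simp add: basis_def)
  thus ?thesis using dim_basis[OF B'(1)] by simp
qed

end

lemma fd_hilbertI:
  fixes H :: "'v hilb"
  assumes vs: "vectorspace (class_ring :: complex ring) H"
    and a1: "\<And>x y. x \<in> carrier H \<Longrightarrow> y \<in> carrier H \<Longrightarrow> ip H x y = cnj (ip H y x)"
    and a2: "\<And>x y z. x \<in> carrier H \<Longrightarrow> y \<in> carrier H \<Longrightarrow> z \<in> carrier H \<Longrightarrow>
      ip H x (y \<oplus>\<^bsub>H\<^esub> z) = ip H x y + ip H x z"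
    and a3: "\<And>c x y. x \<in> carrier H \<Longrightarrow> y \<in> carrier H \<Longrightarrow>
      ip H x (c \<odot>\<^bsub>H\<^esub> y) = c * ip H x y"
    and a4: "\<And>x. x \<in> carrier H \<Longrightarrow> x \<noteq> \<zero>\<^bsub>H\<^esub> \<Longrightarrow> Re (ip H x x) > 0"
    and B: "onb H B"
  shows "fd_hilbert H"
proof -
  interpret vectorspace "class_ring :: complex ring" H by (rule vs)
  have smc: "c \<odot>\<^bsub>H\<^esub> x \<in> carrier H" if "x \<in> carrier H" for c x
    using smult_closed[of c x] that by simp
  have zs: "0 \<odot>\<^bsub>H\<^esub> x = \<zero>\<^bsub>H\<^esub>" if "x \<in> carrier H" for x
    using lmult_0[of x] that by simp
  have ipz: "ip H x \<zero>\<^bsub>H\<^esub> = 0" if "x \<in> carrier H" for x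
    using a3[of x "\<zero>\<^bsub>H\<^esub>" 0] zs[of "\<zero>\<^bsub>H\<^esub>"] that by simp
  have B': "finite B" "B \<subseteq> carrier H" "\<And>b. b \<in> B \<Longrightarrow> b \<in> carrier H"
    "\<And>e f. e \<in> B \<Longrightarrow> f \<in> B \<Longrightarrow> ip H e f = (if e = f then 1 else 0)"
    "\<And>x. x \<in> carrier H \<Longrightarrow> (\<forall>e\<in>B. ip H e x = 0) \<Longrightarrow> x = \<zero>\<^bsub>H\<^esub>"
    using B by (auto simp: onb_def)
  have ipf: "ip H x (finsum H f A) = (\<Sum>a\<in>A. ip H x (f a))"
    if "x \<in> carrier H" "finite A" "\<And>a. a \<in> A \<Longrightarrow> f a \<in> carrier H" for x f and A :: "'v set"
    using that(2,3)
  proof (induct A rule: finite_induct)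
    case (insert a A)
    have "finsum H f (insert a A) = f a \<oplus>\<^bsub>H\<^esub> finsum H f A"
      using insert by (intro finsum_insert) auto
    thus ?case using insert that(1) by (auto simp: a2)
  qed (simp add: that(1) ipz)
  have exp: "x = finsum H (\<lambda>e. ip H e x \<odot>\<^bsub>H\<^esub> e) B" if x: "x \<in> carrier H" for x
  proof -
    define p where "p = finsum H (\<lambda>e. ip H e x \<odot>\<^bsub>H\<^esub> e) B"
    have pc: "p \<in> carrier H" unfolding p_def by (intro finsum_closed) (auto simp: B' smc)
    have ep: "ip H e p = ip H e x" if "e \<in> B" for e
    proof -
      have "ip H e p = (\<Sum>b\<in>B. ip H e (ip H b x \<odot>\<^bsub>H\<^esub> b))"
        unfolding p_def using that B' smc by (intro ipf) auto
      also have "\<dots> = (\<Sum>b\<in>B. if b = e then ip H b x else 0)"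
        using that B' by (intro sum.cong refl) (auto simp: a3)
      finally show ?thesis using that B' by simp
    qed
    have w: "x \<oplus>\<^bsub>H\<^esub> (-1) \<odot>\<^bsub>H\<^esub> p = \<zero>\<^bsub>H\<^esub>"
      by (rule B'(5)) (use pc x B' ep smc in \<open>auto simp: a2 a3\<close>)
    have "p \<oplus>\<^bsub>H\<^esub> (-1) \<odot>\<^bsub>H\<^esub> p = (1 + -1) \<odot>\<^bsub>H\<^esub> p"
      using smult_l_distr[of 1 "-1" p] smult_one[of p] pc by simp
    also have "\<dots> = \<zero>\<^bsub>H\<^esub>" using zs pc by simp
    finally have "x \<oplus>\<^bsub>H\<^esub> (-1) \<odot>\<^bsub>H\<^esub> p = p \<oplus>\<^bsub>H\<^esub> (-1) \<odot>\<^bsub>H\<^esub> p" using w by simp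
    hence "x = p" using x pc smc by (simp add: M.add.right_cancel)
    thus ?thesis by (simp add: p_def)
  qed
  have "x \<in> span B" if "x \<in> carrier H" for x
    using exp[OF that] B' unfolding finite_span[OF B'(1,2)] lincomb_def by auto
  hence "gen_set B" using span_is_subset2[OF B'(2)] by auto
  hence "fin_dim" using B' unfolding fin_dim_def by blast
  thus ?thesis by unfold_locales (auto intro: a1 a2 a3 a4)
qed

lemma unitaryD:
  assumes "unitary H H' U"
  shows "\<And>x. x \<in> carrier H \<Longrightarrow> U x \<in> carrier H'"
    and "\<And>x y. x \<in> carrier H \<Longrightarrow> y \<in> carrier H \<Longrightarrow> U (x \<oplus>\<^bsub>H\<^esub> y) = U x \<oplus>\<^bsub>H'\<^esub> U y"
    and "\<And>x c. x \<in> carrier H \<Longrightarrow> U (c \<odot>\<^bsub>H\<^esub> x) = c \<odot>\<^bsub>H'\<^esub> U x"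
    and "\<And>x y. x \<in> carrier H \<Longrightarrow> y \<in> carrier H \<Longrightarrow> ip H' (U x) (U y) = ip H x y"
    and "bij_betw U (carrier H) (carrier H')"
  using assms unfolding unitary_def LinearCombinations.module_hom_def by auto

lemma unitaryI:
  assumes "\<And>x. x \<in> carrier H \<Longrightarrow> U x \<in> carrier H'"
    and "\<And>x y. x \<in> carrier H \<Longrightarrow> y \<in> carrier H \<Longrightarrow> U (x \<oplus>\<^bsub>H\<^esub> y) = U x \<oplus>\<^bsub>H'\<^esub> U y"
    and "\<And>x c. x \<in> carrier H \<Longrightarrow> U (c \<odot>\<^bsub>H\<^esub> x) = c \<odot>\<^bsub>H'\<^esub> U x"
    and "\<And>x y. x \<in> carrier H \<Longrightarrow> y \<in> carrier H \<Longrightarrow> ip H' (U x) (U y) = ip H x y"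
    and "bij_betw U (carrier H) (carrier H')"
  shows "unitary H H' U"
  using assms unfolding unitary_def LinearCombinations.module_hom_def by auto

lemma unitary_cong:
  assumes "unitary H H' U" "\<And>x. x \<in> carrier H \<Longrightarrow> V x = U x" "fd_hilbert H"
  shows "unitary H H' V"
proof -
  interpret fd_hilbert H by fact
  note U = unitaryD[OF assms(1)]
  have "bij_betw V (carrier H) (carrier H')"
    using U(5) assms(2) bij_betw_cong by metis
  thus ?thesis using U assms(2) by (intro unitaryI) auto
qed

lemma unitary_id: "unitary H H (\<lambda>x. x)"
  by (rule unitaryI) (auto simp: bij_betw_def inj_on_def)

lemma unitary_comp:
  assumes "unitary H H' U" "unitary H' H'' V"
  shows "unitary H H'' (\<lambda>x. V (U x))"
  using unitaryD[OF assms(1)] unitaryD[OF assms(2)] bij_betw_trans[of U "carrier H" "carrier H'" V]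
  by (intro unitaryI) (auto simp: o_def)

lemma unitary_inv:
  assumes "unitary H H' U" "fd_hilbert H"
  shows "unitary H' H (inv_into (carrier H) U)"
    and "\<And>x. x \<in> carrier H \<Longrightarrow> inv_into (carrier H) U (U x) = x"
    and "\<And>y. y \<in> carrier H' \<Longrightarrow> U (inv_into (carrier H) U y) = y"
proof -
  interpret fd_hilbert H by fact
  note U = unitaryD[OF assms(1)]
  let ?V = "inv_into (carrier H) U"
  show 1: "?V (U x) = x" if "x \<in> carrier H" for x
    using U(5) that by (simp add: bij_betw_def)
  show 2: "U (?V y) = y" if "y \<in> carrier H'" for y
    using U(5) that by (simp add: bij_betw_def f_inv_into_f)
  have 3: "?V y \<in> carrier H" if "y \<in> carrier H'" for y
    using U(5) that inv_into_into[of y U "carrier H"] by (simp add: bij_betw_def)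
  show "unitary H' H ?V"
  proof (rule unitaryI)
    fix x y c assume x: "x \<in> carrier H'"
    have "?V (U (c \<odot>\<^bsub>H\<^esub> ?V x)) = c \<odot>\<^bsub>H\<^esub> ?V x" using x 3 by (intro 1) auto
    thus "?V (c \<odot>\<^bsub>H'\<^esub> x) = c \<odot>\<^bsub>H\<^esub> ?V x" using U(3) x 2 3 by simp
    assume y: "y \<in> carrier H'"
    have "?V (U (?V x \<oplus>\<^bsub>H\<^esub> ?V y)) = ?V x \<oplus>\<^bsub>H\<^esub> ?V y" using x y 3 by (intro 1) auto
    thus "?V (x \<oplus>\<^bsub>H'\<^esub> y) = ?V x \<oplus>\<^bsub>H\<^esub> ?V y" using U(2) x y 2 3 by simp
    show "ip H (?V x) (?V y) = ip H' x y" using U(4)[of "?V x" "?V y"] x y 2 3 by simp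
  qed (use 3 U(5) bij_betw_inv_into in auto)
qed

subsection \<open>Total families and unitaries with prescribed values\<close>

lemma linear_total_eq:
  assumes "fd_hilbert H" "fd_hilbert H'" "is_total H X \<phi>" "unitary H H' U" "unitary H H' V"
    and "\<And>t. t \<in> X \<Longrightarrow> U (\<phi> t) = V (\<phi> t)" and x: "x \<in> carrier H"
  shows "U x = V x"
proof -
  interpret H: fd_hilbert H by fact
  interpret H': fd_hilbert H' by fact
  note U = unitaryD[OF assms(4)] and V = unitaryD[OF assms(5)]
  have "x \<in> {x \<in> carrier H. U x = V x}"
  proof (rule H.total_closed[OF assms(3)])
    show "\<zero>\<^bsub>H\<^esub> \<in> {x \<in> carrier H. U x = V x}"
      using U(3)[of "\<zero>\<^bsub>H\<^esub>" 0] V(3)[of "\<zero>\<^bsub>H\<^esub>" 0] U(1)[of "\<zero>\<^bsub>H\<^esub>"] V(1)[of "\<zero>\<^bsub>H\<^esub>"]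
      by (simp add: H.zero_smult H'.zero_smult)
  qed (use U V assms(3,6) x in \<open>auto simp: is_total_def\<close>)
  thus ?thesis by simp
qed

lemma total_eqI:
  assumes "fd_hilbert H" "is_total H X \<phi>" "x \<in> carrier H" "y \<in> carrier H"
    "\<And>t. t \<in> X \<Longrightarrow> ip H (\<phi> t) x = ip H (\<phi> t) y"
  shows "x = y"
proof -
  interpret fd_hilbert H by fact
  have "\<And>t. t \<in> X \<Longrightarrow> \<phi> t \<in> carrier H" using assms(2) by (simp add: is_total_def)
  hence "x \<oplus>\<^bsub>H\<^esub> (-1) \<odot>\<^bsub>H\<^esub> y = \<zero>\<^bsub>H\<^esub>"
    using assms unfolding is_total_def by (simp add: ip_diff)
  thus ?thesis using diff_zero assms by blast
qed

lemma gram_ex: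
  assumes "fd_hilbert H" "fd_hilbert H'" and tot: "is_total H X \<phi>" "is_total H' X \<psi>"
    and gram: "\<And>s t. s \<in> X \<Longrightarrow> t \<in> X \<Longrightarrow> ip H (\<phi> s) (\<phi> t) = ip H' (\<psi> s) (\<psi> t)"
    and x: "x \<in> carrier H"
  shows "\<exists>y\<in>carrier H'. \<forall>t\<in>X. ip H' (\<psi> t) y = ip H (\<phi> t) x"
proof -
  interpret H: fd_hilbert H by fact
  interpret H': fd_hilbert H' by fact
  have c: "\<And>t. t \<in> X \<Longrightarrow> \<phi> t \<in> carrier H" "\<And>t. t \<in> X \<Longrightarrow> \<psi> t \<in> carrier H'"
    using tot by (auto simp: is_total_def)
  let ?S = "{x \<in> carrier H. \<exists>y\<in>carrier H'. \<forall>t\<in>X. ip H' (\<psi> t) y = ip H (\<phi> t) x}"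
  have "x \<in> ?S"
  proof (rule H.total_closed[OF tot(1)])
    show "\<zero>\<^bsub>H\<^esub> \<in> ?S" using c by (auto intro!: bexI[of _ "\<zero>\<^bsub>H'\<^esub>"])
    fix x assume x: "x \<in> ?S"
    then obtain y where y: "y \<in> carrier H'" "\<forall>t\<in>X. ip H' (\<psi> t) y = ip H (\<phi> t) x" by auto
    show "c \<odot>\<^bsub>H\<^esub> x \<in> ?S" for c using x y c
      by (auto simp: H.ip_smult H'.ip_smult intro!: bexI[of _ "c \<odot>\<^bsub>H'\<^esub> y"])
    fix x' assume x': "x' \<in> ?S"
    then obtain y' where y': "y' \<in> carrier H'" "\<forall>t\<in>X. ip H' (\<psi> t) y' = ip H (\<phi> t) x'" by auto
    show "x \<oplus>\<^bsub>H\<^esub> x' \<in> ?S" using x y x' y' c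
      by (auto simp: H.ip_add H'.ip_add intro!: bexI[of _ "y \<oplus>\<^bsub>H'\<^esub> y'"])
  next
    fix t assume "t \<in> X"
    thus "\<phi> t \<in> ?S" using c gram by (auto intro!: bexI[of _ "\<psi> t"])
  qed (use x in auto)
  thus ?thesis by simp
qed

lemma gram:
  assumes fd: "fd_hilbert H" "fd_hilbert H'" and tot: "is_total H X \<phi>" "is_total H' X \<psi>"
    and gram: "\<And>s t. s \<in> X \<Longrightarrow> t \<in> X \<Longrightarrow> ip H (\<phi> s) (\<phi> t) = ip H' (\<psi> s) (\<psi> t)"
  shows "\<exists>U. unitary H H' U \<and> (\<forall>t\<in>X. U (\<phi> t) = \<psi> t)"
proof -
  interpret H: fd_hilbert H by fact
  interpret H': fd_hilbert H' by fact
  have c: "\<And>t. t \<in> X \<Longrightarrow> \<phi> t \<in> carrier H" "\<And>t. t \<in> X \<Longrightarrow> \<psi> t \<in> carrier H'"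
    using tot by (auto simp: is_total_def)
  obtain U where U: "\<And>x. x \<in> carrier H \<Longrightarrow> U x \<in> carrier H'"
    "\<And>x t. x \<in> carrier H \<Longrightarrow> t \<in> X \<Longrightarrow> ip H' (\<psi> t) (U x) = ip H (\<phi> t) x"
    using gram_ex[OF assms] by metis
  have eq: "U x = y" if "x \<in> carrier H" "y \<in> carrier H'"
    "\<And>t. t \<in> X \<Longrightarrow> ip H' (\<psi> t) y = ip H (\<phi> t) x" for x y
    using total_eqI[OF fd(2) tot(2) U(1)[OF that(1)] that(2)] that U(2) by simp
  have U\<phi>: "U (\<phi> t) = \<psi> t" if "t \<in> X" for t
    by (rule eq) (use that c gram in auto)
  have add: "U (x \<oplus>\<^bsub>H\<^esub> y) = U x \<oplus>\<^bsub>H'\<^esub> U y" if "x \<in> carrier H" "y \<in> carrier H" for x y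
    by (rule eq) (use that c U in \<open>auto simp: H.ip_add H'.ip_add\<close>)
  have smult: "U (a \<odot>\<^bsub>H\<^esub> x) = a \<odot>\<^bsub>H'\<^esub> U x" if "x \<in> carrier H" for x a
    by (rule eq) (use that c U in \<open>auto simp: H.ip_smult H'.ip_smult\<close>)
  have "U \<zero>\<^bsub>H\<^esub> = \<zero>\<^bsub>H'\<^esub>" by (rule eq) (use c in auto)
  have ip: "ip H' (U x) (U y) = ip H x y" if x: "x \<in> carrier H" and y: "y \<in> carrier H" for x y
  proof -
    let ?S = "{y \<in> carrier H. ip H' (U x) (U y) = ip H x y}"
    have "y \<in> ?S"
    proof (rule H.total_closed[OF tot(1)])
      fix t assume t: "t \<in> X"
      have "ip H' (U x) (\<psi> t) = ip H x (\<phi> t)"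
        using H'.ip_cnj[OF U(1)[OF x] c(2)[OF t]] H.ip_cnj[OF x c(1)[OF t]] U(2)[OF x t] by simp
      thus "\<phi> t \<in> ?S" using t c U\<phi> by simp
    qed (use x y U add smult \<open>U \<zero>\<^bsub>H\<^esub> = \<zero>\<^bsub>H'\<^esub>\<close> in
        \<open>auto simp: H.ip_add H'.ip_add H.ip_smult H'.ip_smult\<close>)
    thus ?thesis by simp
  qed
  have inj: "inj_on U (carrier H)"
  proof (rule inj_onI)
    fix x y assume xy: "x \<in> carrier H" "y \<in> carrier H" "U x = U y"
    show "x = y" by (rule total_eqI[OF fd(1) tot(1) xy(1,2)]) (use U(2) xy in metis)
  qed
  have surj: "y \<in> U ` carrier H" if y: "y \<in> carrier H'" for y
  proof -
    from gram_ex[OF fd(2,1) tot(2,1) gram[symmetric] y] obtain x where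
      x: "x \<in> carrier H" "\<forall>t\<in>X. ip H (\<phi> t) x = ip H' (\<psi> t) y" by auto
    have "U x = y" by (rule eq) (use x y in auto)
    thus ?thesis using x by auto
  qed
  have "bij_betw U (carrier H) (carrier H')" using inj surj U(1) by (auto simp: bij_betw_def)
  thus ?thesis using U add smult ip U\<phi> by (intro exI[of _ U] conjI unitaryI) auto
qed

lemma unitary_dim:
  assumes "fd_hilbert H" "fd_hilbert H'" "unitary H H' U"
  shows "hdim H = hdim H'"
proof -
  interpret H: fd_hilbert H by fact
  interpret H': fd_hilbert H' by fact
  note U = unitaryD[OF assms(3)]
  obtain B where B: "onb H B" using H.onb_exists by auto
  have Bc: "b \<in> B \<Longrightarrow> b \<in> carrier H" for b using B by (auto simp: onb_def)
  have inj: "inj_on U B" using U(5) Bc by (auto simp: bij_betw_def inj_on_def)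
  have "onb H' (U ` B)" unfolding onb_def
  proof (intro conjI ballI impI)
    show "finite (U ` B)" "U ` B \<subseteq> carrier H'" using B U Bc by (auto simp: onb_def)
    fix e f assume "e \<in> U ` B" "f \<in> U ` B"
    thus "ip H' e f = (if e = f then 1 else 0)"
      using B U Bc inj by (auto simp: onb_def inj_on_def)
  next
    fix y assume y: "y \<in> carrier H'" "\<forall>e\<in>U ` B. ip H' e y = 0"
    then obtain x where x: "x \<in> carrier H" "y = U x" using U(5) by (auto simp: bij_betw_def)
    have "x = \<zero>\<^bsub>H\<^esub>" using x y B U Bc unfolding onb_def by (metis image_eqI)
    thus "y = \<zero>\<^bsub>H'\<^esub>" using U(3)[of "\<zero>\<^bsub>H\<^esub>" 0] x H.zero_smult H'.zero_smult y by simp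
  qed
  thus ?thesis using H.onb_dim[OF B] H'.onb_dim card_image[OF inj] by simp
qed

subsection \<open>Standard spaces, direct sums, tensor products, exterior powers\<close>

definition Cspace :: "nat \<Rightarrow> complex vec hilb" where
  "Cspace n = module.extend (module_vec TYPE(complex) n) \<lparr>ip = (\<lambda>x y. y \<bullet>c x)\<rparr>"

definition hsum :: "'v hilb \<Rightarrow> 'w hilb \<Rightarrow> ('v \<times> 'w) hilb" where
  "hsum H H' = \<lparr>carrier = carrier H \<times> carrier H', mult = undefined, one = undefined,
     zero = (\<zero>\<^bsub>H\<^esub>, \<zero>\<^bsub>H'\<^esub>),
     add = (\<lambda>p q. (fst p \<oplus>\<^bsub>H\<^esub> fst q, snd p \<oplus>\<^bsub>H'\<^esub> snd q)),
     smult = (\<lambda>c p. (c \<odot>\<^bsub>H\<^esub> fst p, c \<odot>\<^bsub>H'\<^esub> snd p)),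
     ip = (\<lambda>p q. ip H (fst p) (fst q) + ip H' (snd p) (snd q))\<rparr>"

definition some_onb :: "'v hilb \<Rightarrow> 'v set" where
  "some_onb H = (SOME B. onb H B)"

text \<open>The tensor product, realised as in Reed and Simon, Section II.4, by conjugate-bilinear forms:
  the elementary tensor of \<open>x\<close> and \<open>y\<close> is the form sending \<open>u\<close>, \<open>v\<close> to the product of the inner products
  of \<open>u\<close> with \<open>x\<close> and of \<open>v\<close> with \<open>y\<close> (\<open>elem_tensor\<close> below). In finite dimension the elementary
  tensors span all conjugate-bilinear forms (\<open>elem_total_id\<close>), and the inner product below, which does not depend on the
  orthonormal bases, is the one making the inner product of two elementary tensors the product of the
  inner products of the factors (\<open>elem_gram\<close>). Forms are extended by 0 outside the carriers.\<close>

definition htensor :: "'v hilb \<Rightarrow> 'w hilb \<Rightarrow> ('v \<Rightarrow> 'w \<Rightarrow> complex) hilb" where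
  "htensor H H' = \<lparr>carrier = {f.
       (\<forall>u v. \<not> (u \<in> carrier H \<and> v \<in> carrier H') \<longrightarrow> f u v = 0) \<and>
       (\<forall>u\<in>carrier H. \<forall>u'\<in>carrier H. \<forall>v\<in>carrier H'. f (u \<oplus>\<^bsub>H\<^esub> u') v = f u v + f u' v) \<and>
       (\<forall>u\<in>carrier H. \<forall>v\<in>carrier H'. \<forall>v'\<in>carrier H'. f u (v \<oplus>\<^bsub>H'\<^esub> v') = f u v + f u v') \<and>
       (\<forall>c. \<forall>u\<in>carrier H. \<forall>v\<in>carrier H'.
          f (c \<odot>\<^bsub>H\<^esub> u) v = cnj c * f u v \<and> f u (c \<odot>\<^bsub>H'\<^esub> v) = cnj c * f u v)},
     mult = undefined, one = undefined,
     zero = (\<lambda>u v. 0), add = (\<lambda>f g u v. f u v + g u v), smult = (\<lambda>c f u v. c * f u v),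
     ip = (\<lambda>f g. \<Sum>e\<in>some_onb H. \<Sum>e'\<in>some_onb H'. cnj (f e e') * g e e')\<rparr>"

text \<open>The tensor product of two unitaries; it maps the elementary tensor of \<open>x\<close> and \<open>y\<close> to that of
  \<open>U x\<close> and \<open>V y\<close> (lemma \<open>tensor_map\<close>).\<close>

definition tensor_map ::
  "'v hilb \<Rightarrow> 'w hilb \<Rightarrow> 'x hilb \<Rightarrow> 'y hilb \<Rightarrow> ('v \<Rightarrow> 'x) \<Rightarrow> ('w \<Rightarrow> 'y) \<Rightarrow> ('v \<Rightarrow> 'w \<Rightarrow> complex) \<Rightarrow> 'x \<Rightarrow> 'y \<Rightarrow> complex" where
  "tensor_map H H' K K' U V f = (\<lambda>u v. if u \<in> carrier K \<and> v \<in> carrier K'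
     then f (inv_into (carrier H) U u) (inv_into (carrier H') V v) else 0)"

text \<open>Tensor powers, realised in the same way by conjugate-multilinear forms on lists of length \<open>k\<close>,
  and the exterior power as the subspace of antisymmetric tensors. For \<open>k = 0\<close> both are
  one-dimensional (the only argument is the empty list).\<close>

definition htensor_power :: "nat \<Rightarrow> 'v hilb \<Rightarrow> ('v list \<Rightarrow> complex) hilb" where
  "htensor_power k H = \<lparr>carrier = {f.
       (\<forall>us. \<not> (length us = k \<and> set us \<subseteq> carrier H) \<longrightarrow> f us = 0) \<and>
       (\<forall>us i. length us = k \<and> set us \<subseteq> carrier H \<and> i < k \<longrightarrow>
          (\<forall>x\<in>carrier H. \<forall>y\<in>carrier H. f (us[i := x \<oplus>\<^bsub>H\<^esub> y]) = f (us[i := x]) + f (us[i := y])) \<and>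
          (\<forall>c. \<forall>x\<in>carrier H. f (us[i := c \<odot>\<^bsub>H\<^esub> x]) = cnj c * f (us[i := x])))},
     mult = undefined, one = undefined,
     zero = (\<lambda>us. 0), add = (\<lambda>f g us. f us + g us), smult = (\<lambda>c f us. c * f us),
     ip = (\<lambda>f g. \<Sum>us | set us \<subseteq> some_onb H \<and> length us = k. cnj (f us) * g us)\<rparr>"

definition hext_power :: "nat \<Rightarrow> 'v hilb \<Rightarrow> ('v list \<Rightarrow> complex) hilb" where
  "hext_power k H = (htensor_power k H)\<lparr>carrier :=
     {f \<in> carrier (htensor_power k H). \<forall>p us. p permutes {..<k} \<and> length us = k \<longrightarrow>
        f (permute_list p us) = of_int (sign p) * f us}\<rparr>"

definition tensor_power_map ::
  "nat \<Rightarrow> 'v hilb \<Rightarrow> 'w hilb \<Rightarrow> ('v \<Rightarrow> 'w) \<Rightarrow> ('v list \<Rightarrow> complex) \<Rightarrow> 'w list \<Rightarrow> complex" where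
  "tensor_power_map k H K U f = (\<lambda>us. if length us = k \<and> set us \<subseteq> carrier K
     then f (map (inv_into (carrier H) U) us) else 0)"

subsection \<open>Properties of the constructions\<close>


lemma Cspace_simps [simp]:
  "carrier (Cspace n) = carrier_vec n" "zero (Cspace n) = 0\<^sub>v n" "add (Cspace n) = (+)"
  "smult (Cspace n) = (\<cdot>\<^sub>v)" "ip (Cspace n) x y = y \<bullet>c x"
  by (auto simp: Cspace_def module.defs module_vec_simps)

lemma fd_Cspace: "fd_hilbert (Cspace n)"
proof (rule fd_hilbertI)
  show "vectorspace class_ring (Cspace n)"
  proof (rule vs_criteria)
    show "\<forall>v\<in>carrier (Cspace n). \<exists>neg_v\<in>carrier (Cspace n). v \<oplus>\<^bsub>Cspace n\<^esub> neg_v = \<zero>\<^bsub>Cspace n\<^esub>"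
      by (auto intro!: bexI[of _ "- v" for v])
  qed (auto simp: class_field smult_smult_assoc add_smult_distrib_vec smult_add_distrib_vec comm_add_vec)
  show "onb (Cspace n) ((\<lambda>i. unit_vec n i) ` {..<n})"
    unfolding onb_def
  proof (intro conjI ballI impI)
    fix e f :: "complex vec" assume "e \<in> unit_vec n ` {..<n}" "f \<in> unit_vec n ` {..<n}"
    then obtain i j where ij: "i < n" "j < n" "e = unit_vec n i" "f = unit_vec n j" by auto
    have "ip (Cspace n) e f = (if i = j then 1 else 0)"
      using ij by (auto simp: scalar_prod_def unit_vec_def if_distrib cong: if_cong)
    thus "ip (Cspace n) e f = (if e = f then 1 else 0)" using ij by simp
  next
    fix x assume x: "x \<in> carrier (Cspace n)" "\<forall>e\<in>unit_vec n ` {..<n}. ip (Cspace n) e x = 0"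
    have "x $ i = 0" if "i < n" for i
    proof -
      have "x \<bullet>c unit_vec n i = x $ i" using x that
        by (auto simp: scalar_prod_def unit_vec_def if_distrib cong: if_cong)
      thus ?thesis using x that by auto
    qed
    thus "x = \<zero>\<^bsub>Cspace n\<^esub>" using x by auto
  qed auto
  fix x assume x: "x \<in> carrier (Cspace n)" "x \<noteq> \<zero>\<^bsub>Cspace n\<^esub>"
  show "Re (ip (Cspace n) x x) > 0"
  proof -
    have "\<exists>i<n. x $ i \<noteq> 0" using x by (auto simp: vec_eq_iff)
    then obtain i where i: "i < n" "x $ i \<noteq> 0" by auto
    have "Re (x \<bullet>c x) = (\<Sum>i<n. (cmod (x $ i))\<^sup>2)"
      using x by (auto simp: scalar_prod_def complex_mult_cnj cmod_power2 atLeast0LessThan intro!: sum.cong)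
    also have "\<dots> > 0" using i by (intro sum_pos2[of _ i]) auto
    finally show ?thesis by simp
  qed
qed (auto simp: scalar_prod_def sum.distrib algebra_simps sum_distrib_left mult.commute)

lemma hsum_simps [simp]:
  "carrier (hsum H H') = carrier H \<times> carrier H'" "\<zero>\<^bsub>hsum H H'\<^esub> = (\<zero>\<^bsub>H\<^esub>, \<zero>\<^bsub>H'\<^esub>)"
  "p \<oplus>\<^bsub>hsum H H'\<^esub> q = (fst p \<oplus>\<^bsub>H\<^esub> fst q, snd p \<oplus>\<^bsub>H'\<^esub> snd q)"
  "c \<odot>\<^bsub>hsum H H'\<^esub> p = (c \<odot>\<^bsub>H\<^esub> fst p, c \<odot>\<^bsub>H'\<^esub> snd p)"
  "ip (hsum H H') p q = ip H (fst p) (fst q) + ip H' (snd p) (snd q)"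
  by (auto simp: hsum_def)

lemma hsum_onb:
  assumes "fd_hilbert H" "fd_hilbert H'" "onb H B" "onb H' B'"
  shows "onb (hsum H H') ((\<lambda>e. (e, \<zero>\<^bsub>H'\<^esub>)) ` B \<union> (\<lambda>e. (\<zero>\<^bsub>H\<^esub>, e)) ` B')"
proof -
  interpret H: fd_hilbert H by fact
  interpret H': fd_hilbert H' by fact
  have nz: "\<zero>\<^bsub>H\<^esub> \<notin> B" "\<zero>\<^bsub>H'\<^esub> \<notin> B'"
    using assms(3,4) unfolding onb_def by (metis H.ip_zero H.zero_closed zero_neq_one, metis H'.ip_zero H'.zero_closed zero_neq_one)
  have B: "finite B" "\<And>b. b \<in> B \<Longrightarrow> b \<in> carrier H" "\<And>e f. e \<in> B \<Longrightarrow> f \<in> B \<Longrightarrow> ip H e f = (if e = f then 1 else 0)"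
    "\<And>x. x \<in> carrier H \<Longrightarrow> (\<forall>e\<in>B. ip H e x = 0) \<Longrightarrow> x = \<zero>\<^bsub>H\<^esub>"
    using assms(3) by (auto simp: onb_def)
  have B': "finite B'" "\<And>b. b \<in> B' \<Longrightarrow> b \<in> carrier H'" "\<And>e f. e \<in> B' \<Longrightarrow> f \<in> B' \<Longrightarrow> ip H' e f = (if e = f then 1 else 0)"
    "\<And>x. x \<in> carrier H' \<Longrightarrow> (\<forall>e\<in>B'. ip H' e x = 0) \<Longrightarrow> x = \<zero>\<^bsub>H'\<^esub>"
    using assms(4) by (auto simp: onb_def)
  show ?thesis unfolding onb_def
  proof (intro conjI ballI impI)
    show "finite ((\<lambda>e. (e, \<zero>\<^bsub>H'\<^esub>)) ` B \<union> (\<lambda>e. (\<zero>\<^bsub>H\<^esub>, e)) ` B')" using B(1) B'(1) by simp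
    show "(\<lambda>e. (e, \<zero>\<^bsub>H'\<^esub>)) ` B \<union> (\<lambda>e. (\<zero>\<^bsub>H\<^esub>, e)) ` B' \<subseteq> carrier (hsum H H')"
      using B(2) B'(2) by auto
  next
    fix p q assume "p \<in> (\<lambda>e. (e, \<zero>\<^bsub>H'\<^esub>)) ` B \<union> (\<lambda>e. (\<zero>\<^bsub>H\<^esub>, e)) ` B'"
      "q \<in> (\<lambda>e. (e, \<zero>\<^bsub>H'\<^esub>)) ` B \<union> (\<lambda>e. (\<zero>\<^bsub>H\<^esub>, e)) ` B'"
    thus "ip (hsum H H') p q = (if p = q then 1 else 0)"
      using nz by (elim UnE imageE) (auto simp: B(2,3) B'(2,3))
  next
    fix x assume x: "x \<in> carrier (hsum H H')"
      "\<forall>e\<in>(\<lambda>e. (e, \<zero>\<^bsub>H'\<^esub>)) ` B \<union> (\<lambda>e. (\<zero>\<^bsub>H\<^esub>, e)) ` B'. ip (hsum H H') e x = 0"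
    have "\<forall>e\<in>B. ip H e (fst x) = 0" "\<forall>e\<in>B'. ip H' e (snd x) = 0"
      using x by (auto simp: ball_Un ball_simps)
    hence "fst x = \<zero>\<^bsub>H\<^esub>" "snd x = \<zero>\<^bsub>H'\<^esub>" using B(4) B'(4) x(1) by auto
    thus "x = \<zero>\<^bsub>hsum H H'\<^esub>" by (simp add: prod_eq_iff)
  qed
qed

lemma fd_hsum:
  assumes "fd_hilbert H" "fd_hilbert H'"
  shows "fd_hilbert (hsum H H')"
proof -
  interpret H: fd_hilbert H by fact
  interpret H': fd_hilbert H' by fact
  obtain B B' where "onb H B" "onb H' B'" using H.onb_exists H'.onb_exists by auto
  from hsum_onb[OF assms this] show ?thesis
  proof (rule fd_hilbertI[rotated 5])
    show "vectorspace class_ring (hsum H H')"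
    proof (rule vs_criteria)
      show "\<forall>v\<in>carrier (hsum H H'). \<exists>neg_v\<in>carrier (hsum H H'). v \<oplus>\<^bsub>hsum H H'\<^esub> neg_v = \<zero>\<^bsub>hsum H H'\<^esub>"
        by (auto intro!: bexI[of _ "(\<ominus>\<^bsub>H\<^esub> fst v, \<ominus>\<^bsub>H'\<^esub> snd v)" for v] simp: H.M.r_neg H'.M.r_neg)
    qed (use H.smult_l_distr H'.smult_l_distr H.smult_r_distr H'.smult_r_distr H.smult_assoc1 H'.smult_assoc1
          H.smult_one H'.smult_one in \<open>auto simp: class_field H.M.a_ac H'.M.a_ac\<close>)
    show "ip (hsum H H') x y = cnj (ip (hsum H H') y x)" if "x \<in> carrier (hsum H H')" "y \<in> carrier (hsum H H')" for x y
      using that H.ip_cnj[of "fst x" "fst y"] H'.ip_cnj[of "snd x" "snd y"] by auto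
    show "Re (ip (hsum H H') x x) > 0" if "x \<in> carrier (hsum H H')" "x \<noteq> \<zero>\<^bsub>hsum H H'\<^esub>" for x
    proof -
      obtain a b where x: "x = (a, b)" by (cases x)
      have "Re (ip H a a) \<ge> 0" "Re (ip H' b b) \<ge> 0"
        using H.ip_pos[of a] H'.ip_pos[of b] that x by (cases "a = \<zero>\<^bsub>H\<^esub>"; cases "b = \<zero>\<^bsub>H'\<^esub>"; force)+
      moreover have "Re (ip H a a) > 0 \<or> Re (ip H' b b) > 0"
        using H.ip_pos[of a] H'.ip_pos[of b] that x by auto
      ultimately show ?thesis using x by auto
    qed
  qed (auto simp: H.ip_add H'.ip_add H.ip_smult H'.ip_smult algebra_simps)
qed

lemma hsum_dim:
  assumes "fd_hilbert H" "fd_hilbert H'"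
  shows "hdim (hsum H H') = hdim H + hdim H'"
proof -
  interpret H: fd_hilbert H by fact
  interpret H': fd_hilbert H' by fact
  interpret S: fd_hilbert "hsum H H'" by (rule fd_hsum) fact+
  obtain B B' where B: "onb H B" "onb H' B'" using H.onb_exists H'.onb_exists by auto
  have nz: "\<zero>\<^bsub>H\<^esub> \<notin> B" "\<zero>\<^bsub>H'\<^esub> \<notin> B'"
    using B unfolding onb_def by (metis H.ip_zero H.zero_closed zero_neq_one, metis H'.ip_zero H'.zero_closed zero_neq_one)
  have "card ((\<lambda>e. (e, \<zero>\<^bsub>H'\<^esub>)) ` B \<union> (\<lambda>e. (\<zero>\<^bsub>H\<^esub>, e)) ` B') = card B + card B'"
    using nz B by (subst card_Un_disjoint) (auto simp: card_image inj_on_def onb_def)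
  thus ?thesis using S.onb_dim[OF hsum_onb[OF assms B]] H.onb_dim H'.onb_dim B by simp
qed

lemma htensor_simps [simp]:
  "\<zero>\<^bsub>htensor H H'\<^esub> = (\<lambda>u v. 0)" "f \<oplus>\<^bsub>htensor H H'\<^esub> g = (\<lambda>u v. f u v + g u v)"
  "c \<odot>\<^bsub>htensor H H'\<^esub> f = (\<lambda>u v. c * f u v)"
  by (auto simp: htensor_def)

definition elem_tensor :: "'v hilb \<Rightarrow> 'w hilb \<Rightarrow> 'v \<Rightarrow> 'w \<Rightarrow> 'v \<Rightarrow> 'w \<Rightarrow> complex" where
  "elem_tensor H H' x y = (\<lambda>u v. if u \<in> carrier H \<and> v \<in> carrier H' then ip H u x * ip H' v y else 0)"

lemma (in fd_hilbert) some_onb: "onb H (some_onb H)"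
  unfolding some_onb_def using onb_exists by (rule someI_ex)

lemma (in fd_hilbert) antilinear_expand:
  assumes B: "onb H B" and x: "x \<in> carrier H"
    and add: "\<And>u v. u \<in> carrier H \<Longrightarrow> v \<in> carrier H \<Longrightarrow> g (u \<oplus>\<^bsub>H\<^esub> v) = g u + (g v :: complex)"
    and sm: "\<And>c u. u \<in> carrier H \<Longrightarrow> g (c \<odot>\<^bsub>H\<^esub> u) = cnj c * g u"
  shows "g x = (\<Sum>e\<in>B. cnj (ip H e x) * g e)"
proof -
  have B': "finite B" "\<And>b. b \<in> B \<Longrightarrow> b \<in> carrier H" using B by (auto simp: onb_def)
  have g0: "g \<zero>\<^bsub>H\<^esub> = 0" using sm[of "\<zero>\<^bsub>H\<^esub>" 0] by (simp add: zero_smult)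
  have "g (finsum H f A) = (\<Sum>a\<in>A. g (f a))" if "finite A" "\<And>a. a \<in> A \<Longrightarrow> f a \<in> carrier H" for f and A :: "'v set"
    using that
  proof (induct A rule: finite_induct)
    case (insert a A)
    have "finsum H f (insert a A) = f a \<oplus>\<^bsub>H\<^esub> finsum H f A"
      using insert by (intro finsum_insert) auto
    thus ?case using insert by (simp add: add finsum_closed')
  qed (simp add: g0)
  from this[OF B'(1), of "\<lambda>e. ip H e x \<odot>\<^bsub>H\<^esub> e"] B' onb_expand[OF B x, symmetric]
  show ?thesis by (auto simp: sm intro!: sum.cong)
qed

context
  fixes H :: "'v hilb" and H' :: "'w hilb"
  assumes fd: "fd_hilbert H" "fd_hilbert H'"
begin

interpretation H: fd_hilbert H by (rule fd)
interpretation H': fd_hilbert H' by (rule fd)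

lemma htensorD:
  assumes "f \<in> carrier (htensor H H')"
  shows "\<And>u v. \<not> (u \<in> carrier H \<and> v \<in> carrier H') \<Longrightarrow> f u v = 0"
    "\<And>u u' v. u \<in> carrier H \<Longrightarrow> u' \<in> carrier H \<Longrightarrow> v \<in> carrier H' \<Longrightarrow> f (u \<oplus>\<^bsub>H\<^esub> u') v = f u v + f u' v"
    "\<And>u v' v. u \<in> carrier H \<Longrightarrow> v \<in> carrier H' \<Longrightarrow> v' \<in> carrier H' \<Longrightarrow> f u (v \<oplus>\<^bsub>H'\<^esub> v') = f u v + f u v'"
    "\<And>c u v. u \<in> carrier H \<Longrightarrow> v \<in> carrier H' \<Longrightarrow> f (c \<odot>\<^bsub>H\<^esub> u) v = cnj c * f u v"
    "\<And>c u v. u \<in> carrier H \<Longrightarrow> v \<in> carrier H' \<Longrightarrow> f u (c \<odot>\<^bsub>H'\<^esub> v) = cnj c * f u v"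
  using assms by (auto simp: htensor_def)

lemma elem_carrier: "x \<in> carrier H \<Longrightarrow> y \<in> carrier H' \<Longrightarrow> elem_tensor H H' x y \<in> carrier (htensor H H')"
  by (auto simp: htensor_def elem_tensor_def H.ip_add_left H'.ip_add_left H.ip_smult_left H'.ip_smult_left algebra_simps)

lemma elem_repro:
  assumes f: "f \<in> carrier (htensor H H')" and x: "x \<in> carrier H" and y: "y \<in> carrier H'"
  shows "ip (htensor H H') (elem_tensor H H' x y) f = f x y"
proof -
  let ?B = "some_onb H" and ?B' = "some_onb H'"
  have B: "\<And>b. b \<in> ?B \<Longrightarrow> b \<in> carrier H" "\<And>b. b \<in> ?B' \<Longrightarrow> b \<in> carrier H'"
    using H.some_onb H'.some_onb by (auto simp: onb_def)
  note fD = htensorD[OF f]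
  have "ip (htensor H H') (elem_tensor H H' x y) f =
    (\<Sum>e\<in>?B. \<Sum>e'\<in>?B'. cnj (ip H e x) * (cnj (ip H' e' y) * f e e'))"
    unfolding htensor_def elem_tensor_def using B by (auto intro!: sum.cong)
  also have "\<dots> = (\<Sum>e\<in>?B. cnj (ip H e x) * f e y)"
  proof (intro sum.cong refl)
    fix e assume e: "e \<in> ?B"
    have "f e y = (\<Sum>e'\<in>?B'. cnj (ip H' e' y) * f e e')"
      by (rule H'.antilinear_expand[OF H'.some_onb y]) (use e B fD in auto)
    thus "(\<Sum>e'\<in>?B'. cnj (ip H e x) * (cnj (ip H' e' y) * f e e')) = cnj (ip H e x) * f e y"
      by (simp add: sum_distrib_left)
  qed
  also have "\<dots> = f x y"
    by (rule H.antilinear_expand[OF H.some_onb x, symmetric]) (use y fD in auto)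
  finally show ?thesis .
qed

lemma elem_gram:
  assumes "x \<in> carrier H" "y \<in> carrier H'" "x' \<in> carrier H" "y' \<in> carrier H'"
  shows "ip (htensor H H') (elem_tensor H H' x y) (elem_tensor H H' x' y') = ip H x x' * ip H' y y'"
  using elem_repro[OF elem_carrier[OF assms(3,4)] assms(1,2)] assms by (simp add: elem_tensor_def)

lemma fd_htensor: "fd_hilbert (htensor H H')"
proof (rule fd_hilbertI)
  let ?T = "htensor H H'" and ?B = "some_onb H" and ?B' = "some_onb H'"
  show vs: "vectorspace class_ring ?T"
  proof (rule vs_criteria)
    show "\<forall>v\<in>carrier ?T. \<exists>neg_v\<in>carrier ?T. v \<oplus>\<^bsub>?T\<^esub> neg_v = \<zero>\<^bsub>?T\<^esub>"
    proof
      fix f assume "f \<in> carrier ?T"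
      hence "(\<lambda>u v. - f u v) \<in> carrier ?T" by (auto simp: htensor_def)
      thus "\<exists>g\<in>carrier ?T. f \<oplus>\<^bsub>?T\<^esub> g = \<zero>\<^bsub>?T\<^esub>"
        by (intro bexI[of _ "\<lambda>u v. - f u v"]) auto
    qed
  qed (auto simp: class_field htensor_def algebra_simps)
  have ip: "ip ?T f g = (\<Sum>e\<in>?B. \<Sum>e'\<in>?B'. cnj (f e e') * g e e')" for f g by (simp add: htensor_def)
  have B: "onb H ?B" "onb H' ?B'" by (rule H.some_onb, rule H'.some_onb)
  have Bc: "b \<in> ?B \<Longrightarrow> b \<in> carrier H" "b' \<in> ?B' \<Longrightarrow> b' \<in> carrier H'" for b b' using B by (auto simp: onb_def)
  have Bf: "finite ?B" "finite ?B'" using B by (auto simp: onb_def)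
  have zero: "f = \<zero>\<^bsub>?T\<^esub>" if f: "f \<in> carrier ?T" and z: "\<And>e e'. e \<in> ?B \<Longrightarrow> e' \<in> ?B' \<Longrightarrow> f e e' = 0" for f
  proof -
    have "f x y = 0" for x y
    proof (cases "x \<in> carrier H \<and> y \<in> carrier H'")
      case True
      have "f x y = ip ?T (elem_tensor H H' x y) f" using elem_repro f True by simp
      also have "\<dots> = 0" unfolding ip by (intro sum.neutral ballI) (simp add: z)
      finally show ?thesis .
    qed (use htensorD(1)[OF f] in auto)
    thus ?thesis by auto
  qed
  show "ip ?T x y = cnj (ip ?T y x)" for x y by (simp add: ip mult.commute)
  show "ip ?T x (y \<oplus>\<^bsub>?T\<^esub> z) = ip ?T x y + ip ?T x z" for x y z by (simp add: ip algebra_simps sum.distrib)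
  show "ip ?T x (c \<odot>\<^bsub>?T\<^esub> y) = c * ip ?T x y" for x y c by (simp add: ip sum_distrib_left algebra_simps)
  show "Re (ip ?T f f) > 0" if f: "f \<in> carrier ?T" "f \<noteq> \<zero>\<^bsub>?T\<^esub>" for f
  proof -
    obtain e e' where e: "e \<in> ?B" "e' \<in> ?B'" "f e e' \<noteq> 0" using zero f by blast
    have "Re (ip ?T f f) = (\<Sum>e\<in>?B. \<Sum>e'\<in>?B'. (cmod (f e e'))\<^sup>2)"
      by (auto simp: ip cmod_power2 intro!: sum.cong) (simp add: power2_eq_square)
    also have "\<dots> > 0" using e Bf
      by (intro sum_pos2[of _ e]) (auto intro!: sum_pos2[of _ e'] sum_nonneg)
    finally show ?thesis .
  qed
  show "onb ?T ((\<lambda>(e, e'). elem_tensor H H' e e') ` (?B \<times> ?B'))"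
    unfolding onb_def
  proof (intro conjI ballI impI)
    show "finite ((\<lambda>(e, e'). elem_tensor H H' e e') ` (?B \<times> ?B'))" using Bf by simp
    show "(\<lambda>(e, e'). elem_tensor H H' e e') ` (?B \<times> ?B') \<subseteq> carrier ?T" using Bc elem_carrier by auto
  next
    fix p q assume "p \<in> (\<lambda>(e, e'). elem_tensor H H' e e') ` (?B \<times> ?B')" "q \<in> (\<lambda>(e, e'). elem_tensor H H' e e') ` (?B \<times> ?B')"
    then obtain e e' f f' where p: "e \<in> ?B" "e' \<in> ?B'" "f \<in> ?B" "f' \<in> ?B'" "p = elem_tensor H H' e e'" "q = elem_tensor H H' f f'" by auto
    have "ip ?T p q = ip H e f * ip H' e' f'" using p elem_gram Bc by simp
    moreover have "ip ?T p p = 1" using p elem_gram Bc B by (simp add: onb_def)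
    ultimately show "ip ?T p q = (if p = q then 1 else 0)" using p B by (auto simp: onb_def)
  next
    fix f assume f: "f \<in> carrier ?T" "\<forall>e\<in>(\<lambda>(e, e'). elem_tensor H H' e e') ` (?B \<times> ?B'). ip ?T e f = 0"
    show "f = \<zero>\<^bsub>?T\<^esub>" using f elem_repro[OF f(1)] Bc by (intro zero) force+
  qed
qed

lemma elem_total:
  assumes "is_total H X \<phi>" "is_total H' Y \<psi>"
  shows "is_total (htensor H H') (X \<times> Y) (\<lambda>(s, t). elem_tensor H H' (\<phi> s) (\<psi> t))"
  unfolding is_total_def
proof (intro conjI ballI impI)
  have c: "s \<in> X \<Longrightarrow> \<phi> s \<in> carrier H" "t \<in> Y \<Longrightarrow> \<psi> t \<in> carrier H'" for s t
    using assms by (auto simp: is_total_def)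
  fix f assume f: "f \<in> carrier (htensor H H')"
    "\<forall>t\<in>X \<times> Y. ip (htensor H H') (case t of (s, t) \<Rightarrow> elem_tensor H H' (\<phi> s) (\<psi> t)) f = 0"
  note fD = htensorD[OF f(1)]
  have z: "f (\<phi> s) (\<psi> t) = 0" if "s \<in> X" "t \<in> Y" for s t
    using f that elem_repro[OF f(1)] c by force
  have "f x (\<psi> t) = 0" if x: "x \<in> carrier H" and t: "t \<in> Y" for x t
  proof -
    have "x \<in> {x \<in> carrier H. f x (\<psi> t) = 0}"
      by (rule H.total_closed[OF assms(1)])
        (use x t fD fD(4)[of "\<zero>\<^bsub>H\<^esub>" "\<psi> t" 0] z c H.zero_smult in auto)
    thus ?thesis by simp
  qed note z2 = this
  have z3: "f x y = 0" if x: "x \<in> carrier H" and y: "y \<in> carrier H'" for x y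
  proof -
    have "y \<in> {y \<in> carrier H'. f x y = 0}"
      by (rule H'.total_closed[OF assms(2)])
        (use x y fD fD(5)[of x "\<zero>\<^bsub>H'\<^esub>" 0] z2 c H'.zero_smult in auto)
    thus ?thesis by simp
  qed
  have "f x y = 0" for x y using z3 fD(1) by blast
  thus "f = \<zero>\<^bsub>htensor H H'\<^esub>" by auto
next
  fix t assume "t \<in> X \<times> Y"
  thus "(case t of (s, t) \<Rightarrow> elem_tensor H H' (\<phi> s) (\<psi> t)) \<in> carrier (htensor H H')"
    using assms elem_carrier by (auto simp: is_total_def)
qed

lemma total_id: "is_total H (carrier H) (\<lambda>x. x)" by (rule H.total_surj) auto

end

lemma elem_total_id:
  assumes "fd_hilbert H" "fd_hilbert H'"
  shows "is_total (htensor H H') (carrier H \<times> carrier H') (\<lambda>(x, y). elem_tensor H H' x y)"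
  using elem_total[OF assms total_id[OF assms(1) assms(2)] total_id[OF assms(2) assms(1)]] .

lemma tensor_map:
  assumes fd: "fd_hilbert H" "fd_hilbert H'" "fd_hilbert K" "fd_hilbert K'"
    and U: "unitary H K U" and V: "unitary H' K' V"
  shows "unitary (htensor H H') (htensor K K') (tensor_map H H' K K' U V)"
    and "\<And>x y. x \<in> carrier H \<Longrightarrow> y \<in> carrier H' \<Longrightarrow>
      tensor_map H H' K K' U V (elem_tensor H H' x y) = elem_tensor K K' (U x) (V y)"
proof -
  interpret H: fd_hilbert H by fact
  interpret H': fd_hilbert H' by fact
  note UD = unitaryD[OF U] and VD = unitaryD[OF V]
  note UI = unitary_inv[OF U fd(1)] and VI = unitary_inv[OF V fd(2)]
  let ?iU = "inv_into (carrier H) U" and ?iV = "inv_into (carrier H') V"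
  note T = fd_htensor[OF fd(1,2)] fd_htensor[OF fd(3,4)]
  have 1: "is_total (htensor K K') (carrier H \<times> carrier H') (\<lambda>(x, y). elem_tensor K K' (U x) (V y))"
    by (rule elem_total[OF fd(3,4)]; rule fd_hilbert.total_surj[OF fd(3)] fd_hilbert.total_surj[OF fd(4)])
      (use UD VD in \<open>auto simp: bij_betw_def\<close>)
  obtain W where W: "unitary (htensor H H') (htensor K K') W"
    "\<forall>t\<in>carrier H \<times> carrier H'. W (case t of (x, y) \<Rightarrow> elem_tensor H H' x y) = (case t of (x, y) \<Rightarrow> elem_tensor K K' (U x) (V y))"
    using gram[OF T elem_total_id[OF fd(1,2)] 1] elem_gram[OF fd(1,2)] elem_gram[OF fd(3,4)] UD VD by fastforce
  note WD = unitaryD[OF W(1)]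
  have eq: "tensor_map H H' K K' U V f = W f" if f: "f \<in> carrier (htensor H H')" for f
  proof (intro ext)
    fix u v
    show "tensor_map H H' K K' U V f u v = W f u v"
    proof (cases "u \<in> carrier K \<and> v \<in> carrier K'")
      case True
      hence uv: "?iU u \<in> carrier H" "?iV v \<in> carrier H'" "U (?iU u) = u" "V (?iV v) = v"
        using UI VI unitaryD(1)[OF UI(1)] unitaryD(1)[OF VI(1)] by auto
      have "W f u v = ip (htensor K K') (elem_tensor K K' u v) (W f)"
        using elem_repro[OF fd(3,4) WD(1)[OF f]] True by simp
      also have "elem_tensor K K' u v = W (elem_tensor H H' (?iU u) (?iV v))" using W(2) uv by force
      also have "ip (htensor K K') \<dots> (W f) = ip (htensor H H') (elem_tensor H H' (?iU u) (?iV v)) f"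
        using elem_carrier[OF fd(1,2)] uv f by (intro WD(4)) auto
      also have "\<dots> = f (?iU u) (?iV v)" using elem_repro[OF fd(1,2) f] uv by simp
      finally show ?thesis using True by (simp add: tensor_map_def)
    next
      case False
      thus ?thesis using htensorD(1)[OF fd(3,4) WD(1)[OF f]] by (auto simp: tensor_map_def)
    qed
  qed
  show "unitary (htensor H H') (htensor K K') (tensor_map H H' K K' U V)"
    by (rule unitary_cong[OF W(1) eq T(1)])
  show "tensor_map H H' K K' U V (elem_tensor H H' x y) = elem_tensor K K' (U x) (V y)"
    if "x \<in> carrier H" "y \<in> carrier H'" for x y
    using eq[OF elem_carrier[OF fd(1,2) that]] W(2) that by force
qed

section \<open>Hilbert net bundles\<close>

record ('k, 'v) net =
  fibre :: "'k \<Rightarrow> 'v hilb"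
  transport :: "'k \<Rightarrow> 'k \<Rightarrow> 'v \<Rightarrow> 'v"

text \<open>A net bundle is given by the family of its fibres and the maps \<open>transport E b a\<close> from the fibre
  over \<open>a\<close> to the fibre over \<open>b\<close>, which matter only for \<open>a \<le> b\<close>. The fibres need not have the same
  dimension unless the poset is connected.\<close>

definition net_bundle :: "('k::order, 'v) net \<Rightarrow> bool" where
  "net_bundle E \<longleftrightarrow> (\<forall>a. fd_hilbert (fibre E a)) \<and>
     (\<forall>a b. a \<le> b \<longrightarrow> unitary (fibre E a) (fibre E b) (transport E b a)) \<and>
     (\<forall>a. \<forall>x\<in>carrier (fibre E a). transport E a a x = x) \<and>
     (\<forall>a b c. a \<le> b \<longrightarrow> b \<le> c \<longrightarrow> (\<forall>x\<in>carrier (fibre E a). transport E c b (transport E b a x) = transport E c a x))"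

definition net_iso :: "('k::order, 'v) net \<Rightarrow> ('k, 'w) net \<Rightarrow> bool" where
  "net_iso E F \<longleftrightarrow> (\<exists>U. (\<forall>a. unitary (fibre E a) (fibre F a) (U a)) \<and>
     (\<forall>a b. a \<le> b \<longrightarrow> (\<forall>x\<in>carrier (fibre E a). U b (transport E b a x) = transport F b a (U a x))))"

definition net_sum :: "('k, 'v) net \<Rightarrow> ('k, 'w) net \<Rightarrow> ('k, 'v \<times> 'w) net" where
  "net_sum E F = \<lparr>fibre = (\<lambda>a. hsum (fibre E a) (fibre F a)), transport = (\<lambda>b a. map_prod (transport E b a) (transport F b a))\<rparr>"

definition net_tensor :: "('k, 'v) net \<Rightarrow> ('k, 'w) net \<Rightarrow> ('k, 'v \<Rightarrow> 'w \<Rightarrow> complex) net" where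
  "net_tensor E F = \<lparr>fibre = (\<lambda>a. htensor (fibre E a) (fibre F a)),
     transport = (\<lambda>b a. tensor_map (fibre E a) (fibre F a) (fibre E b) (fibre F b) (transport E b a) (transport F b a))\<rparr>"

definition net_ext :: "nat \<Rightarrow> ('k, 'v) net \<Rightarrow> ('k, 'v list \<Rightarrow> complex) net" where
  "net_ext k E = \<lparr>fibre = (\<lambda>a. hext_power k (fibre E a)),
     transport = (\<lambda>b a. tensor_power_map k (fibre E a) (fibre E b) (transport E b a))\<rparr>"

definition net_pullback :: "('k2 \<Rightarrow> 'k) \<Rightarrow> ('k, 'v) net \<Rightarrow> ('k2, 'v) net" where
  "net_pullback \<eta> E = \<lparr>fibre = (\<lambda>a. fibre E (\<eta> a)), transport = (\<lambda>b a. transport E (\<eta> b) (\<eta> a))\<rparr>"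

definition trivial_net :: "nat \<Rightarrow> ('k, complex vec) net" where
  "trivial_net n = \<lparr>fibre = (\<lambda>a. Cspace n), transport = (\<lambda>b a x. x)\<rparr>"

definition rank :: "('k::order, 'v) net \<Rightarrow> nat" where
  "rank E = (THE d. \<forall>a. hdim (fibre E a) = d)"

definition pathwise_connected :: "'k::order itself \<Rightarrow> bool" where
  "pathwise_connected _ \<longleftrightarrow> (\<forall>a b :: 'k. (\<lambda>x y. x \<le> y \<or> y \<le> x)\<^sup>*\<^sup>* a b)"

lemma net_bundleD2: "net_bundle E \<Longrightarrow> a \<le> b \<Longrightarrow> unitary (fibre E a) (fibre E b) (transport E b a)"
  unfolding net_bundle_def by simp

lemma net_bundleD:
  assumes "net_bundle E"
  shows "\<And>a. fd_hilbert (fibre E a)"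
    "\<And>a b. a \<le> b \<Longrightarrow> unitary (fibre E a) (fibre E b) (transport E b a)"
    "\<And>a x. x \<in> carrier (fibre E a) \<Longrightarrow> transport E a a x = x"
    "\<And>a b c x. a \<le> b \<Longrightarrow> b \<le> c \<Longrightarrow> x \<in> carrier (fibre E a) \<Longrightarrow> transport E c b (transport E b a x) = transport E c a x"
    "\<And>a b x. a \<le> b \<Longrightarrow> x \<in> carrier (fibre E a) \<Longrightarrow> transport E b a x \<in> carrier (fibre E b)"
    "\<And>a b x y. a \<le> b \<Longrightarrow> x \<in> carrier (fibre E a) \<Longrightarrow> y \<in> carrier (fibre E a) \<Longrightarrow>
       ip (fibre E b) (transport E b a x) (transport E b a y) = ip (fibre E a) x y"
    "\<And>a b c x. a \<le> b \<Longrightarrow> x \<in> carrier (fibre E a) \<Longrightarrow>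
       transport E b a (c \<odot>\<^bsub>fibre E a\<^esub> x) = c \<odot>\<^bsub>fibre E b\<^esub> transport E b a x"
proof -
  show 1: "\<And>a. fd_hilbert (fibre E a)"
    and 2: "\<And>a b. a \<le> b \<Longrightarrow> unitary (fibre E a) (fibre E b) (transport E b a)"
    and "\<And>a x. x \<in> carrier (fibre E a) \<Longrightarrow> transport E a a x = x"
    and "\<And>a b c x. a \<le> b \<Longrightarrow> b \<le> c \<Longrightarrow> x \<in> carrier (fibre E a) \<Longrightarrow> transport E c b (transport E b a x) = transport E c a x"
    using assms unfolding net_bundle_def by simp_all
qed (rule unitaryD[OF net_bundleD2[OF assms]]; assumption)+

lemma net_simps [simp]:
  "fibre (net_sum E F) a = hsum (fibre E a) (fibre F a)"
  "transport (net_sum E F) b a p = (transport E b a (fst p), transport F b a (snd p))"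
  "fibre (net_tensor E F) a = htensor (fibre E a) (fibre F a)"
  "transport (net_tensor E F) b a =
    tensor_map (fibre E a) (fibre F a) (fibre E b) (fibre F b) (transport E b a) (transport F b a)"
  "fibre (trivial_net n) a = Cspace n" "transport (trivial_net n) b a x = x"
  by (auto simp: net_sum_def net_tensor_def trivial_net_def map_prod_def split: prod.splits)

lemma trivial_net_bundle: "net_bundle (trivial_net n)"
  using fd_Cspace unitary_id by (auto simp: net_bundle_def trivial_net_def)

lemma hsum_unitary:
  assumes "unitary H K U" "unitary H' K' V"
  shows "unitary (hsum H H') (hsum K K') (\<lambda>p. (U (fst p), V (snd p)))"
proof (rule unitaryI)
  note U = unitaryD[OF assms(1)] and V = unitaryD[OF assms(2)]
  have "bij_betw (map_prod U V) (carrier H \<times> carrier H') (carrier K \<times> carrier K')"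
    using U(5) V(5) by (intro bij_betw_map_prod) auto
  thus "bij_betw (\<lambda>p. (U (fst p), V (snd p))) (carrier (hsum H H')) (carrier (hsum K K'))"
    by (simp add: map_prod_def case_prod_beta')
qed (use unitaryD[OF assms(1)] unitaryD[OF assms(2)] in auto)

lemma net_sum_bundle:
  assumes "net_bundle E" "net_bundle F"
  shows "net_bundle (net_sum E F)"
  unfolding net_bundle_def
proof (intro conjI allI impI ballI)
  note E = net_bundleD[OF assms(1)] and F = net_bundleD[OF assms(2)]
  show "fd_hilbert (fibre (net_sum E F) a)" for a using fd_hsum[OF E(1) F(1)] by simp
  show "unitary (fibre (net_sum E F) a) (fibre (net_sum E F) b) (transport (net_sum E F) b a)" if "a \<le> b" for a b
  proof -
    have "transport (net_sum E F) b a = (\<lambda>p. (transport E b a (fst p), transport F b a (snd p)))" by auto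
    thus ?thesis using hsum_unitary[OF E(2)[OF that] F(2)[OF that]] by simp
  qed
qed (use net_bundleD[OF assms(1)] net_bundleD[OF assms(2)] in auto)

lemma net_tensor_bundle:
  assumes "net_bundle E" "net_bundle F"
  shows "net_bundle (net_tensor E F)"
proof -
  note E = net_bundleD[OF assms(1)] and F = net_bundleD[OF assms(2)]
  note tm = tensor_map[OF E(1) F(1) E(1) F(1) E(2) F(2)]
  note tot = elem_total_id[OF E(1) F(1)]
  show ?thesis unfolding net_bundle_def
  proof (intro conjI allI impI ballI)
    show fd: "fd_hilbert (fibre (net_tensor E F) a)" for a using fd_htensor[OF E(1) F(1)] by simp
    show un: "unitary (fibre (net_tensor E F) a) (fibre (net_tensor E F) b) (transport (net_tensor E F) b a)" if "a \<le> b" for a b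
      using tm(1)[OF that that] by simp
    show "transport (net_tensor E F) a a x = x" if "x \<in> carrier (fibre (net_tensor E F) a)" for a x
      by (rule linear_total_eq[OF fd[of a] fd[of a] _ un[of a a] unitary_id])
        (use tot[of a] tm(2)[of a a] E F that in auto)
    show "transport (net_tensor E F) c b (transport (net_tensor E F) b a x) = transport (net_tensor E F) c a x"
      if "a \<le> b" "b \<le> c" "x \<in> carrier (fibre (net_tensor E F) a)" for a b c x
      by (rule linear_total_eq[OF fd[of a] fd[of c] _ unitary_comp[OF un un] un])
        (use tot[of a] tm(2) E F that order_trans[OF that(1,2)] in auto)
  qed
qed

lemma net_iso_gram:
  fixes E :: "('k::order, 'v) net" and F :: "('k, 'w) net"
  assumes EF: "net_bundle E" "net_bundle F"
    and tot: "\<And>a. is_total (fibre E a) (X a) (\<phi> a)" "\<And>a. is_total (fibre F a) (X a) (\<psi> a)"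
    and gr: "\<And>a s t. s \<in> X a \<Longrightarrow> t \<in> X a \<Longrightarrow>
      ip (fibre E a) (\<phi> a s) (\<phi> a t) = ip (fibre F a) (\<psi> a s) (\<psi> a t)"
    and tau: "\<And>a b t. a \<le> b \<Longrightarrow> t \<in> X a \<Longrightarrow> \<tau> b a t \<in> X b"
      "\<And>a b t. a \<le> b \<Longrightarrow> t \<in> X a \<Longrightarrow> transport E b a (\<phi> a t) = \<phi> b (\<tau> b a t)"
      "\<And>a b t. a \<le> b \<Longrightarrow> t \<in> X a \<Longrightarrow> transport F b a (\<psi> a t) = \<psi> b (\<tau> b a t)"
  shows "net_iso E F"
proof -
  note E = net_bundleD[OF EF(1)] and F = net_bundleD[OF EF(2)]
  have "\<exists>U. unitary (fibre E a) (fibre F a) U \<and> (\<forall>t\<in>X a. U (\<phi> a t) = \<psi> a t)" for a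
    using gram[OF E(1) F(1) tot] gr by blast
  then obtain U where U: "\<And>a. unitary (fibre E a) (fibre F a) (U a)"
    "\<And>a t. t \<in> X a \<Longrightarrow> U a (\<phi> a t) = \<psi> a t" by metis
  have "U b (transport E b a x) = transport F b a (U a x)" if "a \<le> b" "x \<in> carrier (fibre E a)" for a b x
    by (rule linear_total_eq[OF E(1) F(1) tot(1) unitary_comp[OF E(2) U(1)] unitary_comp[OF U(1) F(2)] _ that(2)])
      (use that U tau in auto)
  thus ?thesis using U(1) unfolding net_iso_def by blast
qed

lemma net_iso_refl: "net_iso E E"
  unfolding net_iso_def by (rule exI[of _ "\<lambda>a x. x"]) (auto intro: unitary_id)

lemma net_iso_sym:
  assumes "net_bundle E" "net_bundle F" "net_iso E F"
  shows "net_iso F E"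
proof -
  note E = net_bundleD[OF assms(1)] and F = net_bundleD[OF assms(2)]
  obtain U where U: "\<And>a. unitary (fibre E a) (fibre F a) (U a)"
    "\<And>a b x. a \<le> b \<Longrightarrow> x \<in> carrier (fibre E a) \<Longrightarrow> U b (transport E b a x) = transport F b a (U a x)"
    using assms(3) unfolding net_iso_def by blast
  let ?V = "\<lambda>a. inv_into (carrier (fibre E a)) (U a)"
  note V = unitary_inv[OF U(1) E(1)]
  have "?V b (transport F b a y) = transport E b a (?V a y)" if ab: "a \<le> b" and y: "y \<in> carrier (fibre F a)" for a b y
  proof -
    have v: "?V a y \<in> carrier (fibre E a)" using unitaryD(1)[OF V(1)] y by blast
    have "?V b (U b (transport E b a (?V a y))) = transport E b a (?V a y)" by (intro V(2) E(5) ab v)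
    thus ?thesis using U(2)[OF ab v] V(3)[OF y] by simp
  qed
  thus ?thesis unfolding net_iso_def using V(1) by (intro exI[of _ ?V]) auto
qed

lemma net_iso_trans:
  assumes "net_iso E F" "net_iso F G"
  shows "net_iso E G"
proof -
  obtain U where U: "\<And>a. unitary (fibre E a) (fibre F a) (U a)"
    "\<And>a b x. a \<le> b \<Longrightarrow> x \<in> carrier (fibre E a) \<Longrightarrow> U b (transport E b a x) = transport F b a (U a x)"
    using assms(1) unfolding net_iso_def by blast
  obtain V where V: "\<And>a. unitary (fibre F a) (fibre G a) (V a)"
    "\<And>a b x. a \<le> b \<Longrightarrow> x \<in> carrier (fibre F a) \<Longrightarrow> V b (transport F b a x) = transport G b a (V a x)"
    using assms(2) unfolding net_iso_def by blast
  show ?thesis unfolding net_iso_def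
    using unitary_comp[OF U(1) V(1)] U(2) V(2) unitaryD(1)[OF U(1)]
    by (intro exI[of _ "\<lambda>a x. V a (U a x)"]) auto
qed

lemma net_iso_dim:
  assumes "net_bundle E" "net_bundle F" "net_iso E F"
  shows "hdim (fibre E a) = hdim (fibre F a)"
proof -
  obtain U where "unitary (fibre E a) (fibre F a) (U a)" using assms(3) unfolding net_iso_def by auto
  thus ?thesis by (rule unitary_dim[OF net_bundleD(1)[OF assms(1)] net_bundleD(1)[OF assms(2)]])
qed


lemma total_id': "net_bundle E \<Longrightarrow> is_total (fibre E a) (carrier (fibre E a)) (\<lambda>x. x)"
  using fd_hilbert.total_surj[OF net_bundleD(1), of E "carrier (fibre E a)" "\<lambda>x. x" a] by auto

lemma total_unitary:
  assumes "fd_hilbert K" "unitary H K U"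
  shows "is_total K (carrier H) U"
  using unitaryD(1,5)[OF assms(2)] by (intro fd_hilbert.total_surj[OF assms(1)]) (auto simp: bij_betw_def)

lemma net_sum_cong:
  assumes "net_iso E E'" "net_iso F F'"
  shows "net_iso (net_sum E F) (net_sum E' F')"
proof -
  obtain U where U: "\<And>a. unitary (fibre E a) (fibre E' a) (U a)"
    "\<And>a b x. a \<le> b \<Longrightarrow> x \<in> carrier (fibre E a) \<Longrightarrow> U b (transport E b a x) = transport E' b a (U a x)"
    using assms(1) unfolding net_iso_def by blast
  obtain V where V: "\<And>a. unitary (fibre F a) (fibre F' a) (V a)"
    "\<And>a b x. a \<le> b \<Longrightarrow> x \<in> carrier (fibre F a) \<Longrightarrow> V b (transport F b a x) = transport F' b a (V a x)"
    using assms(2) unfolding net_iso_def by blast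
  show ?thesis unfolding net_iso_def using hsum_unitary[OF U(1) V(1)] U(2) V(2)
    by (intro exI[of _ "\<lambda>a p. (U a (fst p), V a (snd p))"]) auto
qed

lemma net_tensor_cong:
  assumes EF: "net_bundle E" "net_bundle E'" "net_bundle F" "net_bundle F'"
    and "net_iso E E'" "net_iso F F'"
  shows "net_iso (net_tensor E F) (net_tensor E' F')"
proof -
  note E = net_bundleD[OF EF(1)] and E' = net_bundleD[OF EF(2)]
    and F = net_bundleD[OF EF(3)] and F' = net_bundleD[OF EF(4)]
  obtain U where U: "\<And>a. unitary (fibre E a) (fibre E' a) (U a)"
    "\<And>a b x. a \<le> b \<Longrightarrow> x \<in> carrier (fibre E a) \<Longrightarrow> U b (transport E b a x) = transport E' b a (U a x)"
    using assms(5) unfolding net_iso_def by blast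
  obtain V where V: "\<And>a. unitary (fibre F a) (fibre F' a) (V a)"
    "\<And>a b x. a \<le> b \<Longrightarrow> x \<in> carrier (fibre F a) \<Longrightarrow> V b (transport F b a x) = transport F' b a (V a x)"
    using assms(6) unfolding net_iso_def by blast
  note UV = unitaryD[OF U(1)] unitaryD[OF V(1)]
  show ?thesis
  proof (rule net_iso_gram[where X = "\<lambda>a. carrier (fibre E a) \<times> carrier (fibre F a)"
      and \<phi> = "\<lambda>a (x, y). elem_tensor (fibre E a) (fibre F a) x y"
      and \<psi> = "\<lambda>a (x, y). elem_tensor (fibre E' a) (fibre F' a) (U a x) (V a y)"
      and \<tau> = "\<lambda>b a (x, y). (transport E b a x, transport F b a y)"])
    show "is_total (fibre (net_tensor E' F') a) (carrier (fibre E a) \<times> carrier (fibre F a))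
      (\<lambda>(x, y). elem_tensor (fibre E' a) (fibre F' a) (U a x) (V a y))" for a
      using elem_total[OF E'(1) F'(1) total_unitary[OF E'(1) U(1)] total_unitary[OF F'(1) V(1)]] by simp
    show "net_bundle (net_tensor E F)" "net_bundle (net_tensor E' F')"
      by (intro net_tensor_bundle EF)+
    show "is_total (fibre (net_tensor E F) a) (carrier (fibre E a) \<times> carrier (fibre F a))
      (\<lambda>(x, y). elem_tensor (fibre E a) (fibre F a) x y)" for a
      using elem_total_id[OF E(1) F(1)] by simp
  qed (use E F E' F' U V UV elem_gram[OF E(1) F(1)] elem_gram[OF E'(1) F'(1)]
      tensor_map(2)[OF E(1) F(1) E(1) F(1) E(2) F(2)] tensor_map(2)[OF E'(1) F'(1) E'(1) F'(1) E'(2) F'(2)] in auto)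
qed

subsection \<open>Standard representatives\<close>

lemma coordinates:
  assumes "fd_hilbert H"
  shows "\<exists>n U. unitary H (Cspace n) U"
proof -
  interpret fd_hilbert H by fact
  obtain B where B: "onb H B" using onb_exists by auto
  then obtain es where es: "distinct es" "set es = B" using finite_distinct_list unfolding onb_def by metis
  define n where "n = length es"
  have "is_total H {..<n} (\<lambda>i. es ! i)"
  proof -
    have "es ! i \<in> B" if "i \<in> {..<n}" for i using that es(2) by (auto simp: n_def)
    moreover have "\<exists>i\<in>{..<n}. e = es ! i" if "e \<in> B" for e
      using that unfolding es(2)[symmetric] n_def in_set_conv_nth by auto
    ultimately show ?thesis using B unfolding onb_def is_total_def by (metis subsetD)
  qed
  moreover have "is_total (Cspace n) {..<n} (unit_vec n)"
    unfolding is_total_def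
  proof (intro conjI ballI impI)
    fix x assume x: "x \<in> carrier (Cspace n)" "\<forall>e\<in>{..<n}. ip (Cspace n) (unit_vec n e) x = 0"
    have "x $ i = 0" if "i < n" for i
    proof -
      have "x \<bullet>c unit_vec n i = x $ i" using x that
        by (auto simp: scalar_prod_def unit_vec_def if_distrib cong: if_cong)
      thus ?thesis using x that by auto
    qed
    thus "x = \<zero>\<^bsub>Cspace n\<^esub>" using x by auto
  qed auto
  moreover have "ip H (es ! i) (es ! j) = ip (Cspace n) (unit_vec n i) (unit_vec n j)" if "i \<in> {..<n}" "j \<in> {..<n}" for i j
  proof -
    have "ip H (es ! i) (es ! j) = (if i = j then 1 else 0)"
      using that B es unfolding onb_def n_def by (auto simp: nth_eq_iff_index_eq)
    also have "\<dots> = ip (Cspace n) (unit_vec n i) (unit_vec n j)"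
      using that by (auto simp: scalar_prod_def unit_vec_def if_distrib cong: if_cong)
    finally show ?thesis .
  qed
  ultimately show ?thesis using gram[OF assms fd_Cspace] by blast
qed

lemma transport_bundle:
  fixes E :: "('k::order, 'v) net"
  assumes "net_bundle E" and U: "\<And>a. unitary (fibre E a) (G a) (U a)" and G: "\<And>a. fd_hilbert (G a)"
  shows "\<exists>M. net_bundle M \<and> net_iso E M \<and> fibre M = G"
proof -
  note E = net_bundleD[OF assms(1)] and UD = unitaryD[OF U]
  note V = unitary_inv[OF U E(1)] note VD = unitaryD[OF V(1)]
  define M where "M = \<lparr>fibre = G, transport = (\<lambda>b a y. U b (transport E b a (inv_into (carrier (fibre E a)) (U a) y)))\<rparr>"
  have "net_bundle M" unfolding net_bundle_def M_def
  proof (intro conjI allI impI ballI; simp)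
    show "fd_hilbert (G a)" for a by (rule G)
    show "unitary (G a) (G b) (\<lambda>y. U b (transport E b a (inv_into (carrier (fibre E a)) (U a) y)))" if "a \<le> b" for a b
      using unitary_comp[OF unitary_comp[OF V(1) E(2)[OF that]] U] by simp
  qed (use E V VD UD in auto)
  moreover have "net_iso E M" unfolding net_iso_def M_def
    using U V(2) by (intro exI[of _ U]) auto
  moreover have "fibre M = G" by (simp add: M_def)
  ultimately show ?thesis by blast
qed

lemma std_net_exists:
  assumes "net_bundle (E :: ('k::order, 'v) net)"
  shows "\<exists>M :: ('k, complex vec) net. net_bundle M \<and> net_iso M E"
proof -
  have "\<exists>n U. unitary (fibre E a) (Cspace n) U" for a using coordinates net_bundleD(1)[OF assms] by blast
  then obtain n U where "\<And>a. unitary (fibre E a) (Cspace (n a)) (U a)" by metis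
  from transport_bundle[OF assms this fd_Cspace] obtain M :: "('k, complex vec) net"
    where "net_bundle M" "net_iso E M" by blast
  thus ?thesis using net_iso_sym[OF assms] by blast
qed

subsection \<open>Semiring laws up to isomorphism\<close>

lemma iso_sum_commute:
  assumes "net_bundle E" "net_bundle F"
  shows "net_iso (net_sum E F) (net_sum F E)"
proof -
  note E = net_bundleD[OF assms(1)] and F = net_bundleD[OF assms(2)]
  note B = net_sum_bundle[OF assms] net_sum_bundle[OF assms(2,1)]
  note fd = net_bundleD(1)[OF B(1), unfolded net_simps] net_bundleD(1)[OF B(2), unfolded net_simps]
  show ?thesis
    by (rule net_iso_gram[OF B, where X = "\<lambda>a. carrier (fibre E a) \<times> carrier (fibre F a)"
      and \<phi> = "\<lambda>a (x, y). (x, y)" and \<psi> = "\<lambda>a (x, y). (y, x)"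
      and \<tau> = "\<lambda>b a (x, y). (transport E b a x, transport F b a y)"])
     (use E F in \<open>auto intro!: fd_hilbert.total_surj[OF fd(1)] fd_hilbert.total_surj[OF fd(2)]\<close>)
qed

lemma iso_sum_assoc:
  assumes "net_bundle E" "net_bundle F" "net_bundle G"
  shows "net_iso (net_sum (net_sum E F) G) (net_sum E (net_sum F G))"
proof -
  note E = net_bundleD[OF assms(1)] and F = net_bundleD[OF assms(2)] and G = net_bundleD[OF assms(3)]
  note B = net_sum_bundle[OF net_sum_bundle[OF assms(1,2)] assms(3)]
    net_sum_bundle[OF assms(1) net_sum_bundle[OF assms(2,3)]]
  note fd = net_bundleD(1)[OF B(1), unfolded net_simps] net_bundleD(1)[OF B(2), unfolded net_simps]
  show ?thesis
    by (rule net_iso_gram[OF B, where X = "\<lambda>a. carrier (fibre E a) \<times> carrier (fibre F a) \<times> carrier (fibre G a)"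
      and \<phi> = "\<lambda>a (x, y, z). ((x, y), z)" and \<psi> = "\<lambda>a (x, y, z). (x, (y, z))"
      and \<tau> = "\<lambda>b a (x, y, z). (transport E b a x, transport F b a y, transport G b a z)"])
     (use E F G in \<open>auto simp: image_iff Bex_def intro!: fd_hilbert.total_surj[OF fd(1)] fd_hilbert.total_surj[OF fd(2)]\<close>)
qed

lemma iso_zero_sum:
  assumes "net_bundle E"
  shows "net_iso (net_sum (trivial_net 0) E) E"
proof -
  note E = net_bundleD[OF assms(1)]
  note B = net_sum_bundle[OF trivial_net_bundle[of 0] assms]
  note fd = net_bundleD(1)[OF B(1), unfolded net_simps] E(1)
  have c0: "carrier_vec 0 = {0\<^sub>v 0 :: complex vec}" by auto
  show ?thesis
    by (rule net_iso_gram[OF B assms, where X = "\<lambda>a. carrier (fibre E a)"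
      and \<phi> = "\<lambda>a x. (0\<^sub>v 0, x)" and \<psi> = "\<lambda>a x. x"
      and \<tau> = "\<lambda>b a x. transport E b a x"])
     (use E in \<open>auto simp: c0 intro!: fd_hilbert.total_surj[OF fd(1)] fd_hilbert.total_surj[OF fd(2)]\<close>)
qed

lemma iso_tensor_commute:
  assumes "net_bundle E" "net_bundle F"
  shows "net_iso (net_tensor E F) (net_tensor F E)"
proof -
  note E = net_bundleD[OF assms(1)] and F = net_bundleD[OF assms(2)]
  note B = net_tensor_bundle[OF assms] net_tensor_bundle[OF assms(2,1)]
  show ?thesis
  proof (rule net_iso_gram[OF B, where X = "\<lambda>a. carrier (fibre E a) \<times> carrier (fibre F a)"
      and \<phi> = "\<lambda>a (x, y). elem_tensor (fibre E a) (fibre F a) x y"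
      and \<psi> = "\<lambda>a (x, y). elem_tensor (fibre F a) (fibre E a) y x"
      and \<tau> = "\<lambda>b a (x, y). (transport E b a x, transport F b a y)"])
    show "is_total (fibre (net_tensor F E) a) (carrier (fibre E a) \<times> carrier (fibre F a))
      (\<lambda>(x, y). elem_tensor (fibre F a) (fibre E a) y x)" for a
      using elem_total_id[OF F(1) E(1), of a a] by (auto simp: is_total_def)
  qed (use E F elem_total_id[OF E(1) F(1)] elem_gram[OF E(1) F(1)] elem_gram[OF F(1) E(1)]
     tensor_map(2)[OF E(1) F(1) E(1) F(1) E(2) F(2)] tensor_map(2)[OF F(1) E(1) F(1) E(1) F(2) E(2)] in auto)
qed

lemma iso_tensor_assoc:
  assumes "net_bundle E" "net_bundle F" "net_bundle G"
  shows "net_iso (net_tensor (net_tensor E F) G) (net_tensor E (net_tensor F G))"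
proof -
  note EF = net_tensor_bundle[OF assms(1,2)] and FG = net_tensor_bundle[OF assms(2,3)]
  note E = net_bundleD[OF assms(1)] and F = net_bundleD[OF assms(2)] and G = net_bundleD[OF assms(3)]
  note T = net_bundleD[OF EF, unfolded net_simps] and S = net_bundleD[OF FG, unfolded net_simps]
  note B = net_tensor_bundle[OF EF assms(3)] net_tensor_bundle[OF assms(1) FG]
  note gr = elem_gram[OF E(1) F(1)] elem_gram[OF F(1) G(1)] elem_gram[OF T(1) G(1)] elem_gram[OF E(1) S(1)]
  note car = elem_carrier[OF E(1) F(1)] elem_carrier[OF F(1) G(1)]
  note tm = tensor_map(2)[OF E(1) F(1) E(1) F(1) E(2) F(2)] tensor_map(2)[OF F(1) G(1) F(1) G(1) F(2) G(2)]
    tensor_map(2)[OF T(1) G(1) T(1) G(1) T(2) G(2)] tensor_map(2)[OF E(1) S(1) E(1) S(1) E(2) S(2)]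
  show ?thesis
  proof (rule net_iso_gram[OF B, where X = "\<lambda>a. carrier (fibre E a) \<times> carrier (fibre F a) \<times> carrier (fibre G a)"
      and \<phi> = "\<lambda>a (x, y, z). elem_tensor (htensor (fibre E a) (fibre F a)) (fibre G a) (elem_tensor (fibre E a) (fibre F a) x y) z"
      and \<psi> = "\<lambda>a (x, y, z). elem_tensor (fibre E a) (htensor (fibre F a) (fibre G a)) x (elem_tensor (fibre F a) (fibre G a) y z)"
      and \<tau> = "\<lambda>b a (x, y, z). (transport E b a x, transport F b a y, transport G b a z)"])
    fix a
    show "is_total (fibre (net_tensor (net_tensor E F) G) a) (carrier (fibre E a) \<times> carrier (fibre F a) \<times> carrier (fibre G a))
      (\<lambda>(x, y, z). elem_tensor (htensor (fibre E a) (fibre F a)) (fibre G a) (elem_tensor (fibre E a) (fibre F a) x y) z)"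
      using elem_total[OF T(1) G(1) elem_total_id[OF E(1) F(1)] total_id'[OF assms(3)], of a] by (auto simp: is_total_def)
    show "is_total (fibre (net_tensor E (net_tensor F G)) a) (carrier (fibre E a) \<times> carrier (fibre F a) \<times> carrier (fibre G a))
      (\<lambda>(x, y, z). elem_tensor (fibre E a) (htensor (fibre F a) (fibre G a)) x (elem_tensor (fibre F a) (fibre G a) y z))"
      using elem_total[OF E(1) S(1) total_id'[OF assms(1)] elem_total_id[OF F(1) G(1)], of a] by (auto simp: is_total_def)
  qed (use E F G gr car tm in \<open>auto\<close>)
qed

lemma iso_one_tensor:
  assumes "net_bundle E"
  shows "net_iso (net_tensor (trivial_net 1) E) E"
proof -
  note E = net_bundleD[OF assms] and B = net_tensor_bundle[OF trivial_net_bundle[of 1] assms]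
  note gr = elem_gram[OF fd_Cspace E(1)] and tm = tensor_map(2)[OF fd_Cspace E(1) fd_Cspace E(1) unitary_id E(2)]
  have sm: "c \<odot>\<^bsub>fibre E a\<^esub> x \<in> carrier (fibre E a)" if "x \<in> carrier (fibre E a)" for c a x
    using fd_hilbert.smc[OF E(1) that] .
  have id: "transport (trivial_net n) b a = (\<lambda>x. x)" for n and b a :: 'a by auto
  show ?thesis
  proof (rule net_iso_gram[OF B assms, where X = "\<lambda>a. carrier (Cspace 1) \<times> carrier (fibre E a)"
      and \<phi> = "\<lambda>a (c, x). elem_tensor (Cspace 1) (fibre E a) c x"
      and \<psi> = "\<lambda>a (c, x). (c $ 0) \<odot>\<^bsub>fibre E a\<^esub> x"
      and \<tau> = "\<lambda>b a (c, x). (c, transport E b a x)"])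
    fix a
    show "is_total (fibre (net_tensor (trivial_net 1) E) a) (carrier (Cspace 1) \<times> carrier (fibre E a))
      (\<lambda>(c, x). elem_tensor (Cspace 1) (fibre E a) c x)"
      using elem_total_id[OF fd_Cspace E(1)] by simp
    show "is_total (fibre E a) (carrier (Cspace 1) \<times> carrier (fibre E a)) (\<lambda>(c, x). (c $ 0) \<odot>\<^bsub>fibre E a\<^esub> x)"
    proof (rule fd_hilbert.total_surj[OF E(1)])
      interpret fd_hilbert "fibre E a" by (rule E(1))
      show "carrier (fibre E a) \<subseteq> (\<lambda>(c, x). (c $ 0) \<odot>\<^bsub>fibre E a\<^esub> x) ` (carrier (Cspace 1) \<times> carrier (fibre E a))"
      proof
        fix x assume x: "x \<in> carrier (fibre E a)"
        show "x \<in> (\<lambda>(c, x). (c $ 0) \<odot>\<^bsub>fibre E a\<^esub> x) ` (carrier (Cspace 1) \<times> carrier (fibre E a))"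
          using x smult_one[of x] by (intro image_eqI[of _ _ "(vec 1 (\<lambda>_. 1), x)"]) auto
      qed
    qed (use sm in auto)
    fix s t assume "s \<in> carrier (Cspace 1) \<times> carrier (fibre E a)" "t \<in> carrier (Cspace 1) \<times> carrier (fibre E a)"
    thus "ip (fibre (net_tensor (trivial_net 1) E) a) (case s of (c, x) \<Rightarrow> elem_tensor (Cspace 1) (fibre E a) c x)
            (case t of (c, x) \<Rightarrow> elem_tensor (Cspace 1) (fibre E a) c x) =
          ip (fibre E a) (case s of (c, x) \<Rightarrow> (c $ 0) \<odot>\<^bsub>fibre E a\<^esub> x) (case t of (c, x) \<Rightarrow> (c $ 0) \<odot>\<^bsub>fibre E a\<^esub> x)"
      using gr sm by (auto simp: fd_hilbert.ip_smult[OF E(1)] fd_hilbert.ip_smult_left[OF E(1)] scalar_prod_def)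
  qed (use E tm in \<open>auto simp: id\<close>)
qed

lemma iso_zero_tensor:
  assumes "net_bundle E"
  shows "net_iso (net_tensor (trivial_net 0) E) (trivial_net 0)"
proof -
  note E = net_bundleD[OF assms] and B = net_tensor_bundle[OF trivial_net_bundle[of 0] assms]
  note gr = elem_gram[OF fd_Cspace E(1)] and tm = tensor_map(2)[OF fd_Cspace E(1) fd_Cspace E(1) unitary_id E(2)]
  have id: "transport (trivial_net n) b a = (\<lambda>x. x)" for n and b a :: 'a by auto
  have c0: "carrier_vec 0 = {0\<^sub>v 0 :: complex vec}" by auto
  have tot: "is_total (htensor (Cspace 0) (fibre E a)) (carrier (Cspace 0) \<times> carrier (fibre E a))
      (\<lambda>(c, x). elem_tensor (Cspace 0) (fibre E a) c x)" for a
    using elem_total_id[OF fd_Cspace E(1)] .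
  show ?thesis
    by (rule net_iso_gram[OF B trivial_net_bundle, where X = "\<lambda>a. carrier (Cspace 0) \<times> carrier (fibre E a)"
      and \<phi> = "\<lambda>a (c, x). elem_tensor (Cspace 0) (fibre E a) c x"
      and \<psi> = "\<lambda>a (c, x). 0\<^sub>v 0"
      and \<tau> = "\<lambda>b a (c, x). (c, transport E b a x)"])
     (use E tm gr tot in \<open>auto simp: id c0 is_total_def\<close>)
qed

lemma iso_tensor_distrib:
  assumes "net_bundle E" "net_bundle F" "net_bundle G"
  shows "net_iso (net_tensor (net_sum E F) G) (net_sum (net_tensor E G) (net_tensor F G))"
proof -
  note EF = net_sum_bundle[OF assms(1,2)]
  note EG = net_tensor_bundle[OF assms(1,3)] and FG = net_tensor_bundle[OF assms(2,3)]
  note E = net_bundleD[OF assms(1)] and F = net_bundleD[OF assms(2)] and G = net_bundleD[OF assms(3)]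
  note T = net_bundleD[OF EF, unfolded net_simps(1)]
  note B = net_tensor_bundle[OF EF assms(3)] net_sum_bundle[OF EG FG]
  note gr = elem_gram[OF E(1) G(1)] elem_gram[OF F(1) G(1)] elem_gram[OF T(1) G(1)]
  note car = elem_carrier[OF E(1) G(1)] elem_carrier[OF F(1) G(1)]
  note tm = tensor_map(2)[OF E(1) G(1) E(1) G(1) E(2) G(2)] tensor_map(2)[OF F(1) G(1) F(1) G(1) F(2) G(2)]
    tensor_map(2)[OF T(1) G(1) T(1) G(1) T(2) G(2)]
  show ?thesis
  proof (rule net_iso_gram[OF B, where X = "\<lambda>a. (carrier (fibre E a) \<times> carrier (fibre F a)) \<times> carrier (fibre G a)"
      and \<phi> = "\<lambda>a (p, z). elem_tensor (hsum (fibre E a) (fibre F a)) (fibre G a) p z"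
      and \<psi> = "\<lambda>a (p, z). (elem_tensor (fibre E a) (fibre G a) (fst p) z, elem_tensor (fibre F a) (fibre G a) (snd p) z)"
      and \<tau> = "\<lambda>b a (p, z). ((transport E b a (fst p), transport F b a (snd p)), transport G b a z)"])
    fix a
    interpret E: fd_hilbert "fibre E a" by (rule E(1))
    interpret F: fd_hilbert "fibre F a" by (rule F(1))
    show "is_total (fibre (net_tensor (net_sum E F) G) a) ((carrier (fibre E a) \<times> carrier (fibre F a)) \<times> carrier (fibre G a))
      (\<lambda>(p, z). elem_tensor (hsum (fibre E a) (fibre F a)) (fibre G a) p z)"
      using elem_total_id[OF T(1) G(1), of a] by simp
    have z: "elem_tensor (fibre E a) (fibre G a) \<zero>\<^bsub>fibre E a\<^esub> z = (\<lambda>u v. 0)" "elem_tensor (fibre F a) (fibre G a) \<zero>\<^bsub>fibre F a\<^esub> z = (\<lambda>u v. 0)" for z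
      by (auto simp: elem_tensor_def fun_eq_iff)
    have z0: "ip (htensor H H') (\<lambda>u v. 0) f = 0" for H :: "'x hilb" and H' :: "'y hilb" and f
      by (simp add: htensor_def)
    show "is_total (fibre (net_sum (net_tensor E G) (net_tensor F G)) a) ((carrier (fibre E a) \<times> carrier (fibre F a)) \<times> carrier (fibre G a))
      (\<lambda>(p, z). (elem_tensor (fibre E a) (fibre G a) (fst p) z, elem_tensor (fibre F a) (fibre G a) (snd p) z))"
      unfolding is_total_def
    proof (intro conjI ballI impI)
      fix f assume f: "f \<in> carrier (fibre (net_sum (net_tensor E G) (net_tensor F G)) a)"
        "\<forall>t\<in>(carrier (fibre E a) \<times> carrier (fibre F a)) \<times> carrier (fibre G a).
          ip (fibre (net_sum (net_tensor E G) (net_tensor F G)) a)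
           (case t of (p, z) \<Rightarrow> (elem_tensor (fibre E a) (fibre G a) (fst p) z, elem_tensor (fibre F a) (fibre G a) (snd p) z)) f = 0"
      have "ip (htensor (fibre E a) (fibre G a)) (elem_tensor (fibre E a) (fibre G a) x z) (fst f) = 0"
        if "x \<in> carrier (fibre E a)" "z \<in> carrier (fibre G a)" for x z
        using bspec[OF f(2), of "((x, \<zero>\<^bsub>fibre F a\<^esub>), z)"] that by (simp add: z z0)
      hence 1: "fst f = (\<lambda>u v. 0)"
        using elem_total_id[OF E(1) G(1), of a a] f(1) by (force simp: is_total_def)
      have "ip (htensor (fibre F a) (fibre G a)) (elem_tensor (fibre F a) (fibre G a) x z) (snd f) = 0"
        if "x \<in> carrier (fibre F a)" "z \<in> carrier (fibre G a)" for x z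
        using bspec[OF f(2), of "((\<zero>\<^bsub>fibre E a\<^esub>, x), z)"] that by (simp add: z z0)
      hence 2: "snd f = (\<lambda>u v. 0)"
        using elem_total_id[OF F(1) G(1), of a a] f(1) by (force simp: is_total_def)
      show "f = \<zero>\<^bsub>fibre (net_sum (net_tensor E G) (net_tensor F G)) a\<^esub>" using 1 2 by (simp add: prod_eq_iff)
    qed (use car in auto)
  next
    fix a s t
    assume "s \<in> (carrier (fibre E a) \<times> carrier (fibre F a)) \<times> carrier (fibre G a)"
      "t \<in> (carrier (fibre E a) \<times> carrier (fibre F a)) \<times> carrier (fibre G a)"
    thus "ip (fibre (net_tensor (net_sum E F) G) a) (case s of (p, z) \<Rightarrow> elem_tensor (hsum (fibre E a) (fibre F a)) (fibre G a) p z)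
       (case t of (p, z) \<Rightarrow> elem_tensor (hsum (fibre E a) (fibre F a)) (fibre G a) p z) =
      ip (fibre (net_sum (net_tensor E G) (net_tensor F G)) a)
       (case s of (p, z) \<Rightarrow> (elem_tensor (fibre E a) (fibre G a) (fst p) z, elem_tensor (fibre F a) (fibre G a) (snd p) z))
       (case t of (p, z) \<Rightarrow> (elem_tensor (fibre E a) (fibre G a) (fst p) z, elem_tensor (fibre F a) (fibre G a) (snd p) z))"
      by (auto simp: gr algebra_simps)
  next
    fix a b t assume "a \<le> b" "t \<in> (carrier (fibre E a) \<times> carrier (fibre F a)) \<times> carrier (fibre G a)"
    thus "transport (net_tensor (net_sum E F) G) b a (case t of (p, z) \<Rightarrow> elem_tensor (hsum (fibre E a) (fibre F a)) (fibre G a) p z) =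
      (case (case t of (p, z) \<Rightarrow> ((transport E b a (fst p), transport F b a (snd p)), transport G b a z)) of
        (p, z) \<Rightarrow> elem_tensor (hsum (fibre E b) (fibre F b)) (fibre G b) p z)"
      using tm(3)[of a b a b] by auto
  qed (use E F G tm(1,2) in auto)
qed

section \<open>K-theory\<close>

lemma Cspace_dim: "hdim (Cspace n) = n"
proof -
  interpret fd_hilbert "Cspace n" by (rule fd_Cspace)
  have ip: "x \<bullet>c unit_vec n i = x $ i" if "i < n" "x \<in> carrier_vec n" for x :: "complex vec" and i
    using that by (auto simp: scalar_prod_def unit_vec_def if_distrib cong: if_cong)
  have inj: "inj_on (unit_vec n :: nat \<Rightarrow> complex vec) {..<n}"
    by (auto simp: inj_on_def)
  have "onb (Cspace n) (unit_vec n ` {..<n})"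
    unfolding onb_def
  proof (intro conjI ballI impI)
    fix x assume x: "x \<in> carrier (Cspace n)" "\<forall>e\<in>unit_vec n ` {..<n}. ip (Cspace n) e x = 0"
    thus "x = \<zero>\<^bsub>Cspace n\<^esub>" using ip by auto
  next
    fix e f :: "complex vec" assume "e \<in> unit_vec n ` {..<n}" "f \<in> unit_vec n ` {..<n}"
    thus "ip (Cspace n) e f = (if e = f then 1 else 0)" using ip by auto
  qed auto
  from onb_dim[OF this] show ?thesis using card_image[OF inj] by simp
qed

subsection \<open>The semiring of isomorphism classes\<close>

text \<open>Every net bundle is isomorphic to one whose fibres have their elements in the type
  \<open>complex vec\<close> (\<open>std_net_exists\<close>), so isomorphism classes are formed among the latter;
  \<open>iso_class\<close> then applies to net bundles with fibres in arbitrary types, see \<open>iso_class_eq_iff\<close>.\<close>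

definition net_rel :: "('k::order, complex vec) net \<Rightarrow> ('k, complex vec) net \<Rightarrow> bool" where
  "net_rel E F \<longleftrightarrow> net_bundle E \<and> net_bundle F \<and> net_iso E F"

quotient_type (overloaded) 'k vclass = "('k::order, complex vec) net" / partial: net_rel
proof (rule part_equivpI)
  show "\<exists>E :: ('k, complex vec) net. net_rel E E"
    using trivial_net_bundle net_iso_refl by (auto simp: net_rel_def)
  show "symp (net_rel :: ('k, complex vec) net \<Rightarrow> _)"
    by (rule sympI) (auto simp: net_rel_def intro: net_iso_sym)
  show "transp (net_rel :: ('k, complex vec) net \<Rightarrow> _)"
    by (rule transpI) (auto simp: net_rel_def intro: net_iso_trans)
qed

definition iso_class :: "('k::order, 'v) net \<Rightarrow> 'k vclass" where
  "iso_class E = abs_vclass (SOME M. net_bundle M \<and> net_iso M E)"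

lemma iso_class_some:
  assumes "net_bundle E"
  shows "net_bundle (SOME M :: ('k::order, complex vec) net. net_bundle M \<and> net_iso M E)"
    "net_iso (SOME M :: ('k::order, complex vec) net. net_bundle M \<and> net_iso M E) E"
  using someI_ex[OF std_net_exists[OF assms]] by auto

lemma iso_class_eq_iff:
  assumes "net_bundle E" "net_bundle F"
  shows "iso_class E = iso_class F \<longleftrightarrow> net_iso E F"
proof -
  let ?M = "SOME M :: ('a, complex vec) net. net_bundle M \<and> net_iso M E"
  let ?N = "SOME M :: ('a, complex vec) net. net_bundle M \<and> net_iso M F"
  note M = iso_class_some[OF assms(1)] and N = iso_class_some[OF assms(2)]
  have "iso_class E = iso_class F \<longleftrightarrow> net_rel ?M ?N"
    unfolding iso_class_def using Quotient3_rel[OF Quotient3_vclass, of ?M ?N] M N net_iso_refl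
    by (auto simp: net_rel_def)
  also have "\<dots> \<longleftrightarrow> net_iso ?M ?N" using M N by (simp add: net_rel_def)
  also have "\<dots> \<longleftrightarrow> net_iso E F"
    using net_iso_trans[OF net_iso_trans[OF net_iso_sym[OF M(1) assms(1) M(2)]] N(2)]
      net_iso_trans[OF net_iso_trans[OF M(2)] net_iso_sym[OF N(1) assms(2) N(2)]] by blast
  finally show ?thesis .
qed

lemma rep_vclass: "net_bundle (rep_vclass x)" "iso_class (rep_vclass x) = x"
proof -
  have r: "net_rel (rep_vclass x) (rep_vclass x)" by (rule Quotient3_rep_reflp[OF Quotient3_vclass])
  thus b: "net_bundle (rep_vclass x)" by (simp add: net_rel_def)
  note M = iso_class_some[OF b]
  have "iso_class (rep_vclass x) = abs_vclass (rep_vclass x)"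
    unfolding iso_class_def by (rule Quotient3_rel_abs[OF Quotient3_vclass]) (use M b in \<open>simp add: net_rel_def\<close>)
  thus "iso_class (rep_vclass x) = x" by (simp add: Quotient3_abs_rep[OF Quotient3_vclass])
qed

lemma iso_class_cases: obtains E :: "('k::order, complex vec) net" where "net_bundle E" "x = iso_class E"
  using rep_vclass[of x] by metis

instantiation vclass :: (order) comm_semiring_1
begin

definition zero_vclass where "0 = iso_class (trivial_net 0)"
definition one_vclass where "1 = iso_class (trivial_net 1)"
definition plus_vclass where "x + y = iso_class (net_sum (rep_vclass x) (rep_vclass y))"
definition times_vclass where "x * y = iso_class (net_tensor (rep_vclass x) (rep_vclass y))"

lemma iso_class_sum:
  assumes "net_bundle E" "net_bundle F"
  shows "iso_class (net_sum E F) = iso_class E + iso_class F"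
proof -
  have "net_iso E (rep_vclass (iso_class E))" "net_iso F (rep_vclass (iso_class F))"
    using iso_class_eq_iff rep_vclass assms by metis+
  thus ?thesis unfolding plus_vclass_def
    using iso_class_eq_iff net_sum_bundle net_sum_cong assms rep_vclass(1) by metis
qed

lemma iso_class_tensor:
  assumes "net_bundle E" "net_bundle F"
  shows "iso_class (net_tensor E F) = iso_class E * iso_class F"
proof -
  have "net_iso E (rep_vclass (iso_class E))" "net_iso F (rep_vclass (iso_class F))"
    using iso_class_eq_iff rep_vclass assms by metis+
  thus ?thesis unfolding times_vclass_def
    using iso_class_eq_iff net_tensor_bundle net_tensor_cong assms rep_vclass(1) by metis
qed

instance
proof
  fix x y z :: "'a vclass"
  obtain E F G :: "('a, complex vec) net" where
    E: "net_bundle E" "x = iso_class E" and F: "net_bundle F" "y = iso_class F" and G: "net_bundle G" "z = iso_class G"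
    using iso_class_cases by metis
  note nb = net_sum_bundle net_tensor_bundle trivial_net_bundle E(1) F(1) G(1)
  have eq: "iso_class A = iso_class B" if "net_iso A B" "net_bundle A" "net_bundle B"
    for A :: "('a, 'p) net" and B :: "('a, 'q) net" using that iso_class_eq_iff by blast
  show "x + y + z = x + (y + z)"
    using eq[OF iso_sum_assoc[OF E(1) F(1) G(1)]] E F G by (simp add: nb iso_class_sum)
  show "x + y = y + x"
    using eq[OF iso_sum_commute[OF E(1) F(1)]] E F by (simp add: nb iso_class_sum)
  show "0 + x = x"
    using eq[OF iso_zero_sum[OF E(1)]] E by (simp add: nb iso_class_sum zero_vclass_def)
  show "x * y * z = x * (y * z)"
    using eq[OF iso_tensor_assoc[OF E(1) F(1) G(1)]] E F G by (simp add: nb iso_class_tensor)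
  show xy: "x * y = y * x"
    using eq[OF iso_tensor_commute[OF E(1) F(1)]] E F by (simp add: nb iso_class_tensor)
  show "1 * x = x"
    using eq[OF iso_one_tensor[OF E(1)]] E by (simp add: nb iso_class_tensor one_vclass_def)
  show "(x + y) * z = x * z + y * z"
    using eq[OF iso_tensor_distrib[OF E(1) F(1) G(1)]] E F G by (simp add: nb iso_class_sum iso_class_tensor)
  show 0: "0 * x = 0"
    using eq[OF iso_zero_tensor[OF E(1)]] E by (simp add: nb iso_class_tensor zero_vclass_def)
  show "x * 0 = 0"
    using eq[OF iso_tensor_commute[OF E(1) trivial_net_bundle[of 0]]] 0 E
    by (simp add: nb iso_class_tensor zero_vclass_def)
  show "(0 :: 'a vclass) \<noteq> 1"
    unfolding zero_vclass_def one_vclass_def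
    using iso_class_eq_iff[OF trivial_net_bundle trivial_net_bundle, of 0 1]
      net_iso_dim[OF trivial_net_bundle[of 0] trivial_net_bundle[of 1]] Cspace_dim by force
qed

end

lemma vclass_no_absorb: "1 + (x :: 'k::order vclass) \<noteq> x"
proof
  assume a: "1 + x = x"
  obtain E :: "('k, complex vec) net" where E: "net_bundle E" "x = iso_class E" by (rule iso_class_cases)
  have "net_iso (net_sum (trivial_net 1) E) E"
    using a E iso_class_eq_iff[OF net_sum_bundle[OF trivial_net_bundle[of 1] E(1)] E(1)]
      iso_class_sum[OF trivial_net_bundle[of 1] E(1)] by (simp add: one_vclass_def)
  from net_iso_dim[OF net_sum_bundle[OF trivial_net_bundle[of 1] E(1)] E(1) this]
  show False using hsum_dim[OF fd_Cspace[of 1] net_bundleD(1)[OF E(1)]] Cspace_dim[of 1] by simp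
qed

lemma iso_class_trivial: "iso_class (trivial_net n :: ('k::order, complex vec) net) = of_nat n"
proof (induct n)
  case (Suc n)
  let ?T = "\<lambda>n. trivial_net n :: ('k, complex vec) net"
  have "net_iso (net_sum (?T 1) (?T n)) (?T (1 + n))"
  proof (rule net_iso_gram[OF net_sum_bundle[OF trivial_net_bundle trivial_net_bundle] trivial_net_bundle,
      where X = "\<lambda>a. carrier_vec 1 \<times> carrier_vec n" and \<phi> = "\<lambda>a p. p"
      and \<psi> = "\<lambda>a (c, d). append_vec c d" and \<tau> = "\<lambda>b a p. p"])
    fix a :: 'k
    show "is_total (fibre (net_sum (?T 1) (?T n)) a) (carrier_vec 1 \<times> carrier_vec n) (\<lambda>p. p)"
      using fd_hilbert.total_surj[OF fd_hsum[OF fd_Cspace[of 1] fd_Cspace[of n]], of "carrier_vec 1 \<times> carrier_vec n" "\<lambda>p. p"]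
      by simp
    have "\<exists>p\<in>carrier_vec 1 \<times> carrier_vec n. x = (case p of (c, d) \<Rightarrow> append_vec c d)"
      if "x \<in> carrier_vec (1 + n)" for x :: "complex vec"
      using vec_first_last_append[OF that]
      by (intro bexI[of _ "(vec_first x 1, vec_last x n)"]) auto
    hence "carrier (Cspace (1 + n)) \<subseteq> (\<lambda>(c, d). append_vec c d) ` (carrier_vec 1 \<times> carrier_vec n)"
      unfolding Cspace_simps image_iff subset_iff by blast
    hence "is_total (Cspace (1 + n)) (carrier_vec 1 \<times> carrier_vec n) (\<lambda>(c, d). append_vec c d)"
      by (intro fd_hilbert.total_surj[OF fd_Cspace[of "1 + n"]]) (auto intro: append_carrier_vec[of _ 1, simplified])
    thus "is_total (fibre (?T (1 + n)) a) (carrier_vec 1 \<times> carrier_vec n) (\<lambda>(c, d). append_vec c d)"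
      by simp
    fix s t :: "complex vec \<times> complex vec"
    assume s: "s \<in> carrier_vec 1 \<times> carrier_vec n" and t: "t \<in> carrier_vec 1 \<times> carrier_vec n"
    have cj: "conjugate (append_vec c d) = append_vec (conjugate c) (conjugate d)" for c d :: "complex vec"
      by (rule eq_vecI) (auto simp: append_vec_def Let_def)
    show "ip (fibre (net_sum (?T 1) (?T n)) a) s t =
        ip (fibre (?T (1 + n)) a) (case s of (c, d) \<Rightarrow> append_vec c d) (case t of (c, d) \<Rightarrow> append_vec c d)"
      using s t by (auto simp: cj scalar_prod_append[of _ 1 _ n])
  qed auto
  hence "iso_class (?T (1 + n)) = iso_class (?T 1) + iso_class (?T n)"
    using iso_class_eq_iff[OF net_sum_bundle[OF trivial_net_bundle trivial_net_bundle] trivial_net_bundle]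
      iso_class_sum[OF trivial_net_bundle trivial_net_bundle] by metis
  thus ?case using Suc by (simp add: one_vclass_def)
qed (simp add: zero_vclass_def)

subsection \<open>The Grothendieck ring\<close>

definition K0_rel :: "'k::order vclass \<times> 'k vclass \<Rightarrow> 'k vclass \<times> 'k vclass \<Rightarrow> bool" where
  "K0_rel = (\<lambda>(a, b) (c, d). \<exists>e. a + d + e = c + b + e)"

quotient_type (overloaded) 'k K0 = "'k::order vclass \<times> 'k vclass" / K0_rel
proof (rule equivpI)
  show "reflp (K0_rel :: 'k vclass \<times> 'k vclass \<Rightarrow> _)" by (auto simp: reflp_def K0_rel_def)
  show "symp (K0_rel :: 'k vclass \<times> 'k vclass \<Rightarrow> _)" by (auto simp: symp_def K0_rel_def) metis
  show "transp (K0_rel :: 'k vclass \<times> 'k vclass \<Rightarrow> _)"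
  proof (rule transpI)
    fix x y z :: "'k vclass \<times> 'k vclass"
    assume "K0_rel x y" "K0_rel y z"
    then obtain a b c d f g e h where x: "x = (a, b)" "y = (c, d)" "z = (f, g)"
      "a + d + e = c + b + e" "c + g + h = f + d + h" by (auto simp: K0_rel_def)
    have "a + g + (d + e + h) = (a + d + e) + (g + h)" by (simp add: ac_simps)
    also have "\<dots> = (c + g + h) + (b + e)" unfolding x(4) by (simp add: ac_simps)
    also have "\<dots> = f + b + (d + e + h)" unfolding x(5) by (simp add: ac_simps)
    finally show "K0_rel x z" using x by (auto simp: K0_rel_def)
  qed
qed

instantiation K0 :: (order) comm_ring_1
begin

lift_definition zero_K0 :: "'a K0" is "(0, 0)" .
lift_definition one_K0 :: "'a K0" is "(1, 0)" .
lift_definition plus_K0 :: "'a K0 \<Rightarrow> 'a K0 \<Rightarrow> 'a K0" is "\<lambda>(a, b) (c, d). (a + c, b + d)"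
proof -
  fix p p' q q' :: "'a vclass \<times> 'a vclass"
  assume "K0_rel p p'" "K0_rel q q'"
  then obtain a b a' b' c d c' d' e f where x: "p = (a, b)" "p' = (a', b')" "q = (c, d)" "q' = (c', d')"
    "a + b' + e = a' + b + e" "c + d' + f = c' + d + f" by (auto simp: K0_rel_def)
  have "(a + c) + (b' + d') + (e + f) = (a + b' + e) + (c + d' + f)" by (simp add: ac_simps)
  also have "\<dots> = (a' + c') + (b + d) + (e + f)" unfolding x by (simp add: ac_simps)
  finally show "K0_rel ((case p of (a, b) \<Rightarrow> \<lambda>(c, d). (a + c, b + d)) q) ((case p' of (a, b) \<Rightarrow> \<lambda>(c, d). (a + c, b + d)) q')"
    using x by (auto simp: K0_rel_def)
qed
lift_definition uminus_K0 :: "'a K0 \<Rightarrow> 'a K0" is "\<lambda>(a, b). (b, a)"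
  by (auto simp: K0_rel_def) (metis add.commute)
definition minus_K0 where "x - y = x + - (y :: 'a K0)"
lift_definition times_K0 :: "'a K0 \<Rightarrow> 'a K0 \<Rightarrow> 'a K0" is "\<lambda>(a, b) (c, d). (a * c + b * d, a * d + b * c)"
proof -
  let ?m = "\<lambda>(a, b) (c, d). (a * c + b * d, a * d + b * c) :: 'a vclass \<times> 'a vclass"
  have comm: "?m p q = ?m q p" for p q by (cases p; cases q) (simp add: ac_simps)
  have 1: "K0_rel (?m p q) (?m p' q)" if "K0_rel p p'" for p p' q
  proof -
    from that obtain a b a' b' e where x: "p = (a, b)" "p' = (a', b')" "a + b' + e = a' + b + e"
      by (auto simp: K0_rel_def)
    obtain c d where q: "q = (c, d)" by force
    have "(a * c + b * d) + (a' * d + b' * c) + (e * c + e * d) = (a + b' + e) * c + (a' + b + e) * d"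
      by (simp add: algebra_simps)
    also have "\<dots> = (a' + b + e) * c + (a + b' + e) * d" unfolding x(3) ..
    also have "\<dots> = (a' * c + b' * d) + (a * d + b * c) + (e * c + e * d)" by (simp add: algebra_simps)
    finally show ?thesis using x q by (auto simp: K0_rel_def)
  qed
  fix p p' q q' :: "'a vclass \<times> 'a vclass"
  assume "K0_rel p p'" "K0_rel q q'"
  from 1[OF this(1), of q] 1[OF this(2), of p']
  have "K0_rel (?m p q) (?m p' q)" "K0_rel (?m p' q) (?m p' q')"
    unfolding comm[of q p'] comm[of q' p'] .
  thus "K0_rel (?m p q) (?m p' q')" by (rule equivp_transp[OF K0_equivp])
qed

instance
proof
  fix x y z :: "'a K0"
  show "x + y + z = x + (y + z)" by transfer (auto simp: K0_rel_def ac_simps)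
  show "x + y = y + x" by transfer (auto simp: K0_rel_def ac_simps)
  show "0 + x = x" by transfer (auto simp: K0_rel_def ac_simps)
  show "- x + x = 0" by transfer (auto simp: K0_rel_def ac_simps)
  show "x - y = x + - y" by (rule minus_K0_def)
  show "x * y * z = x * (y * z)" by transfer (auto simp: K0_rel_def algebra_simps)
  show "x * y = y * x" by transfer (auto simp: K0_rel_def algebra_simps)
  show "1 * x = x" by transfer (auto simp: K0_rel_def algebra_simps)
  show "(x + y) * z = x * z + y * z" by transfer (auto simp: K0_rel_def algebra_simps)
  have "\<not> K0_rel (0, 0 :: 'a vclass) (1, 0)"
  proof
    assume "K0_rel (0, 0 :: 'a vclass) (1, 0)"
    then obtain e :: "'a vclass" where "e = 1 + e" by (auto simp: K0_rel_def)
    thus False using vclass_no_absorb[of e] by simp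
  qed
  thus "(0 :: 'a K0) \<noteq> 1" by transfer
qed

end

definition K0_class :: "('k::order, 'v) net \<Rightarrow> 'k K0" where
  "K0_class E = abs_K0 (iso_class E, 0)"

lemma K0_class_diff:
  fixes E :: "('k::order, 'v) net" and F :: "('k, 'w) net"
  shows "K0_class E - K0_class F = abs_K0 (iso_class E, iso_class F)"
  by (simp add: K0_class_def minus_K0_def uminus_K0.abs_eq plus_K0.abs_eq)

lemma K0_class_eq_iff:
  assumes "net_bundle E" "net_bundle E'" "net_bundle F" "net_bundle F'"
  shows "K0_class E - K0_class E' = K0_class F - K0_class F' \<longleftrightarrow>
    (\<exists>G :: ('k::order, complex vec) net. net_bundle G \<and>
      net_iso (net_sum (net_sum E F') G) (net_sum (net_sum F E') G))"
proof -
  have "K0_class E - K0_class E' = K0_class F - K0_class F' \<longleftrightarrow>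
      (\<exists>e. iso_class E + iso_class F' + e = iso_class F + iso_class E' + e)"
    unfolding K0_class_diff K0.abs_eq_iff K0_rel_def prod.case ..
  also have "\<dots> \<longleftrightarrow> (\<exists>G :: ('k, complex vec) net. net_bundle G \<and>
      iso_class E + iso_class F' + iso_class G = iso_class F + iso_class E' + iso_class G)"
    using rep_vclass by metis
  also have "\<dots> \<longleftrightarrow> (\<exists>G :: ('k, complex vec) net. net_bundle G \<and>
      net_iso (net_sum (net_sum E F') G) (net_sum (net_sum F E') G))"
    using assms by (auto simp: iso_class_eq_iff net_sum_bundle simp flip: iso_class_sum)
  finally show ?thesis .
qed

subsection \<open>Stable equivalence classes\<close>

definition stable_rel :: "'k::order vclass \<Rightarrow> 'k vclass \<Rightarrow> bool" where
  "stable_rel x y \<longleftrightarrow> (\<exists>j k. x + iso_class (trivial_net j) = y + iso_class (trivial_net k))"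

quotient_type (overloaded) 'k stable = "'k::order vclass" / stable_rel
proof (rule equivpI)
  show "reflp (stable_rel :: 'k vclass \<Rightarrow> _)" by (auto simp: reflp_def stable_rel_def)
  show "symp (stable_rel :: 'k vclass \<Rightarrow> _)" by (auto simp: symp_def stable_rel_def) metis
  show "transp (stable_rel :: 'k vclass \<Rightarrow> _)"
  proof (rule transpI)
    fix x y z :: "'k vclass"
    assume "stable_rel x y" "stable_rel y z"
    then obtain j k m n where jk: "x + of_nat j = y + of_nat k" "y + of_nat m = z + of_nat n"
      by (auto simp: stable_rel_def iso_class_trivial)
    have "x + of_nat (j + m) = (x + of_nat j) + of_nat m" by (simp add: ac_simps)
    also have "\<dots> = (y + of_nat m) + of_nat k" unfolding jk(1) by (simp add: ac_simps)
    also have "\<dots> = z + of_nat (n + k)" unfolding jk(2) by (simp add: ac_simps)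
    finally show "stable_rel x z" unfolding stable_rel_def iso_class_trivial by blast
  qed
qed

instantiation stable :: (order) ab_semigroup_add
begin
lift_definition plus_stable :: "'a stable \<Rightarrow> 'a stable \<Rightarrow> 'a stable" is "(+)"
proof -
  fix x x' y y' :: "'a vclass"
  assume "stable_rel x x'" "stable_rel y y'"
  then obtain j k m n where jk: "x + of_nat j = x' + of_nat k" "y + of_nat m = y' + of_nat n"
    by (auto simp: stable_rel_def iso_class_trivial)
  have "(x + y) + of_nat (j + m) = (x + of_nat j) + (y + of_nat m)" by (simp add: ac_simps)
  also have "\<dots> = (x' + y') + of_nat (k + n)" unfolding jk by (simp add: ac_simps)
  finally show "stable_rel (x + y) (x' + y')" unfolding stable_rel_def iso_class_trivial by blast
qed
instance
  by standard (transfer; auto simp: stable_rel_def ac_simps)+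
end

definition stable_class :: "('k::order, 'v) net \<Rightarrow> 'k stable" where
  "stable_class E = abs_stable (iso_class E)"

lemma stable_class_eq_iff:
  assumes "net_bundle E" "net_bundle F"
  shows "stable_class E = stable_class F \<longleftrightarrow>
    (\<exists>j k. net_iso (net_sum E (trivial_net j)) (net_sum F (trivial_net k)))"
  using assms unfolding stable_class_def stable.abs_eq_iff stable_rel_def
  by (simp add: iso_class_eq_iff net_sum_bundle trivial_net_bundle flip: iso_class_sum)


subsection \<open>Chern K-classes\<close>

text \<open>The two maps induced on the Grothendieck ring; they are well defined for connected posets and
  for order-preserving maps respectively (\<open>K0_rank_diff\<close>, \<open>K0_pullback_diff\<close>).\<close>

definition K0_rank :: "'k::order K0 \<Rightarrow> int" where
  "K0_rank x = (THE r. \<forall>(E :: ('k, complex vec) net) (F :: ('k, complex vec) net).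
     net_bundle E \<and> net_bundle F \<and> x = K0_class E - K0_class F \<longrightarrow> r = int (rank E) - int (rank F))"

definition reduced_K0 :: "'k::order K0 set" where
  "reduced_K0 = {x. K0_rank x = 0}"

definition K0_pullback :: "('k2::order \<Rightarrow> 'k::order) \<Rightarrow> 'k K0 \<Rightarrow> 'k2 K0" where
  "K0_pullback \<eta> x = (THE y. \<forall>(E :: ('k, complex vec) net) (F :: ('k, complex vec) net).
     net_bundle E \<and> net_bundle F \<and> x = K0_class E - K0_class F \<longrightarrow>
     y = K0_class (net_pullback \<eta> E) - K0_class (net_pullback \<eta> F))"

lemma net_pullback_bundle: "net_bundle E \<Longrightarrow> mono \<eta> \<Longrightarrow> net_bundle (net_pullback \<eta> E)"
  unfolding net_bundle_def net_pullback_def by (simp add: monoD)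

lemma net_pullback_iso: "net_iso E F \<Longrightarrow> mono \<eta> \<Longrightarrow> net_iso (net_pullback \<eta> E) (net_pullback \<eta> F)"
proof -
  assume *: "net_iso E F" "mono \<eta>"
  then obtain U where "\<forall>a. unitary (fibre E a) (fibre F a) (U a)"
    "\<forall>a b. a \<le> b \<longrightarrow> (\<forall>x\<in>carrier (fibre E a). U b (transport E b a x) = transport F b a (U a x))"
    unfolding net_iso_def by auto
  thus ?thesis unfolding net_iso_def net_pullback_def
    using *(2) by (intro exI[of _ "\<lambda>a. U (\<eta> a)"]) (simp add: monoD)
qed

lemma net_pullback_sum: "net_pullback \<eta> (net_sum E F) = net_sum (net_pullback \<eta> E) (net_pullback \<eta> F)"
  by (simp add: net_pullback_def net_sum_def)

lemma K0_class_std: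
  fixes E :: "('k::order, 'v) net"
  assumes "net_bundle E"
  obtains M :: "('k, complex vec) net" where "net_bundle M" "net_iso M E" "K0_class M = K0_class E"
proof -
  obtain M :: "('k, complex vec) net" where M: "net_bundle M" "net_iso M E"
    using std_net_exists[OF assms] by blast
  have "iso_class M = iso_class E" using iso_class_eq_iff[OF M(1) assms] M(2) by simp
  thus ?thesis using that M by (simp add: K0_class_def)
qed

lemma rank_eq:
  fixes E :: "('k::order, 'v) net"
  assumes "pathwise_connected TYPE('k)" "net_bundle E"
  shows "hdim (fibre E a) = rank E"
proof -
  have le: "hdim (fibre E a) = hdim (fibre E b)" if "a \<le> b" for a b
    by (rule unitary_dim[OF net_bundleD(1,1)[OF assms(2)] net_bundleD(2)[OF assms(2) that]])
  have const: "hdim (fibre E b) = hdim (fibre E a)" for b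
  proof -
    have "(\<lambda>x y. x \<le> y \<or> y \<le> x)\<^sup>*\<^sup>* a b" using assms(1) by (simp add: pathwise_connected_def)
    thus ?thesis
    proof (induct rule: rtranclp_induct)
      case (step y z)
      from step(2) have "hdim (fibre E z) = hdim (fibre E y)"
      proof
        assume "y \<le> z"
        thus ?thesis by (rule le[symmetric])
      qed (rule le)
      thus ?case using step(3) by (rule trans)
    qed simp
  qed
  have "rank E = hdim (fibre E a)" unfolding rank_def
  proof (rule the_equality)
    show "\<forall>b. hdim (fibre E b) = hdim (fibre E a)" using const by (rule allI)
    fix d assume "\<forall>b. hdim (fibre E b) = d"
    hence "hdim (fibre E a) = d" ..
    thus "d = hdim (fibre E a)" by (rule sym)
  qed
  thus ?thesis by simp
qed

lemma K0_rank_diff: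
  fixes E :: "('k::order, 'v) net" and F :: "('k, 'w) net"
  assumes conn: "pathwise_connected TYPE('k)" and EF: "net_bundle E" "net_bundle F"
  shows "K0_rank (K0_class E - K0_class F) = int (rank E) - int (rank F)"
proof -
  have eq: "int (rank A) - int (rank B) = int (rank C) - int (rank D)"
    if nb: "net_bundle A" "net_bundle B" "net_bundle C" "net_bundle D"
      and ne: "K0_class A - K0_class B = K0_class C - K0_class D"
    for A :: "('k, 'a) net" and B :: "('k, 'b) net" and C :: "('k, 'c) net" and D :: "('k, 'd) net"
  proof -
    obtain G :: "('k, complex vec) net" where G: "net_bundle G"
      "net_iso (net_sum (net_sum A D) G) (net_sum (net_sum C B) G)"
      using ne K0_class_eq_iff[OF nb] by blast
    have "hdim (fibre (net_sum (net_sum A D) G) undefined) = hdim (fibre (net_sum (net_sum C B) G) undefined)"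
      by (rule net_iso_dim[OF _ _ G(2)]) (intro net_sum_bundle nb G(1))+
    hence "rank A + rank D + rank G = rank C + rank B + rank G"
      using nb G(1)
      by (simp add: hsum_dim fd_hsum net_bundleD(1) rank_eq[OF conn])
    thus ?thesis by simp
  qed
  obtain M :: "('k, complex vec) net" where M: "net_bundle M" "K0_class M = K0_class E"
    using K0_class_std[OF EF(1)] by metis
  obtain N :: "('k, complex vec) net" where N: "net_bundle N" "K0_class N = K0_class F"
    using K0_class_std[OF EF(2)] by metis
  show ?thesis unfolding K0_rank_def
  proof (rule the_equality)
    fix r assume "\<forall>(A :: ('k, complex vec) net) (B :: ('k, complex vec) net). net_bundle A \<and> net_bundle B \<and>
      K0_class E - K0_class F = K0_class A - K0_class B \<longrightarrow> r = int (rank A) - int (rank B)"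
    hence "r = int (rank M) - int (rank N)" using M N by simp
    thus "r = int (rank E) - int (rank F)" using eq[OF EF M(1) N(1)] M N by simp
  qed (use eq[OF EF] in blast)
qed

lemma K0_pullback_diff:
  fixes E :: "('k::order, 'v) net" and F :: "('k, 'w) net" and \<eta> :: "'k2::order \<Rightarrow> 'k"
  assumes "mono \<eta>" and EF: "net_bundle E" "net_bundle F"
  shows "K0_pullback \<eta> (K0_class E - K0_class F) =
    K0_class (net_pullback \<eta> E) - K0_class (net_pullback \<eta> F)"
proof -
  have eq: "K0_class (net_pullback \<eta> A) - K0_class (net_pullback \<eta> B) =
      K0_class (net_pullback \<eta> C) - K0_class (net_pullback \<eta> D)"
    if nb: "net_bundle A" "net_bundle B" "net_bundle C" "net_bundle D"
      and ne: "K0_class A - K0_class B = K0_class C - K0_class D"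
    for A :: "('k, 'a) net" and B :: "('k, 'b) net" and C :: "('k, 'c) net" and D :: "('k, 'd) net"
  proof -
    obtain G :: "('k, complex vec) net" where G: "net_bundle G"
      "net_iso (net_sum (net_sum A D) G) (net_sum (net_sum C B) G)"
      using ne K0_class_eq_iff[OF nb] by blast
    note pb = net_pullback_bundle[OF _ assms(1)]
    from net_pullback_iso[OF G(2) assms(1)]
    have "iso_class (net_pullback \<eta> A) + iso_class (net_pullback \<eta> D) + iso_class (net_pullback \<eta> G) =
        iso_class (net_pullback \<eta> C) + iso_class (net_pullback \<eta> B) + iso_class (net_pullback \<eta> G)"
      using nb G(1) by (simp add: net_pullback_sum iso_class_eq_iff net_sum_bundle pb flip: iso_class_sum)
    thus ?thesis
      by (simp add: K0_class_diff K0.abs_eq_iff K0_rel_def) blast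
  qed
  obtain M :: "('k, complex vec) net" where M: "net_bundle M" "K0_class M = K0_class E"
    using K0_class_std[OF EF(1)] by metis
  obtain N :: "('k, complex vec) net" where N: "net_bundle N" "K0_class N = K0_class F"
    using K0_class_std[OF EF(2)] by metis
  show ?thesis unfolding K0_pullback_def
  proof (rule the_equality)
    fix y assume "\<forall>(A :: ('k, complex vec) net) (B :: ('k, complex vec) net). net_bundle A \<and> net_bundle B \<and>
      K0_class E - K0_class F = K0_class A - K0_class B \<longrightarrow>
      y = K0_class (net_pullback \<eta> A) - K0_class (net_pullback \<eta> B)"
    hence "y = K0_class (net_pullback \<eta> M) - K0_class (net_pullback \<eta> N)" using M N by simp
    thus "y = K0_class (net_pullback \<eta> E) - K0_class (net_pullback \<eta> F)" using eq[OF EF M(1) N(1)] M N by simp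
  qed (use eq[OF EF] in blast)
qed

definition chern_K :: "('k::order, 'v) net \<Rightarrow> nat \<Rightarrow> 'k K0" where
  "chern_K E i =
     (if i = 0 then 1
      else if i \<le> rank E then
        (\<Sum>k=0..i. (-1) ^ k * of_nat ((rank E - k) choose (i - k)) * K0_class (net_ext k E))
      else 0)"

definition total_chern_K :: "('k::order, 'v) net \<Rightarrow> 'k K0 poly" where
  "total_chern_K E = 1 + (\<Sum>i=1..rank E. Polynomial.monom (chern_K E i) i)"

definition one_plus_h :: "'r::comm_ring_1 set \<Rightarrow> 'r poly set" where
  "one_plus_h R = {p. Polynomial.coeff p 0 = 1 \<and> (\<forall>i>0. Polynomial.coeff p i \<in> R)}"

end

(* The exterior powers satisfy [l^k (E + F)] = sum over j of [l^j E] [l^(k-j) F]. To see this, choose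
   wedge products x_1 ^ ... ^ x_k, normalised so that their Gram matrix is given by determinants of
   inner products: on wedge products of vectors taken from E and F the determinants are block
   diagonal, and a unitary between two spaces is determined by matching total families with equal
   Gram matrices. With d = rank E, the total Chern class is the sum of
   (-h)^k (1 + h)^(d-k) [l^k E], and it is therefore multiplicative. It equals 1 on the trivial
   line bundle, hence it only depends on the stable class. *)

theory Submission
  imports Defs "Jordan_Normal_Form.Determinant"
begin

section \<open>Exterior powers of Hilbert spaces\<close>

text \<open>An isomorphism of net bundles has to commute with all transports, and the fibres carry
  no choice of bases that transports respect. Hence families indexed by all vectors, or by all lists
  of vectors, replace bases: a transport acts on them by moving the index, and naturality becomes a
  statement about indices. Since forms realise the tensors, the inner product with an elementary
  tensor or a wedge is an evaluation, so totality of a family says that a form is determined by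
  certain values.

  The binomial coefficients come from the substitution \<open>t = - h / (1 + h)\<close> in the
  multiplicative series of exterior powers: a line bundle L gets the factor 1 + (1 - [L]) h, which
  is 1 when L is trivial. In the language of lambda-rings the total class is the gamma series of E -
  d at -h. The prefactor (1 + h)^d turns the series into a polynomial because exterior powers beyond
  the rank vanish; the same vanishing makes the exponents in the product match.\<close>

definition tuples :: "nat \<Rightarrow> 'a set \<Rightarrow> 'a list set" where
  "tuples k A = {us. set us \<subseteq> A \<and> length us = k}"

lemma tuples_0 [simp]: "tuples 0 A = {[]}"
  by (auto simp: tuples_def)

lemma tuples_Suc: "tuples (Suc k) A = (\<lambda>(x, us). x # us) ` (A \<times> tuples k A)"
  by (auto simp: tuples_def length_Suc_conv image_iff)

lemma Cons_in_tuples [simp]: "x # us \<in> tuples (Suc k) A \<longleftrightarrow> x \<in> A \<and> us \<in> tuples k A"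
  by (auto simp: tuples_def)

lemma nth_in_tuples: "us \<in> tuples k A \<Longrightarrow> i < k \<Longrightarrow> us ! i \<in> A"
  by (auto simp: tuples_def)

lemma finite_tuples: "finite A \<Longrightarrow> finite (tuples k A)"
  unfolding tuples_def by (rule finite_lists_length_eq)

lemma tuples_mono: "A \<subseteq> B \<Longrightarrow> tuples k A \<subseteq> tuples k B"
  by (auto simp: tuples_def)

lemma map_in_tuples: "us \<in> tuples k A \<Longrightarrow> (\<And>x. x \<in> A \<Longrightarrow> f x \<in> B) \<Longrightarrow> map f us \<in> tuples k B"
  by (auto simp: tuples_def)

lemma list_update_in_tuples: "us \<in> tuples k A \<Longrightarrow> x \<in> A \<Longrightarrow> us[i := x] \<in> tuples k A"
  using set_update_subset_insert[of us i x] by (auto simp: tuples_def)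

lemma permute_list_in_tuples [simp]:
  "p permutes {..<k} \<Longrightarrow> permute_list p us \<in> tuples k A \<longleftrightarrow> us \<in> tuples k A"
  by (auto simp: tuples_def)

lemma sum_tuples_Suc:
  "(\<Sum>us\<in>tuples (Suc k) A. g us) = (\<Sum>x\<in>A. \<Sum>us\<in>tuples k A. (g (x # us) :: complex))"
  unfolding tuples_Suc sum.cartesian_product
  by (subst sum.reindex) (auto simp: inj_on_def case_prod_beta' intro!: sum.cong)

section \<open>Tensor powers and their alternating subspaces as spaces of forms\<close>

lemma htensor_power_simps [simp]:
  "\<zero>\<^bsub>htensor_power k H\<^esub> = (\<lambda>us. 0)" "f \<oplus>\<^bsub>htensor_power k H\<^esub> g = (\<lambda>us. f us + g us)"
  "c \<odot>\<^bsub>htensor_power k H\<^esub> f = (\<lambda>us. c * f us)"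
  by (auto simp: htensor_power_def tuples_def)

lemma hext_power_simps [simp]:
  "\<zero>\<^bsub>hext_power k H\<^esub> = (\<lambda>us. 0)" "f \<oplus>\<^bsub>hext_power k H\<^esub> g = (\<lambda>us. f us + g us)"
  "c \<odot>\<^bsub>hext_power k H\<^esub> f = (\<lambda>us. c * f us)"
  by (auto simp: hext_power_def htensor_power_def tuples_def)

lemma htensor_power_ip: "ip (htensor_power k H) f g = (\<Sum>us\<in>tuples k (some_onb H). cnj (f us) * g us)"
  by (auto simp: htensor_power_def tuples_def)

lemma htensor_power_carrier:
  "f \<in> carrier (htensor_power k H) \<longleftrightarrow>
     (\<forall>us. us \<notin> tuples k (carrier H) \<longrightarrow> f us = 0) \<and>
     (\<forall>us\<in>tuples k (carrier H). \<forall>i<k. \<forall>x\<in>carrier H.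
        (\<forall>y\<in>carrier H. f (us[i := x \<oplus>\<^bsub>H\<^esub> y]) = f (us[i := x]) + f (us[i := y])) \<and>
        (\<forall>c. f (us[i := c \<odot>\<^bsub>H\<^esub> x]) = cnj c * f (us[i := x])))"
  unfolding htensor_power_def tuples_def by auto

lemma hext_power_ip: "ip (hext_power k H) f g = (\<Sum>us\<in>tuples k (some_onb H). cnj (f us) * g us)"
  by (auto simp: hext_power_def htensor_power_def tuples_def)

lemma hext_power_carrier:
  "f \<in> carrier (hext_power k H) \<longleftrightarrow> f \<in> carrier (htensor_power k H) \<and>
     (\<forall>p us. p permutes {..<k} \<and> length us = k \<longrightarrow> f (permute_list p us) = of_int (sign p) * f us)"
  unfolding hext_power_def by auto

lemma htensor_power_outside: "f \<in> carrier (htensor_power k H) \<Longrightarrow> us \<notin> tuples k (carrier H) \<Longrightarrow> f us = 0"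
  by (simp add: htensor_power_carrier)

text \<open>The factor \<open>1 / sqrt (fact k)\<close> turns the Gram matrix of wedge products into the determinants of
  inner products (\<open>wedge_gram\<close>); evaluating at \<open>us\<close> then is the inner product with \<open>wedge k H us\<close>
  only up to \<open>sqrt (fact k)\<close> (\<open>wedge_repro\<close>).\<close>

definition wedge :: "nat \<Rightarrow> 'v hilb \<Rightarrow> 'v list \<Rightarrow> 'v list \<Rightarrow> complex" where
  "wedge k H us = (\<lambda>vs. if vs \<in> tuples k (carrier H)
     then det (mat k k (\<lambda>(i, j). ip H (vs ! i) (us ! j))) / sqrt (fact k) else 0)"

context
  fixes H :: "'v hilb"
  assumes fd: "fd_hilbert H"
begin

interpretation fd_hilbert H by (rule fd)

text \<open>Fixing the first argument lowers the degree by one, which drives the inductions on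
  \<open>k\<close> below. The two linearity clauses put no condition on \<open>us\<close>, because
  forms vanish on every list outside \<open>tuples\<close>.\<close>

lemma htensor_power_Cons:
  assumes f: "f \<in> carrier (htensor_power (Suc k) H)"
  shows "\<And>x. x \<in> carrier H \<Longrightarrow> (\<lambda>us. f (x # us)) \<in> carrier (htensor_power k H)"
    "\<And>x y us. x \<in> carrier H \<Longrightarrow> y \<in> carrier H \<Longrightarrow> f ((x \<oplus>\<^bsub>H\<^esub> y) # us) = f (x # us) + f (y # us)"
    "\<And>c x us. x \<in> carrier H \<Longrightarrow> f ((c \<odot>\<^bsub>H\<^esub> x) # us) = cnj c * f (x # us)"
proof -
  note out = htensor_power_outside[OF f]
  have D: "f (us[i := x \<oplus>\<^bsub>H\<^esub> y]) = f (us[i := x]) + f (us[i := y])"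
    "f (us[i := c \<odot>\<^bsub>H\<^esub> x]) = cnj c * f (us[i := x])"
    if "us \<in> tuples (Suc k) (carrier H)" "i < Suc k" "x \<in> carrier H" "y \<in> carrier H" for us i x y c
    using f that unfolding htensor_power_carrier by blast+
  show "(\<lambda>us. f (x # us)) \<in> carrier (htensor_power k H)" if x: "x \<in> carrier H" for x
    unfolding htensor_power_carrier
  proof (intro conjI allI impI ballI)
    fix us i y z c
    assume "us \<in> tuples k (carrier H)" "i < k" and y: "y \<in> carrier H"
    hence us: "x # us \<in> tuples (Suc k) (carrier H)" "Suc i < Suc k" using x by auto
    show "f (x # us[i := c \<odot>\<^bsub>H\<^esub> y]) = cnj c * f (x # us[i := y])"
      using D(2)[OF us y y] by simp
    show "f (x # us[i := y \<oplus>\<^bsub>H\<^esub> z]) = f (x # us[i := y]) + f (x # us[i := z])" if "z \<in> carrier H"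
      using D(1)[OF us y that] by simp
  qed (use out in auto)
  show "f ((x \<oplus>\<^bsub>H\<^esub> y) # us) = f (x # us) + f (y # us)" if "x \<in> carrier H" "y \<in> carrier H" for x y us
  proof (cases "us \<in> tuples k (carrier H)")
    case True
    thus ?thesis using D(1)[of "x # us" 0 x y] that by simp
  qed (simp add: out)
  show "f ((c \<odot>\<^bsub>H\<^esub> x) # us) = cnj c * f (x # us)" if "x \<in> carrier H" for x c us
  proof (cases "us \<in> tuples k (carrier H)")
    case True
    thus ?thesis using D(2)[of "x # us" 0 x x] that by simp
  qed (simp add: out)
qed

text \<open>\<open>antilinear_expand\<close> is applied to one slot after the other; the
  coefficients are conjugated because forms are antilinear in each slot.\<close>

lemma htensor_power_expand:
  assumes B: "onb H B"
  shows "f \<in> carrier (htensor_power k H) \<Longrightarrow> us \<in> tuples k (carrier H) \<Longrightarrow>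
    f us = (\<Sum>bs\<in>tuples k B. cnj (\<Prod>i<k. ip H (bs ! i) (us ! i)) * f bs)"
proof (induction k arbitrary: f us)
  case (Suc k)
  obtain x vs where us: "us = x # vs" "x \<in> carrier H" "vs \<in> tuples k (carrier H)"
    using Suc.prems(2) by (auto simp: tuples_Suc)
  note fC = htensor_power_Cons[OF Suc.prems(1)]
  have Bc: "b \<in> B \<Longrightarrow> b \<in> carrier H" for b using B by (auto simp: onb_def)
  have "f us = (\<Sum>b\<in>B. cnj (ip H b x) * f (b # vs))"
    unfolding us(1) by (rule antilinear_expand[OF B us(2)]) (auto intro: fC)
  also have "\<dots> = (\<Sum>b\<in>B. cnj (ip H b x) * (\<Sum>bs\<in>tuples k B. cnj (\<Prod>i<k. ip H (bs ! i) (vs ! i)) * f (b # bs)))"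
    using Suc.IH[OF fC(1) us(3)] Bc by (intro sum.cong refl) simp
  also have "\<dots> = (\<Sum>bs\<in>tuples (Suc k) B. cnj (\<Prod>i<Suc k. ip H (bs ! i) (us ! i)) * f bs)"
    unfolding sum_tuples_Suc us(1) prod.lessThan_Suc_shift by (simp add: sum_distrib_left mult_ac)
  finally show ?case .
qed simp

text \<open>This is how totality is used for forms: values on lists from a total family determine a
  form, one slot at a time.\<close>

lemma htensor_power_eq_zero:
  assumes tot: "is_total H X \<phi>"
  shows "f \<in> carrier (htensor_power k H) \<Longrightarrow> (\<And>ts. ts \<in> tuples k X \<Longrightarrow> f (map \<phi> ts) = 0) \<Longrightarrow> f = (\<lambda>us. 0)"
proof (induction k arbitrary: f)
  case 0
  show ?case
  proof
    fix us
    show "f us = 0" using 0(2)[of "[]"] htensor_power_outside[OF 0(1), of us] by (cases "us = []") auto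
  qed
next
  case (Suc k)
  note fC = htensor_power_Cons[OF Suc.prems(1)]
  have \<phi>c: "\<And>t. t \<in> X \<Longrightarrow> \<phi> t \<in> carrier H" using tot by (auto simp: is_total_def)
  have 1: "f (\<phi> t # us) = 0" if t: "t \<in> X" for t us
  proof -
    have "(\<lambda>us. f (\<phi> t # us)) = (\<lambda>us. 0)"
      by (rule Suc.IH[OF fC(1)]) (use t \<phi>c Suc.prems(2)[of "t # ts" for ts] in auto)
    thus ?thesis by meson
  qed
  have 2: "f (x # us) = 0" if "x \<in> carrier H" for x us
  proof -
    \<comment> \<open>The zero set in the first slot is a subspace containing the total family,
      hence the whole space.\<close>
    have "x \<in> {x \<in> carrier H. f (x # us) = 0}"
      by (rule total_closed[OF tot]) (use that fC \<phi>c 1 fC(3)[of "\<zero>\<^bsub>H\<^esub>" 0] zero_smult in auto)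
    thus ?thesis by simp
  qed
  have "f us = 0" for us
  proof (cases "us \<in> tuples (Suc k) (carrier H)")
    case True
    then obtain x vs where "us = x # vs" "x \<in> carrier H" by (auto simp: tuples_Suc)
    thus ?thesis using 2 by simp
  qed (rule htensor_power_outside[OF Suc.prems(1)])
  thus ?case by blast
qed

text \<open>The elementary tensor of the entries of \<open>us\<close>, the \<open>k\<close>-fold
  analogue of \<open>elem_tensor\<close>.\<close>

definition ptensor :: "nat \<Rightarrow> 'v list \<Rightarrow> 'v list \<Rightarrow> complex" where
  "ptensor k us = (\<lambda>vs. if vs \<in> tuples k (carrier H) then \<Prod>i<k. ip H (vs ! i) (us ! i) else 0)"

lemma ptensor_carrier:
  assumes us: "us \<in> tuples k (carrier H)"
  shows "ptensor k us \<in> carrier (htensor_power k H)"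
  unfolding htensor_power_carrier
proof (intro conjI allI impI ballI)
  fix vs i x y c
  assume vs: "vs \<in> tuples k (carrier H)" and i: "i < k" and x: "x \<in> carrier H"
  \<comment> \<open>Isolating the factor of slot \<open>i\<close> reduces both linearity conditions
    to those of the inner product.\<close>
  have *: "ptensor k us (vs[i := z]) = ip H z (us ! i) * (\<Prod>l\<in>{..<k} - {i}. ip H (vs ! l) (us ! l))"
    if z: "z \<in> carrier H" for z
  proof -
    have "length vs = k" using vs by (simp add: tuples_def)
    thus ?thesis using list_update_in_tuples[OF vs z] i unfolding ptensor_def
      by (simp add: prod.remove[of "{..<k}" i])
  qed
  have ui: "us ! i \<in> carrier H" using nth_in_tuples[OF us i] .
  show "ptensor k us (vs[i := c \<odot>\<^bsub>H\<^esub> x]) = cnj c * ptensor k us (vs[i := x])"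
    using x ui by (simp add: * ip_smult_left)
  show "ptensor k us (vs[i := x \<oplus>\<^bsub>H\<^esub> y]) = ptensor k us (vs[i := x]) + ptensor k us (vs[i := y])" if "y \<in> carrier H"
    using x that ui by (simp add: * ip_add_left algebra_simps)
qed (simp add: ptensor_def)

lemma some_onb_carrier: "tuples k (some_onb H) \<subseteq> tuples k (carrier H)"
  using some_onb by (intro tuples_mono) (simp add: onb_def)

text \<open>The sum defining the inner product with an elementary tensor is literally the basis
  expansion of \<open>f us\<close>.\<close>

lemma ptensor_repro:
  assumes "f \<in> carrier (htensor_power k H)" "us \<in> tuples k (carrier H)"
  shows "ip (htensor_power k H) (ptensor k us) f = f us"
  using htensor_power_expand[OF some_onb assms] some_onb_carrier[of k]
  by (auto simp: htensor_power_ip ptensor_def subset_iff intro!: sum.cong)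

lemma fd_htensor_power: "fd_hilbert (htensor_power k H)"
proof (rule fd_hilbertI)
  let ?T = "htensor_power k H" and ?B = "tuples k (some_onb H)"
  have car: "f \<in> carrier ?T \<Longrightarrow> g \<in> carrier ?T \<Longrightarrow> (\<lambda>us. f us + g us) \<in> carrier ?T"
    "f \<in> carrier ?T \<Longrightarrow> (\<lambda>us. c * f us) \<in> carrier ?T" for f g c
    unfolding htensor_power_carrier by (simp_all add: algebra_simps)
  show vs: "vectorspace class_ring ?T"
  proof (rule vs_criteria)
    show "\<forall>v\<in>carrier ?T. \<exists>neg_v\<in>carrier ?T. v \<oplus>\<^bsub>?T\<^esub> neg_v = \<zero>\<^bsub>?T\<^esub>"
    proof
      fix f assume "f \<in> carrier ?T"
      from car(2)[OF this, of "-1"] show "\<exists>g\<in>carrier ?T. f \<oplus>\<^bsub>?T\<^esub> g = \<zero>\<^bsub>?T\<^esub>"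
        by (rule bexI[rotated]) simp
    qed
  qed (use car in \<open>auto simp: class_field algebra_simps htensor_power_carrier\<close>)
  note Bc = subsetD[OF some_onb_carrier[of k]]
  have Bf: "finite ?B" using some_onb by (intro finite_tuples) (simp add: onb_def)
  have zero: "f = (\<lambda>us. 0)" if f: "f \<in> carrier ?T" and z: "\<And>bs. bs \<in> ?B \<Longrightarrow> f bs = 0" for f
    using htensor_power_eq_zero[OF is_totalb[OF some_onb] f] z by simp
  show "ip ?T x y = cnj (ip ?T y x)" for x y by (simp add: htensor_power_ip mult.commute)
  show "ip ?T x (y \<oplus>\<^bsub>?T\<^esub> z) = ip ?T x y + ip ?T x z" for x y z by (simp add: htensor_power_ip algebra_simps sum.distrib)
  show "ip ?T x (c \<odot>\<^bsub>?T\<^esub> y) = c * ip ?T x y" for x y c by (simp add: htensor_power_ip sum_distrib_left algebra_simps)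
  show "Re (ip ?T f f) > 0" if f: "f \<in> carrier ?T" "f \<noteq> \<zero>\<^bsub>?T\<^esub>" for f
  proof -
    obtain bs where bs: "bs \<in> ?B" "f bs \<noteq> 0" using zero f by auto
    have "Re (ip ?T f f) = (\<Sum>bs\<in>?B. (cmod (f bs))\<^sup>2)"
      by (auto simp: htensor_power_ip cmod_power2 intro!: sum.cong) (simp add: power2_eq_square)
    also have "\<dots> > 0" using bs Bf by (intro sum_pos2[of _ bs]) auto
    finally show ?thesis .
  qed
  have gr: "ip ?T (ptensor k us) (ptensor k vs) = (if us = vs then 1 else 0)" if uv: "us \<in> ?B" "vs \<in> ?B" for us vs
  proof -
    have "ip ?T (ptensor k us) (ptensor k vs) = (\<Prod>i<k. ip H (us ! i) (vs ! i))"
      using ptensor_repro[OF ptensor_carrier] uv Bc by (simp add: ptensor_def)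
    also have "\<dots> = (\<Prod>i<k. if us ! i = vs ! i then 1 else 0)"
      using some_onb nth_in_tuples[OF uv(1)] nth_in_tuples[OF uv(2)] by (intro prod.cong) (auto simp: onb_def)
    also have "\<dots> = (if us = vs then 1 else 0)"
    proof (cases "us = vs")
      case False
      then obtain i where "i < k" "us ! i \<noteq> vs ! i" using uv by (auto simp: tuples_def list_eq_iff_nth_eq)
      thus ?thesis using False by (auto simp: prod_zero_iff)
    qed simp
    finally show ?thesis .
  qed
  show "onb ?T (ptensor k ` ?B)"
    unfolding onb_def
  proof (intro conjI ballI impI)
    show "finite (ptensor k ` ?B)" using Bf by simp
    show "ptensor k ` ?B \<subseteq> carrier ?T" using Bc ptensor_carrier by auto
  next
    fix p q assume "p \<in> ptensor k ` ?B" "q \<in> ptensor k ` ?B"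
    then obtain us vs where p: "us \<in> ?B" "vs \<in> ?B" "p = ptensor k us" "q = ptensor k vs" by auto
    show "ip ?T p q = (if p = q then 1 else 0)"
      \<comment> \<open>Different lists give different tensors: equal ones would have inner product
        both 0 and 1.\<close>
      using gr[OF p(1,2)] gr[OF p(1,1)] unfolding p(3,4) by (metis zero_neq_one)
  next
    fix f assume f: "f \<in> carrier ?T" "\<forall>e\<in>ptensor k ` ?B. ip ?T e f = 0"
    have "f = (\<lambda>us. 0)" by (rule zero[OF f(1)]) (use f(2) ptensor_repro[OF f(1)] Bc in auto)
    thus "f = \<zero>\<^bsub>?T\<^esub>" by simp
  qed
qed

lemma fd_hext_power: "fd_hilbert (hext_power k H)"
proof -
  let ?T = "htensor_power k H" and ?S = "hext_power k H"
  interpret T: fd_hilbert ?T by (rule fd_htensor_power)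
  have sub: "carrier ?S \<subseteq> carrier ?T" by (auto simp: hext_power_carrier)
  have car: "f \<in> carrier ?S \<Longrightarrow> g \<in> carrier ?S \<Longrightarrow> (\<lambda>us. f us + g us) \<in> carrier ?S"
    "f \<in> carrier ?S \<Longrightarrow> (\<lambda>us. c * f us) \<in> carrier ?S" "(\<lambda>us. 0) \<in> carrier ?S" for f g c
    unfolding hext_power_carrier htensor_power_carrier by (simp_all add: algebra_simps)
  have ips: "ip ?S = ip ?T" by (intro ext) (simp add: hext_power_ip htensor_power_ip)
  \<comment> \<open>The basis is found abstractly as a maximal orthonormal set of the subspace, so
    no explicit basis with increasing indices has to be handled.\<close>
  obtain B where B: "finite B" "B \<subseteq> carrier ?S" "\<forall>e\<in>B. \<forall>f\<in>B. ip ?T e f = (if e = f then 1 else 0)"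
    "\<And>x. x \<in> carrier ?S \<Longrightarrow> (\<forall>e\<in>B. ip ?T e x = 0) \<Longrightarrow> x = \<zero>\<^bsub>?T\<^esub>"
    by (rule T.onb_subspace[OF sub]) (use car in \<open>auto intro: that\<close>)
  show ?thesis
  proof (rule fd_hilbertI)
    show vs: "vectorspace class_ring ?S"
    proof (rule vs_criteria)
      show "\<forall>v\<in>carrier ?S. \<exists>neg_v\<in>carrier ?S. v \<oplus>\<^bsub>?S\<^esub> neg_v = \<zero>\<^bsub>?S\<^esub>"
      proof
        fix f assume "f \<in> carrier ?S"
        from car(2)[OF this, of "-1"] show "\<exists>g\<in>carrier ?S. f \<oplus>\<^bsub>?S\<^esub> g = \<zero>\<^bsub>?S\<^esub>"
          by (rule bexI[rotated]) simp
      qed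
    qed (use car in \<open>auto simp: class_field algebra_simps\<close>)
    show "onb ?S B" using B unfolding onb_def ips by simp
    show "ip ?S x y = cnj (ip ?S y x)" for x y by (simp add: hext_power_ip mult.commute)
    show "ip ?S x (y \<oplus>\<^bsub>?S\<^esub> z) = ip ?S x y + ip ?S x z" for x y z by (simp add: hext_power_ip algebra_simps sum.distrib)
    show "ip ?S x (c \<odot>\<^bsub>?S\<^esub> y) = c * ip ?S x y" for x y c by (simp add: hext_power_ip sum_distrib_left algebra_simps)
    show "Re (ip ?S f f) > 0" if "f \<in> carrier ?S" "f \<noteq> \<zero>\<^bsub>?S\<^esub>" for f
      unfolding ips by (rule T.ip_pos) (use that sub in auto)
  qed
qed

section \<open>Wedge products as antisymmetrised elementary tensors\<close>

lemma wedge_ptensor: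
  assumes us: "us \<in> tuples k (carrier H)"
  shows "wedge k H us = (\<lambda>vs. (\<Sum>p | p permutes {..<k}. of_int (sign p) * ptensor k (permute_list p us) vs) / sqrt (fact k))"
proof
  fix vs
  have l: "length us = k" using us by (simp add: tuples_def)
  show "wedge k H us vs = (\<Sum>p | p permutes {..<k}. of_int (sign p) * ptensor k (permute_list p us) vs) / sqrt (fact k)"
  proof (cases "vs \<in> tuples k (carrier H)")
    case True
    \<comment> \<open>The Leibniz formula: the summand for \<open>p\<close> is, up to sign, the
      elementary tensor of the permuted list.\<close>
    have "det (mat k k (\<lambda>(i, j). ip H (vs ! i) (us ! j))) =
      (\<Sum>p | p permutes {..<k}. of_int (sign p) * (\<Prod>i<k. ip H (vs ! i) (us ! p i)))"
      unfolding det_def'[OF mat_carrier] atLeast0LessThan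
    proof (intro sum.cong refl arg_cong2[where f = "(*)"] prod.cong)
      fix p i assume "p \<in> {p. p permutes {..<k}}" "i \<in> {..<k}"
      hence "p i < k" "i < k" using permutes_in_image[of p "{..<k}" i] by auto
      thus "mat k k (\<lambda>(i, j). ip H (vs ! i) (us ! j)) $$ (i, p i) = ip H (vs ! i) (us ! p i)" by simp
    qed
    also have "\<dots> = (\<Sum>p | p permutes {..<k}. of_int (sign p) * ptensor k (permute_list p us) vs)"
      unfolding ptensor_def if_P[OF True]
      by (intro sum.cong refl arg_cong2[where f = "(*)"] prod.cong) (auto simp: permute_list_nth l)
    finally show ?thesis unfolding wedge_def if_P[OF True] by simp
  qed (simp add: wedge_def ptensor_def)
qed

lemma wedge_carrier:
  assumes us: "us \<in> tuples k (carrier H)"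
  shows "wedge k H us \<in> carrier (hext_power k H)"
  unfolding hext_power_carrier
proof (intro conjI allI impI)
  have "permute_list p us \<in> tuples k (carrier H)" if "p permutes {..<k}" for p using us that by simp
  from ptensor_carrier[OF this] show "wedge k H us \<in> carrier (htensor_power k H)"
    unfolding wedge_ptensor[OF us] htensor_power_carrier
    by (auto simp: add_divide_distrib distrib_left sum.distrib sum_distrib_left mult_ac)
  fix p and vs :: "'v list" assume p: "p permutes {..<k} \<and> length vs = k"
  show "wedge k H us (permute_list p vs) = of_int (sign p) * wedge k H us vs"
  proof (cases "vs \<in> tuples k (carrier H)")
    case True
    let ?A = "mat k k (\<lambda>(i, j). ip H (vs ! i) (us ! j))"
    \<comment> \<open>Permuting the arguments permutes the rows of the determinant, so its
      antisymmetry becomes that of the form.\<close>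
    have "mat k k (\<lambda>(i, j). ip H (permute_list p vs ! i) (us ! j)) = mat k k (\<lambda>(i, j). ?A $$ (p i, j))"
      using p by (intro eq_matI) (auto simp: permute_list_nth permutes_in_image[of p "{..<k}", simplified])
    thus ?thesis using True p det_permute_rows[of ?A k p] by (simp add: wedge_def atLeast0LessThan)
  qed (use p in \<open>simp add: wedge_def\<close>)
qed

text \<open>By antisymmetry of \<open>f\<close> all \<open>fact k\<close> terms of the wedge
  contribute the same value \<open>f us\<close>; dividing by the normalising square root leaves
  \<open>sqrt (fact k)\<close>.\<close>

lemma wedge_repro:
  assumes f: "f \<in> carrier (hext_power k H)" and us: "us \<in> tuples k (carrier H)"
  shows "ip (hext_power k H) (wedge k H us) f = complex_of_real (sqrt (fact k)) * f us"
proof -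
  let ?B = "tuples k (some_onb H)" and ?P = "{p. p permutes {..<k}}"
  have fT: "f \<in> carrier (htensor_power k H)" using f by (simp add: hext_power_carrier)
  have P: "permute_list p us \<in> tuples k (carrier H)" if "p permutes {..<k}" for p using us that by simp
  have l: "length us = k" using us by (simp add: tuples_def)
  have "ip (hext_power k H) (wedge k H us) f =
    (\<Sum>bs\<in>?B. \<Sum>p\<in>?P. of_int (sign p) * (cnj (ptensor k (permute_list p us) bs) * f bs)) / sqrt (fact k)"
    unfolding wedge_ptensor[OF us] by (simp add: hext_power_ip sum_distrib_right sum_distrib_left sum_divide_distrib mult_ac)
  also have "\<dots> = (\<Sum>p\<in>?P. of_int (sign p) * ip (htensor_power k H) (ptensor k (permute_list p us)) f) / sqrt (fact k)"
    by (subst sum.swap) (simp add: htensor_power_ip sum_distrib_left)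
  also have "\<dots> = (\<Sum>p\<in>?P. f us) / sqrt (fact k)"
  proof (intro arg_cong2[where f = "(/)"] sum.cong refl)
    fix p assume "p \<in> ?P"
    hence p: "p permutes {..<k}" by simp
    have "ip (htensor_power k H) (ptensor k (permute_list p us)) f = of_int (sign p) * f us"
      using ptensor_repro[OF fT P[OF p]] f p l by (simp add: hext_power_carrier)
    thus "of_int (sign p) * ip (htensor_power k H) (ptensor k (permute_list p us)) f = f us"
      \<comment> \<open>The sign of the permuted tensor meets the sign from the antisymmetry of
        \<open>f\<close>, and their product is 1.\<close>
      by (simp add: sign_def)
  qed
  also have "\<dots> = complex_of_real (fact k) / complex_of_real (sqrt (fact k)) * f us"
    by (simp add: card_permutations[OF refl])
  also have "complex_of_real (fact k) / complex_of_real (sqrt (fact k)) = complex_of_real (sqrt (fact k))"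
    using real_div_sqrt[of "fact k"] unfolding of_real_divide[symmetric] by simp
  finally show ?thesis .
qed

lemma wedge_gram:
  assumes "us \<in> tuples k (carrier H)" "ws \<in> tuples k (carrier H)"
  shows "ip (hext_power k H) (wedge k H us) (wedge k H ws) = det (mat k k (\<lambda>(i, j). ip H (us ! i) (ws ! j)))"
proof -
  have "wedge k H ws us = det (mat k k (\<lambda>(i, j). ip H (us ! i) (ws ! j))) / complex_of_real (sqrt (fact k))"
    using assms(1) by (simp add: wedge_def)
  thus ?thesis using wedge_repro[OF wedge_carrier[OF assms(2)] assms(1)] by simp
qed

text \<open>By \<open>wedge_repro\<close>, being orthogonal to a wedge means vanishing at its list.
  Totality thus becomes a uniqueness statement for alternating forms, which both
  \<open>wedge_total\<close> and \<open>join_tuples_total\<close> verify.\<close>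

lemma wedge_total_if:
  assumes "\<And>t. t \<in> X \<Longrightarrow> \<phi> t \<in> tuples k (carrier H)"
    and "\<And>f. f \<in> carrier (hext_power k H) \<Longrightarrow> (\<And>t. t \<in> X \<Longrightarrow> f (\<phi> t) = 0) \<Longrightarrow> f = (\<lambda>us. 0)"
  shows "is_total (hext_power k H) X (\<lambda>t. wedge k H (\<phi> t))"
  unfolding is_total_def
proof (intro conjI ballI impI)
  fix f assume f: "f \<in> carrier (hext_power k H)" "\<forall>t\<in>X. ip (hext_power k H) (wedge k H (\<phi> t)) f = 0"
  have "f (\<phi> t) = 0" if "t \<in> X" for t
    using wedge_repro[OF f(1) assms(1)[OF that]] f(2) that by simp
  thus "f = \<zero>\<^bsub>hext_power k H\<^esub>" using assms(2)[OF f(1)] by simp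
next
  show "wedge k H (\<phi> t) \<in> carrier (hext_power k H)" if "t \<in> X" for t
    using wedge_carrier[OF assms(1)[OF that]] .
qed

lemma wedge_total:
  assumes "is_total H X \<phi>"
  shows "is_total (hext_power k H) (tuples k X) (\<lambda>ts. wedge k H (map \<phi> ts))"
proof (rule wedge_total_if)
  show "map \<phi> t \<in> tuples k (carrier H)" if "t \<in> tuples k X" for t
    by (rule map_in_tuples[OF that]) (use assms in \<open>simp add: is_total_def\<close>)
  show "f = (\<lambda>us. 0)" if "f \<in> carrier (hext_power k H)" "\<And>t. t \<in> tuples k X \<Longrightarrow> f (map \<phi> t) = 0" for f
    using htensor_power_eq_zero[OF assms, of f k] that by (simp add: hext_power_carrier)
qed

lemma wedge_total_id: "is_total (hext_power k H) (tuples k (carrier H)) (wedge k H)"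
  using wedge_total[OF total_id[OF fd fd]] by simp

text \<open>By the pigeonhole principle a list of more than \<open>dim\<close> basis vectors has a
  repeated entry. Swapping the equal entries fixes the list but changes the sign of the value, so
  the value is 0.\<close>

lemma hext_power_trivial:
  assumes k: "k > dim"
  shows "carrier (hext_power k H) \<subseteq> {\<lambda>us. 0}"
proof
  fix f assume f: "f \<in> carrier (hext_power k H)"
  have "f bs = 0" if bs: "bs \<in> tuples k (some_onb H)" for bs
  proof -
    have "card (set bs) \<le> dim" unfolding onb_dim[OF some_onb]
      using bs some_onb by (intro card_mono) (auto simp: tuples_def onb_def)
    hence "\<not> distinct bs" using k bs by (auto simp: tuples_def distinct_card)
    then obtain i j where ij: "i < k" "j < k" "i \<noteq> j" "bs ! i = bs ! j"
      using bs by (auto simp: distinct_conv_nth tuples_def)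
    have p: "Transposition.transpose i j permutes {..<k}" using ij by (intro permutes_swap_id) auto
    have l: "length bs = k" using bs by (simp add: tuples_def)
    have "permute_list (Transposition.transpose i j) bs = bs"
      using ij l p by (intro nth_equalityI) (auto simp: permute_list_nth transpose_def)
    moreover have "f (permute_list (Transposition.transpose i j) bs) = of_int (sign (Transposition.transpose i j)) * f bs"
      using f p l by (simp add: hext_power_carrier)
    moreover have "sign (Transposition.transpose i j) = - 1" using ij(3) by (simp add: sign_swap_id)
    ultimately have "f bs = - f bs" by simp
    thus ?thesis by simp
  qed
  thus "f \<in> {\<lambda>us. 0}"
    using htensor_power_eq_zero[OF is_totalb[OF some_onb], of f k] f by (simp add: hext_power_carrier)
qed

end


text \<open>\<open>gram\<close> provides a unitary \<open>W\<close> with the desired values on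
  wedges. That the explicit formula agrees with \<open>W\<close> on wedges is not enough for
  \<open>linear_total_eq\<close>, which presupposes two unitaries; so the two are compared pointwise
  on every alternating form.\<close>

lemma tensor_power_map:
  assumes fd: "fd_hilbert H" "fd_hilbert K" and U: "unitary H K U"
  shows "unitary (hext_power k H) (hext_power k K) (tensor_power_map k H K U)"
    and "\<And>us. us \<in> tuples k (carrier H) \<Longrightarrow> tensor_power_map k H K U (wedge k H us) = wedge k K (map U us)"
proof -
  let ?V = "inv_into (carrier H) U" and ?T = "tensor_power_map k H K U"
  note UD = unitaryD[OF U] and UI = unitary_inv[OF U fd(1)]
  note VD = unitaryD[OF UI(1)]
  note fdh = fd_hext_power[OF fd(1)] fd_hext_power[OF fd(2)]
  have T: "?T f us = (if us \<in> tuples k (carrier K) then f (map ?V us) else 0)" for f us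
    by (auto simp: tensor_power_map_def tuples_def)
  have mU: "map U us \<in> tuples k (carrier K)" if "us \<in> tuples k (carrier H)" for us
    using that UD(1) by (rule map_in_tuples)
  have mV: "map ?V us \<in> tuples k (carrier H)" if "us \<in> tuples k (carrier K)" for us
    using that VD(1) by (rule map_in_tuples)
  have UV: "map U (map ?V us) = us" if "us \<in> tuples k (carrier K)" for us
    using that UI(3) by (auto simp: tuples_def intro!: map_idI)
  show tw: "?T (wedge k H us) = wedge k K (map U us)" if us: "us \<in> tuples k (carrier H)" for us
  proof
    fix vs
    show "?T (wedge k H us) vs = wedge k K (map U us) vs"
    proof (cases "vs \<in> tuples k (carrier K)")
      case True
      have "mat k k (\<lambda>(i, j). ip H (map ?V vs ! i) (us ! j)) = mat k k (\<lambda>(i, j). ip K (vs ! i) (map U us ! j))"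
      proof (rule eq_matI; simp)
        fix i j assume ij: "i < k" "j < k"
        have c: "vs ! i \<in> carrier K" "us ! j \<in> carrier H" using nth_in_tuples True us ij by blast+
        have "ip H (?V (vs ! i)) (us ! j) = ip K (vs ! i) (U (us ! j))"
          using UD(4)[OF VD(1)[OF c(1)] c(2)] UI(3)[OF c(1)] by simp
        thus "ip H (map ?V vs ! i) (us ! j) = ip K (vs ! i) (map U us ! j)"
          using True us ij by (simp add: tuples_def)
      qed
      thus ?thesis using True mV[OF True] by (simp add: T wedge_def)
    qed (simp add: T wedge_def)
  qed
  have tot: "is_total (hext_power k K) (tuples k (carrier H)) (\<lambda>us. wedge k K (map U us))"
    using wedge_total[OF fd(2) total_unitary[OF fd(2) U]] .
  have "ip (hext_power k H) (wedge k H s) (wedge k H t) = ip (hext_power k K) (wedge k K (map U s)) (wedge k K (map U t))"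
    if st: "s \<in> tuples k (carrier H)" "t \<in> tuples k (carrier H)" for s t
  proof -
    have "mat k k (\<lambda>(i, j). ip H (s ! i) (t ! j)) = mat k k (\<lambda>(i, j). ip K (map U s ! i) (map U t ! j))"
      using st UD(4) by (intro eq_matI) (auto simp: tuples_def subset_iff)
    thus ?thesis using wedge_gram[OF fd(1) st] wedge_gram[OF fd(2) mU mU] st by simp
  qed
  from gram[OF fdh wedge_total_id[OF fd(1)] tot this] obtain W where
    W: "unitary (hext_power k H) (hext_power k K) W" "\<And>us. us \<in> tuples k (carrier H) \<Longrightarrow> W (wedge k H us) = wedge k K (map U us)"
    by blast
  note WD = unitaryD[OF W(1)]
  have "?T f = W f" if f: "f \<in> carrier (hext_power k H)" for f
  proof
    fix vs
    have Wf: "W f \<in> carrier (htensor_power k K)" using WD(1)[OF f] by (simp add: hext_power_carrier)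
    show "?T f vs = W f vs"
    proof (cases "vs \<in> tuples k (carrier K)")
      case True
      \<comment> \<open>The value at \<open>vs\<close> is, up to a nonzero factor, the inner product
        with the wedge of \<open>vs\<close>, which is the image under \<open>W\<close> of the wedge
        of the preimages.\<close>
      have "complex_of_real (sqrt (fact k)) * W f vs = ip (hext_power k K) (W (wedge k H (map ?V vs))) (W f)"
        using wedge_repro[OF fd(2) WD(1)[OF f] True] W(2)[OF mV[OF True]] UV[OF True] by simp
      also have "\<dots> = ip (hext_power k H) (wedge k H (map ?V vs)) f"
        by (rule WD(4)[OF wedge_carrier[OF fd(1) mV[OF True]] f])
      also have "\<dots> = complex_of_real (sqrt (fact k)) * f (map ?V vs)"
        by (rule wedge_repro[OF fd(1) f mV[OF True]])
      finally show ?thesis using True by (simp add: T)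
    qed (simp add: T htensor_power_outside[OF Wf])
  qed
  thus "unitary (hext_power k H) (hext_power k K) ?T"
    by (rule unitary_cong[OF W(1) _ fdh(1)])
qed

section \<open>Exterior powers of net bundles\<close>

lemma net_ext_simps [simp]:
  "fibre (net_ext k E) a = hext_power k (fibre E a)"
  "transport (net_ext k E) b a = tensor_power_map k (fibre E a) (fibre E b) (transport E b a)"
  by (auto simp: net_ext_def)

text \<open>Both functoriality laws are equations between unitaries, so they may be tested on
  wedges, where transports act entry by entry on lists.\<close>

lemma net_ext_bundle:
  assumes "net_bundle E"
  shows "net_bundle (net_ext k E)"
proof -
  note E = net_bundleD[OF assms]
  note tm = tensor_power_map[OF E(1) E(1) E(2)]
  have tup: "map (transport E b a) us \<in> tuples k (carrier (fibre E b))"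
    if "us \<in> tuples k (carrier (fibre E a))" "a \<le> b" for a b us
    using map_in_tuples[OF that(1)] E(5)[OF that(2)] by blast
  have id: "map (transport E a a) us = us" if "us \<in> tuples k (carrier (fibre E a))" for a us
    using that E(3) by (auto simp: tuples_def intro!: map_idI)
  have comp: "map (transport E c b) (map (transport E b a) us) = map (transport E c a) us"
    if "a \<le> b" "b \<le> c" "us \<in> tuples k (carrier (fibre E a))" for a b c us
    using that E(4) by (auto simp: tuples_def)
  show ?thesis unfolding net_bundle_def
  proof (intro conjI allI impI ballI)
    show fd: "fd_hilbert (fibre (net_ext k E) a)" for a using fd_hext_power[OF E(1)] by simp
    show un: "unitary (fibre (net_ext k E) a) (fibre (net_ext k E) b) (transport (net_ext k E) b a)" if "a \<le> b" for a b
      using tm(1)[OF that] by simp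
    show "transport (net_ext k E) a a x = x" if "x \<in> carrier (fibre (net_ext k E) a)" for a x
      by (rule linear_total_eq[OF fd[of a] fd[of a] _ un[of a a] unitary_id])
        (use wedge_total_id[OF E(1)] tm(2)[of a a] id that in auto)
    show "transport (net_ext k E) c b (transport (net_ext k E) b a x) = transport (net_ext k E) c a x"
      if "a \<le> b" "b \<le> c" "x \<in> carrier (fibre (net_ext k E) a)" for a b c x
    proof (rule linear_total_eq[OF fd[of a] fd[of c] _ unitary_comp[OF un un] un])
      show "is_total (fibre (net_ext k E) a) (tuples k (carrier (fibre E a))) (wedge k (fibre E a))"
        using wedge_total_id[OF E(1)] by simp
      show "transport (net_ext k E) c b (transport (net_ext k E) b a (wedge k (fibre E a) t)) =
          transport (net_ext k E) c a (wedge k (fibre E a) t)" if "t \<in> tuples k (carrier (fibre E a))" for t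
        using tm(2) tup[OF that \<open>a \<le> b\<close>] comp[OF \<open>a \<le> b\<close> \<open>b \<le> c\<close> that] that order_trans[OF \<open>a \<le> b\<close> \<open>b \<le> c\<close>] \<open>a \<le> b\<close> \<open>b \<le> c\<close>
        by (simp del: map_map)
    qed (use that order_trans[OF that(1,2)] in auto)
  qed
qed

text \<open>Both exterior powers are indexed by lists from the fibres of \<open>E\<close>, on the
  side of \<open>F\<close> through \<open>U\<close>. The intertwining property of \<open>U\<close>
  says exactly that transports of both move the index alike.\<close>

lemma net_ext_cong:
  assumes EF: "net_bundle E" "net_bundle F" and "net_iso E F"
  shows "net_iso (net_ext k E) (net_ext k F)"
proof -
  note E = net_bundleD[OF EF(1)] and F = net_bundleD[OF EF(2)]
  obtain U where U: "\<And>a. unitary (fibre E a) (fibre F a) (U a)"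
    "\<And>a b x. a \<le> b \<Longrightarrow> x \<in> carrier (fibre E a) \<Longrightarrow> U b (transport E b a x) = transport F b a (U a x)"
    using assms(3) unfolding net_iso_def by blast
  note tE = tensor_power_map[OF E(1) E(1) E(2)] and tF = tensor_power_map[OF F(1) F(1) F(2)]
    and tU = tensor_power_map[OF E(1) F(1) U(1)]
  have tup: "map (transport E b a) us \<in> tuples k (carrier (fibre E b))"
    "map (U a) us \<in> tuples k (carrier (fibre F a))"
    if "us \<in> tuples k (carrier (fibre E a))" "a \<le> b" for a b us
    using map_in_tuples[OF that(1)] E(5)[OF that(2)] unitaryD(1)[OF U(1)] by blast+
  have comm: "map (U b) (map (transport E b a) us) = map (transport F b a) (map (U a) us)"
    if "a \<le> b" "us \<in> tuples k (carrier (fibre E a))" for a b us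
    using that U(2) by (auto simp: tuples_def)
  show ?thesis
  proof (rule net_iso_gram[where X = "\<lambda>a. tuples k (carrier (fibre E a))" and \<phi> = "\<lambda>a. wedge k (fibre E a)"
      and \<psi> = "\<lambda>a us. wedge k (fibre F a) (map (U a) us)" and \<tau> = "\<lambda>b a. map (transport E b a)"])
    show "net_bundle (net_ext k E)" "net_bundle (net_ext k F)" by (intro net_ext_bundle EF)+
    fix a
    show "is_total (fibre (net_ext k E) a) (tuples k (carrier (fibre E a))) (wedge k (fibre E a))"
      using wedge_total_id[OF E(1)] by simp
    show "is_total (fibre (net_ext k F) a) (tuples k (carrier (fibre E a))) (\<lambda>us. wedge k (fibre F a) (map (U a) us))"
      using wedge_total[OF F(1) total_unitary[OF F(1) U(1)]] by simp
    fix s t assume st: "s \<in> tuples k (carrier (fibre E a))" "t \<in> tuples k (carrier (fibre E a))"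
    show "ip (fibre (net_ext k E) a) (wedge k (fibre E a) s) (wedge k (fibre E a) t) =
        ip (fibre (net_ext k F) a) (wedge k (fibre F a) (map (U a) s)) (wedge k (fibre F a) (map (U a) t))"
      using unitaryD(4)[OF tU(1) wedge_carrier[OF E(1) st(1)] wedge_carrier[OF E(1) st(2)]] tU(2) st by simp
  next
    fix a b us assume "a \<le> b" "us \<in> tuples k (carrier (fibre E a))"
    thus "transport (net_ext k F) b a (wedge k (fibre F a) (map (U a) us)) = wedge k (fibre F b) (map (U b) (map (transport E b a) us))"
      using tF(2) tup comm by (simp del: map_map)
  qed (use tup tE(2) in auto)
qed

section \<open>Pullback of exterior powers, and exterior powers of degree 0, of degree 1 and beyond
  the rank\<close>

lemma net_pullback_ext: "net_pullback \<eta> (net_ext k E) = net_ext k (net_pullback \<eta> E)"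
  by (simp add: net_pullback_def net_ext_def)

text \<open>The only list of length 0 is \<open>[]\<close>. Its wedge is fixed by all transports and
  is a unit vector, because the empty determinant is 1.\<close>

lemma iso_class_ext_0:
  assumes "net_bundle E"
  shows "iso_class (net_ext 0 E) = 1"
proof -
  note E = net_bundleD[OF assms]
  have "net_iso (net_ext 0 E) (trivial_net 1)"
  proof (rule net_iso_gram[where X = "\<lambda>a. {[]}" and \<phi> = "\<lambda>a. wedge 0 (fibre E a)"
      and \<psi> = "\<lambda>a us. unit_vec 1 0" and \<tau> = "\<lambda>b a us. us"])
    show "is_total (fibre (net_ext 0 E) a) {[]} (wedge 0 (fibre E a))" for a
      using wedge_total_id[OF E(1), of 0 a] by simp
    show "is_total (fibre (trivial_net 1 :: ('a, complex vec) net) a) {[]} (\<lambda>us. unit_vec 1 0)" for a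
      by (auto simp: is_total_def scalar_prod_def)
    show "transport (net_ext 0 E) b a (wedge 0 (fibre E a) us) = wedge 0 (fibre E b) us"
      if "a \<le> b" "us \<in> {[]}" for a b us
      using tensor_power_map(2)[OF E(1) E(1) E(2)[OF that(1)], of us 0] that(2) by simp
    show "ip (fibre (net_ext 0 E) a) (wedge 0 (fibre E a) s) (wedge 0 (fibre E a) t) =
        ip (fibre (trivial_net 1 :: ('a, complex vec) net) a) (unit_vec 1 0) (unit_vec 1 0)" if "s \<in> {[]}" "t \<in> {[]}" for a s t
      using that wedge_gram[OF E(1), of s 0 a t] by (simp add: scalar_prod_def det_dim_zero)
  qed (use net_ext_bundle[OF assms] trivial_net_bundle in auto)
  thus ?thesis unfolding one_vclass_def
    using iso_class_eq_iff[OF net_ext_bundle[OF assms] trivial_net_bundle] by blast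
qed

text \<open>A determinant of size one is its entry, so the wedges of singletons have the Gram matrix
  of the vectors themselves. This gives the first Chern class of the trivial line bundle.\<close>

lemma iso_class_ext_1:
  assumes "net_bundle E"
  shows "iso_class (net_ext 1 E) = iso_class E"
proof -
  note E = net_bundleD[OF assms]
  have "net_iso (net_ext 1 E) E"
  proof (rule net_iso_gram[where X = "\<lambda>a. carrier (fibre E a)" and \<phi> = "\<lambda>a x. wedge 1 (fibre E a) [x]"
      and \<psi> = "\<lambda>a x. x" and \<tau> = "\<lambda>b a. transport E b a"])
    have X: "tuples 1 A = (\<lambda>x. [x]) ` A" for A :: "'b set" using tuples_Suc[of 0 A] by auto
    show "is_total (fibre (net_ext 1 E) a) (carrier (fibre E a)) (\<lambda>x. wedge 1 (fibre E a) [x])" for a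
      using wedge_total_id[OF E(1), of 1 a] unfolding X by (simp add: is_total_def)
    show "is_total (fibre E a) (carrier (fibre E a)) (\<lambda>x. x)" for a by (rule total_id'[OF assms])
    show "transport (net_ext 1 E) b a (wedge 1 (fibre E a) [x]) = wedge 1 (fibre E b) [transport E b a x]"
      if "a \<le> b" "x \<in> carrier (fibre E a)" for a b x
      using tensor_power_map(2)[OF E(1) E(1) E(2)[OF that(1)], of "[x]" 1] that(2) by (simp add: X)
    show "ip (fibre (net_ext 1 E) a) (wedge 1 (fibre E a) [x]) (wedge 1 (fibre E a) [y]) = ip (fibre E a) x y"
      if "x \<in> carrier (fibre E a)" "y \<in> carrier (fibre E a)" for a x y
      using that wedge_gram[OF E(1), of "[x]" 1 a "[y]"] by (simp add: X det_single)
  qed (use net_ext_bundle[OF assms] assms E(5) in auto)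
  thus ?thesis using iso_class_eq_iff[OF net_ext_bundle[OF assms] assms] by blast
qed

lemma iso_class_ext_eq_0:
  assumes "net_bundle E" "\<And>a. hdim (fibre E a) < k"
  shows "iso_class (net_ext k E) = 0"
proof -
  note E = net_bundleD[OF assms(1)]
  have "net_iso (net_ext k E) (trivial_net 0)"
    \<comment> \<open>In a zero space the empty family is total.\<close>
    by (rule net_iso_gram[OF net_ext_bundle[OF assms(1)] trivial_net_bundle, where X = "\<lambda>a. {}" and \<tau> = "\<lambda>b a x. x"])
      (use hext_power_trivial[OF E(1) assms(2)] in \<open>auto simp: is_total_def\<close>)
  thus ?thesis unfolding zero_vclass_def
    using iso_class_eq_iff[OF net_ext_bundle[OF assms(1)] trivial_net_bundle] by blast
qed


section \<open>The exterior powers of a direct sum\<close>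

text \<open>A zero column puts a unit vector into the kernel.\<close>

lemma det_zero_col:
  fixes A :: "'a :: field mat"
  assumes A: "A \<in> carrier_mat n n" and l: "l < n" and z: "\<And>i. i < n \<Longrightarrow> A $$ (i, l) = 0"
  shows "det A = 0"
proof -
  have "A *\<^sub>v unit_vec n l = 0\<^sub>v n"
    using A l z by (intro eq_vecI) (auto simp: scalar_prod_right_unit)
  moreover have "unit_vec n l \<noteq> (0\<^sub>v n :: 'a vec)" using l by simp
  ultimately show ?thesis using det_0_iff_vec_prod_zero_field[OF A] by (metis unit_vec_carrier)
qed

text \<open>The wedge of this list is the counterpart, in the exterior power of the direct sum, of
  the wedge of \<open>us\<close> tensored with the wedge of \<open>vs\<close>.\<close>

definition join_tuples :: "'v hilb \<Rightarrow> 'w hilb \<Rightarrow> 'v list \<Rightarrow> 'w list \<Rightarrow> ('v \<times> 'w) list" where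
  "join_tuples H H' us vs = map (\<lambda>x. (x, \<zero>\<^bsub>H'\<^esub>)) us @ map (\<lambda>y. (\<zero>\<^bsub>H\<^esub>, y)) vs"

context
  fixes H :: "'v hilb" and H' :: "'w hilb"
  assumes fd: "fd_hilbert H" "fd_hilbert H'"
begin

interpretation H: fd_hilbert H by (rule fd)
interpretation H': fd_hilbert H' by (rule fd)

lemma join_tuples_carrier:
  assumes "j \<le> k" "us \<in> tuples j (carrier H)" "vs \<in> tuples (k - j) (carrier H')"
  shows "join_tuples H H' us vs \<in> tuples k (carrier (hsum H H'))"
  using assms by (auto simp: join_tuples_def tuples_def)

text \<open>Rows and columns are both cut after position \<open>j\<close>, although the columns
  change from \<open>H\<close> to \<open>H'\<close> at \<open>j'\<close>. One off-diagonal block is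
  zero in any case; if \<open>j \<noteq> j'\<close>, a diagonal block also has a column pairing
  vectors of different summands only, and the determinant vanishes.\<close>

lemma det_join_tuples:
  assumes j: "j \<le> k" "us \<in> tuples j (carrier H)" "vs \<in> tuples (k - j) (carrier H')"
    and j': "j' \<le> k" "us' \<in> tuples j' (carrier H)" "vs' \<in> tuples (k - j') (carrier H')"
  shows "det (mat k k (\<lambda>(i, l). ip (hsum H H') (join_tuples H H' us vs ! i) (join_tuples H H' us' vs' ! l))) =
    (if j = j' then det (mat j j (\<lambda>(i, l). ip H (us ! i) (us' ! l))) *
       det (mat (k - j) (k - j) (\<lambda>(i, l). ip H' (vs ! i) (vs' ! l))) else 0)"
proof -
  define M where "M i l = ip (hsum H H') (join_tuples H H' us vs ! i) (join_tuples H H' us' vs' ! l)" for i l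
  define A where "A = mat j j (\<lambda>(i, l). M i l)"
  define B where "B = mat j (k - j) (\<lambda>(i, l). M i (l + j))"
  define C where "C = mat (k - j) j (\<lambda>(i, l). M (i + j) l)"
  define D where "D = mat (k - j) (k - j) (\<lambda>(i, l). M (i + j) (l + j))"
  have len: "length us = j" "length vs = k - j" "length us' = j'" "length vs' = k - j'"
    using j j' by (auto simp: tuples_def)
  have blocks: "mat k k (\<lambda>(i, l). M i l) = four_block_mat A B C D"
    using j(1) by (intro eq_matI) (auto simp: A_def B_def C_def D_def)
  have car: "A \<in> carrier_mat j j" "B \<in> carrier_mat j (k - j)" "C \<in> carrier_mat (k - j) j" "D \<in> carrier_mat (k - j) (k - j)"
    by (auto simp: A_def B_def C_def D_def)
  have c: "us ! i \<in> carrier H" "us' ! i' \<in> carrier H" "vs ! l \<in> carrier H'" "vs' ! l' \<in> carrier H'"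
    if "i < j" "i' < j'" "l < k - j" "l' < k - j'" for i i' l l'
    using nth_in_tuples that j j' by blast+
  have M: "M i l = (if i < j then if l < j' then ip H (us ! i) (us' ! l) else 0
      else if l < j' then 0 else ip H' (vs ! (i - j)) (vs' ! (l - j')))" if "i < k" "l < k" for i l
    using that len j(1) j'(1) nth_in_tuples[OF j(2), of i] nth_in_tuples[OF j'(2), of l]
      nth_in_tuples[OF j(3), of "i - j"] nth_in_tuples[OF j'(3), of "l - j'"]
    by (auto simp: M_def join_tuples_def nth_append)
  show ?thesis
  proof (cases "j \<le> j'")
    case True
    have "C = 0\<^sub>m (k - j) j" using True j j' by (intro eq_matI) (auto simp: C_def M)
    hence det: "det (four_block_mat A B C D) = det A * det D"
      using det_four_block_mat_lower_left_zero[OF car(1,2) _ car(4)] by simp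
    show ?thesis
    proof (cases "j = j'")
      case True
      have "A = mat j j (\<lambda>(i, l). ip H (us ! i) (us' ! l))"
        using True j by (intro eq_matI) (auto simp: A_def M)
      moreover have "D = mat (k - j) (k - j) (\<lambda>(i, l). ip H' (vs ! i) (vs' ! l))"
        using True j by (intro eq_matI) (auto simp: D_def M)
      ultimately show ?thesis using det True blocks by (simp add: M_def)
    next
      case False
      \<comment> \<open>The first column of \<open>D\<close> has index \<open>j < j'\<close> in the
        full matrix: it comes from \<open>H\<close>, while all rows of \<open>D\<close> come from
        \<open>H'\<close>.\<close>
      have "det D = 0" by (rule det_zero_col[OF car(4), of 0])
        (use False \<open>j \<le> j'\<close> j' in \<open>auto simp: D_def M\<close>)
      thus ?thesis using det False blocks by (simp add: M_def)
    qed
  next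
    case False
    have "B = 0\<^sub>m j (k - j)" using False j j' by (intro eq_matI) (auto simp: B_def M)
    hence det: "det (four_block_mat A B C D) = det A * det D"
      using det_four_block_mat_upper_right_zero[OF car(1) _ car(3,4)] by simp
    \<comment> \<open>Column \<open>j' < j\<close> comes from \<open>H'\<close>, while all rows of
      \<open>A\<close> come from \<open>H\<close>.\<close>
    have "det A = 0" by (rule det_zero_col[OF car(1), of j'])
        (use False j in \<open>auto simp: A_def M\<close>)
    thus ?thesis using det False blocks by (simp add: M_def)
  qed
qed

text \<open>The value 0 for \<open>j \<noteq> j'\<close> is the orthogonality of different summands,
  so the joined wedges have the Gram matrix of the direct sum over \<open>j\<close> of tensor
  products of exterior powers.\<close>

lemma join_tuples_gram:
  assumes j: "j \<le> k" "us \<in> tuples j (carrier H)" "vs \<in> tuples (k - j) (carrier H')"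
    and j': "j' \<le> k" "us' \<in> tuples j' (carrier H)" "vs' \<in> tuples (k - j') (carrier H')"
  shows "ip (hext_power k (hsum H H')) (wedge k (hsum H H') (join_tuples H H' us vs))
      (wedge k (hsum H H') (join_tuples H H' us' vs')) =
    (if j = j' then ip (htensor (hext_power j H) (hext_power (k - j) H'))
       (elem_tensor (hext_power j H) (hext_power (k - j) H') (wedge j H us) (wedge (k - j) H' vs))
       (elem_tensor (hext_power j H) (hext_power (k - j) H') (wedge j H us') (wedge (k - j) H' vs')) else 0)"
proof -
  note e = elem_gram[OF fd_hext_power[OF fd(1)] fd_hext_power[OF fd(2)]]
  note w = wedge_carrier[OF fd(1)] wedge_carrier[OF fd(2)]
  show ?thesis
    unfolding wedge_gram[OF fd_hsum[OF fd] join_tuples_carrier[OF j] join_tuples_carrier[OF j']] det_join_tuples[OF j j']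
    using j j' by (auto simp: e[OF w w] wedge_gram[OF fd(1)] wedge_gram[OF fd(2)])
qed

text \<open>Vectors lying in one of the two summands are total in the sum. A list of such vectors
  becomes a joined list after a permutation, which changes the value of an alternating form by a
  sign only.\<close>

lemma join_tuples_total:
  "is_total (hext_power k (hsum H H')) (SIGMA j:{..<Suc k}. tuples j (carrier H) \<times> tuples (k - j) (carrier H'))
     (\<lambda>(j, us, vs). wedge k (hsum H H') (join_tuples H H' us vs))"
proof -
  let ?S = "hsum H H'" and ?X = "(\<lambda>x. (x, \<zero>\<^bsub>H'\<^esub>)) ` carrier H \<union> (\<lambda>y. (\<zero>\<^bsub>H\<^esub>, y)) ` carrier H'"
  have tot: "is_total ?S ?X (\<lambda>p. p)" unfolding is_total_def
  proof (intro conjI ballI impI)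
    fix p assume p: "p \<in> carrier ?S" "\<forall>t\<in>?X. ip ?S t p = 0"
    have "ip H (fst p) (fst p) = 0" using p(1) bspec[OF p(2), of "(fst p, \<zero>\<^bsub>H'\<^esub>)"] by auto
    moreover have "ip H' (snd p) (snd p) = 0" using p(1) bspec[OF p(2), of "(\<zero>\<^bsub>H\<^esub>, snd p)"] by auto
    ultimately show "p = \<zero>\<^bsub>?S\<^esub>" using p(1) H.ip_self_zero H'.ip_self_zero by (auto simp: prod_eq_iff)
  qed auto
  have "is_total (hext_power k ?S) (SIGMA j:{..<Suc k}. tuples j (carrier H) \<times> tuples (k - j) (carrier H'))
     (\<lambda>t. wedge k ?S (case t of (j, us, vs) \<Rightarrow> join_tuples H H' us vs))"
  proof (rule wedge_total_if[OF fd_hsum[OF fd]])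
    fix t assume "t \<in> (SIGMA j:{..<Suc k}. tuples j (carrier H) \<times> tuples (k - j) (carrier H'))"
    then obtain j us vs where "t = (j, us, vs)" "j \<le> k" "us \<in> tuples j (carrier H)" "vs \<in> tuples (k - j) (carrier H')"
      by (auto simp: less_Suc_eq_le)
    thus "(case t of (j, us, vs) \<Rightarrow> join_tuples H H' us vs) \<in> tuples k (carrier ?S)"
      using join_tuples_carrier[of j k us vs] by simp
  next
    fix f assume f: "f \<in> carrier (hext_power k ?S)"
      and z: "\<And>t. t \<in> (SIGMA j:{..<Suc k}. tuples j (carrier H) \<times> tuples (k - j) (carrier H')) \<Longrightarrow>
        f (case t of (j, us, vs) \<Rightarrow> join_tuples H H' us vs) = 0"
    have "f ts = 0" if ts: "ts \<in> tuples k ?X" for ts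
    proof -
      \<comment> \<open>The zero vector belongs to both summands; this predicate assigns it to
        \<open>H\<close>.\<close>
      let ?P = "\<lambda>p. snd p = \<zero>\<^bsub>H'\<^esub>"
      define us where "us = map fst (filter ?P ts)"
      define vs where "vs = map snd (filter (\<lambda>p. \<not> ?P p) ts)"
      define j where "j = length us"
      have l: "length us + length vs = k"
        using ts sum_length_filter_compl[of ?P ts] by (simp add: us_def vs_def tuples_def)
      have j: "j \<le> k" "us \<in> tuples j (carrier H)" "vs \<in> tuples (k - j) (carrier H')"
        using l ts by (auto simp: j_def us_def vs_def tuples_def)
      have "join_tuples H H' us vs = filter ?P ts @ filter (\<lambda>p. \<not> ?P p) ts"
        using ts unfolding join_tuples_def us_def vs_def
        by (auto simp: tuples_def intro!: map_idI)
      \<comment> \<open>Sorting the entries by summand keeps the multiset, and equal multisets yield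
        the permutation.\<close>
      hence "mset (join_tuples H H' us vs) = mset ts" by simp
      then obtain p where p: "p permutes {..<length ts}" "permute_list p ts = join_tuples H H' us vs"
        by (rule mset_eq_permutation)
      have "f (permute_list p ts) = of_int (sign p) * f ts"
        using f p(1) ts by (simp add: hext_power_carrier tuples_def)
      moreover have "f (join_tuples H H' us vs) = 0" using z[of "(j, us, vs)"] j by simp
      ultimately show ?thesis using p(2) by (simp add: sign_def split: if_splits)
    qed
    thus "f = (\<lambda>us. 0)"
      using htensor_power_eq_zero[OF fd_hsum[OF fd] tot, of f k] f by (simp add: hext_power_carrier)
  qed
  thus ?thesis by (simp add: case_prod_beta')
qed

end

section \<open>Direct sums of finite families of net bundles, and the sum formula for exterior
  powers\<close>

lemma fd_hilbert_zero_closed: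
  assumes "fd_hilbert H"
  shows "\<zero>\<^bsub>H\<^esub> \<in> carrier H"
proof -
  interpret fd_hilbert H by fact
  show ?thesis by (rule zero_closed)
qed

lemma unitary_zero:
  assumes "fd_hilbert H" "fd_hilbert H'" "unitary H H' U"
  shows "U \<zero>\<^bsub>H\<^esub> = \<zero>\<^bsub>H'\<^esub>"
proof -
  interpret H: fd_hilbert H by fact
  interpret H': fd_hilbert H' by fact
  have "U \<zero>\<^bsub>H\<^esub> = U (0 \<odot>\<^bsub>H\<^esub> \<zero>\<^bsub>H\<^esub>)" using H.zero_smult by simp
  also have "\<dots> = \<zero>\<^bsub>H'\<^esub>"
    using unitaryD(3)[OF assms(3), of "\<zero>\<^bsub>H\<^esub>" 0] unitaryD(1)[OF assms(3), of "\<zero>\<^bsub>H\<^esub>"] H'.zero_smult by simp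
  finally show ?thesis .
qed

text \<open>The fibres of a direct sum of \<open>n\<close> bundles would have a type depending on \<open>n\<close>; here the sum is
  realised with fibres in \<open>complex vec\<close> and is accessible through the total family \<open>\<psi>\<close> only.\<close>

lemma direct_sum_exists:
  fixes N :: "nat \<Rightarrow> ('k::order, 'v) net" and X :: "nat \<Rightarrow> 'k \<Rightarrow> 't set"
  assumes N: "\<And>j. net_bundle (N j)"
    and tot: "\<And>j a. is_total (fibre (N j) a) (X j a) (\<phi> j a)"
    and tau: "\<And>j a b t. a \<le> b \<Longrightarrow> t \<in> X j a \<Longrightarrow> \<tau> j b a t \<in> X j b"
      "\<And>j a b t. a \<le> b \<Longrightarrow> t \<in> X j a \<Longrightarrow> transport (N j) b a (\<phi> j a t) = \<phi> j b (\<tau> j b a t)"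
  shows "\<exists>(S :: ('k, complex vec) net) \<psi>. net_bundle S \<and> iso_class S = (\<Sum>j<n. iso_class (N j)) \<and>
    (\<forall>a. is_total (fibre S a) (SIGMA j:{..<n}. X j a) (\<lambda>(j, t). \<psi> j a t)) \<and>
    (\<forall>a. \<forall>i<n. \<forall>j<n. \<forall>s\<in>X i a. \<forall>t\<in>X j a. ip (fibre S a) (\<psi> i a s) (\<psi> j a t) =
       (if i = j then ip (fibre (N j) a) (\<phi> j a s) (\<phi> j a t) else 0)) \<and>
    (\<forall>a b. \<forall>j<n. \<forall>t\<in>X j a. a \<le> b \<longrightarrow> transport S b a (\<psi> j a t) = \<psi> j b (\<tau> j b a t))"
proof (induction n)
  case 0
  have "is_total (fibre (trivial_net 0 :: ('k, complex vec) net) a) (SIGMA j:{..<0}. X j a) \<psi>" for \<psi> a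
    by (auto simp: is_total_def)
  thus ?case
    by (intro exI[of _ "trivial_net 0"]) (auto simp: trivial_net_bundle zero_vclass_def)
next
  case (Suc n)
  then obtain S :: "('k, complex vec) net" and \<psi> where S: "net_bundle S" "iso_class S = (\<Sum>j<n. iso_class (N j))"
    "\<And>a. is_total (fibre S a) (SIGMA j:{..<n}. X j a) (\<lambda>(j, t). \<psi> j a t)"
    "\<And>a i j s t. i < n \<Longrightarrow> j < n \<Longrightarrow> s \<in> X i a \<Longrightarrow> t \<in> X j a \<Longrightarrow> ip (fibre S a) (\<psi> i a s) (\<psi> j a t) =
       (if i = j then ip (fibre (N j) a) (\<phi> j a s) (\<phi> j a t) else 0)"
    "\<And>a b j t. j < n \<Longrightarrow> t \<in> X j a \<Longrightarrow> a \<le> b \<Longrightarrow> transport S b a (\<psi> j a t) = \<psi> j b (\<tau> j b a t)"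
    by metis
  let ?T = "net_sum S (N n)"
  note T = net_sum_bundle[OF S(1) N[of n]]
  obtain M :: "('k, complex vec) net" where M: "net_bundle M" "net_iso M ?T" using std_net_exists[OF T] by blast
  obtain U where U: "\<And>a. unitary (fibre ?T a) (fibre M a) (U a)"
    "\<And>a b x. a \<le> b \<Longrightarrow> x \<in> carrier (fibre ?T a) \<Longrightarrow> U b (transport ?T b a x) = transport M b a (U a x)"
    using net_iso_sym[OF M(1) T M(2)] unfolding net_iso_def by blast
  note UD = unitaryD[OF U(1)] and SD = net_bundleD[OF S(1)] and ND = net_bundleD[OF N] and MD = net_bundleD[OF M(1)]
  have \<psi>c: "\<psi> j a t \<in> carrier (fibre S a)" if "j < n" "t \<in> X j a" for j a t
    using S(3)[of a] that by (auto simp: is_total_def)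
  have \<phi>c: "\<phi> j a t \<in> carrier (fibre (N j) a)" if "t \<in> X j a" for j a t
    using tot[of j a] that by (auto simp: is_total_def)
  have zc: "\<zero>\<^bsub>fibre S a\<^esub> \<in> carrier (fibre S a)" "\<zero>\<^bsub>fibre (N j) a\<^esub> \<in> carrier (fibre (N j) a)" for j a
    by (rule fd_hilbert_zero_closed[OF SD(1)], rule fd_hilbert_zero_closed[OF ND(1)])
  \<comment> \<open>The old family and the one of the new summand, each padded by zero;
    \<open>U\<close> then carries both back to fibres in \<open>complex vec\<close>, so that the
    induction can continue.\<close>
  define \<chi> where "\<chi> j a t = (if j < n then (\<psi> j a t, \<zero>\<^bsub>fibre (N n) a\<^esub>) else (\<zero>\<^bsub>fibre S a\<^esub>, \<phi> j a t))" for j a t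
  have \<chi>c: "\<chi> j a t \<in> carrier (fibre ?T a)" if "j < Suc n" "t \<in> X j a" for j a t
    using that \<psi>c \<phi>c zc by (auto simp: \<chi>_def less_Suc_eq)
  show ?case
  proof (intro exI[of _ M] exI[of _ "\<lambda>j a t. U a (\<chi> j a t)"] conjI allI impI ballI)
    show "net_bundle M" by (rule M(1))
    show "iso_class M = (\<Sum>j<Suc n. iso_class (N j))"
      using M(2) iso_class_eq_iff[OF M(1) T] iso_class_sum[OF S(1) N[of n]] S(2) by simp
    show "is_total (fibre M a) (SIGMA j:{..<Suc n}. X j a) (\<lambda>(j, t). U a (\<chi> j a t))" for a
      unfolding is_total_def
    proof (intro conjI ballI impI)
      fix p assume "p \<in> (SIGMA j:{..<Suc n}. X j a)"
      thus "(case p of (j, t) \<Rightarrow> U a (\<chi> j a t)) \<in> carrier (fibre M a)" using UD(1)[OF \<chi>c] by auto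
    next
      fix y assume y: "y \<in> carrier (fibre M a)"
        "\<forall>t\<in>SIGMA j:{..<Suc n}. X j a. ip (fibre M a) (case t of (j, t) \<Rightarrow> U a (\<chi> j a t)) y = 0"
      have "y \<in> U a ` carrier (fibre ?T a)" using UD(5)[of a] y(1) unfolding bij_betw_def by blast
      then obtain x where x: "x \<in> carrier (fibre ?T a)" "y = U a x" by blast
      have z: "ip (fibre ?T a) (\<chi> j a t) x = 0" if "j < Suc n" "t \<in> X j a" for j t
        using bspec[OF y(2), of "(j, t)"] that UD(4)[OF \<chi>c[OF that] x(1)] x(2) by auto
      have x': "fst x \<in> carrier (fibre S a)" "snd x \<in> carrier (fibre (N n) a)" using x(1) by auto
      have "ip (fibre S a) (\<psi> j a t) (fst x) = 0" if "j < n" "t \<in> X j a" for j t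
        using z[of j t] that x' fd_hilbert.ip_zero_left[OF ND(1)] by (simp add: \<chi>_def)
      hence "fst x = \<zero>\<^bsub>fibre S a\<^esub>" using S(3)[of a] x' unfolding is_total_def by auto
      moreover have "ip (fibre (N n) a) (\<phi> n a t) (snd x) = 0" if "t \<in> X n a" for t
        using z[of n t] that x' fd_hilbert.ip_zero_left[OF SD(1)] by (simp add: \<chi>_def)
      hence "snd x = \<zero>\<^bsub>fibre (N n) a\<^esub>" using tot[of n a] x' unfolding is_total_def by auto
      ultimately have "x = (0 :: complex) \<odot>\<^bsub>fibre ?T a\<^esub> x"
        using x' fd_hilbert.zero_smult[OF SD(1)] fd_hilbert.zero_smult[OF ND(1)] by (simp add: prod_eq_iff)
      hence "y = (0 :: complex) \<odot>\<^bsub>fibre M a\<^esub> y" using UD(3)[OF x(1), of 0] x(2) by simp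
      thus "y = \<zero>\<^bsub>fibre M a\<^esub>" using fd_hilbert.zero_smult[OF MD(1) y(1)] by simp
    qed
    show "ip (fibre M a) (U a (\<chi> i a s)) (U a (\<chi> j a t)) = (if i = j then ip (fibre (N j) a) (\<phi> j a s) (\<phi> j a t) else 0)"
      if "i < Suc n" "j < Suc n" "s \<in> X i a" "t \<in> X j a" for a i j s t
      using UD(4)[OF \<chi>c[OF that(1,3)] \<chi>c[OF that(2,4)]] that S(4)[of i j s a t] \<psi>c[of i s a] \<psi>c[of j t a]
        \<phi>c[of s i a] \<phi>c[of t j a] zc fd_hilbert.ip_zero_left[OF SD(1)] fd_hilbert.ip_zero[OF SD(1)]
        fd_hilbert.ip_zero_left[OF ND(1)] fd_hilbert.ip_zero[OF ND(1)]
      by (auto simp: \<chi>_def less_Suc_eq)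
    show "transport M b a (U a (\<chi> j a t)) = U b (\<chi> j b (\<tau> j b a t))" if "j < Suc n" "t \<in> X j a" "a \<le> b" for a b j t
    proof -
      have z: "transport S b a \<zero>\<^bsub>fibre S a\<^esub> = \<zero>\<^bsub>fibre S b\<^esub>"
        "transport (N n) b a \<zero>\<^bsub>fibre (N n) a\<^esub> = \<zero>\<^bsub>fibre (N n) b\<^esub>"
        by (rule unitary_zero[OF SD(1) SD(1) SD(2)[OF that(3)]], rule unitary_zero[OF ND(1) ND(1) ND(2)[OF that(3)]])
      have "transport ?T b a (\<chi> j a t) = \<chi> j b (\<tau> j b a t)"
        using that S(5) tau(2) z by (auto simp: \<chi>_def less_Suc_eq)
      thus ?thesis using U(2)[OF that(3) \<chi>c[OF that(1,2)]] by simp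
    qed
  qed
qed

lemma iso_class_ext_sum:
  assumes EF: "net_bundle E" "net_bundle F"
  shows "iso_class (net_ext k (net_sum E F)) = (\<Sum>j<Suc k. iso_class (net_ext j E) * iso_class (net_ext (k - j) F))"
proof -
  note E = net_bundleD[OF EF(1)] and F = net_bundleD[OF EF(2)]
  note S = net_sum_bundle[OF EF] note SD = net_bundleD[OF S]
  note Ej = net_ext_bundle[OF EF(1)] and Fj = net_ext_bundle[OF EF(2)]
  note ED = net_bundleD[OF Ej, unfolded net_ext_simps] and FD = net_bundleD[OF Fj, unfolded net_ext_simps]
  \<comment> \<open>\<open>direct_sum_exists\<close> asks for a bundle at every index. For
    \<open>j > k\<close> the truncated difference is 0, and these indices do not enter the
    sum.\<close>
  define N where "N j = net_tensor (net_ext j E) (net_ext (k - j) F)" for j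
  define X where "X j a = tuples j (carrier (fibre E a)) \<times> tuples (k - j) (carrier (fibre F a))" for j a
  define \<phi> where "\<phi> j a = (\<lambda>(us, vs). elem_tensor (hext_power j (fibre E a)) (hext_power (k - j) (fibre F a))
    (wedge j (fibre E a) us) (wedge (k - j) (fibre F a) vs))" for j a
  define \<tau> where "\<tau> j b a = map_prod (map (transport E b a)) (map (transport F b a))" for j :: nat and b a
  define \<chi> where "\<chi> j a = (\<lambda>(us, vs). wedge k (fibre (net_sum E F) a) (join_tuples (fibre E a) (fibre F a) us vs))" for j :: nat and a
  have N: "net_bundle (N j)" for j unfolding N_def by (rule net_tensor_bundle[OF Ej Fj])
  have tot: "is_total (fibre (N j) a) (X j a) (\<phi> j a)" for j a
    unfolding N_def X_def \<phi>_def net_simps net_ext_simps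
    by (rule elem_total[OF ED(1) FD(1) wedge_total_id[OF E(1)] wedge_total_id[OF F(1)]])
  have tup: "map (transport E b a) us \<in> tuples j (carrier (fibre E b))" "map (transport F b a) vs \<in> tuples l (carrier (fibre F b))"
    if "a \<le> b" "us \<in> tuples j (carrier (fibre E a))" "vs \<in> tuples l (carrier (fibre F a))" for a b us vs j l
    by (rule map_in_tuples[OF that(2)], erule E(5)[OF that(1)]) (rule map_in_tuples[OF that(3)], erule F(5)[OF that(1)])
  have \<tau>: "\<tau> j b a t \<in> X j b" if "a \<le> b" "t \<in> X j a" for j a b t
    using that tup[OF that(1)] by (auto simp: \<tau>_def X_def)
  have \<tau>\<phi>: "transport (N j) b a (\<phi> j a t) = \<phi> j b (\<tau> j b a t)" if ab: "a \<le> b" and t: "t \<in> X j a" for j a b t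
  proof -
    obtain us vs where t': "t = (us, vs)" "us \<in> tuples j (carrier (fibre E a))" "vs \<in> tuples (k - j) (carrier (fibre F a))"
      using t by (auto simp: X_def)
    show ?thesis
      using tensor_map(2)[OF ED(1) FD(1) ED(1) FD(1) ED(2)[OF ab] FD(2)[OF ab]
          wedge_carrier[OF E(1) t'(2)] wedge_carrier[OF F(1) t'(3)]]
        tensor_power_map(2)[OF E(1) E(1) E(2)[OF ab] t'(2)] tensor_power_map(2)[OF F(1) F(1) F(2)[OF ab] t'(3)]
      by (simp add: N_def \<phi>_def \<tau>_def t'(1))
  qed
  obtain M :: "('a, complex vec) net" and \<psi> where M: "net_bundle M" "iso_class M = (\<Sum>j<Suc k. iso_class (N j))"
    "\<forall>a. is_total (fibre M a) (SIGMA j:{..<Suc k}. X j a) (\<lambda>(j, t). \<psi> j a t)"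
    "\<forall>a. \<forall>i<Suc k. \<forall>j<Suc k. \<forall>s\<in>X i a. \<forall>t\<in>X j a. ip (fibre M a) (\<psi> i a s) (\<psi> j a t) =
       (if i = j then ip (fibre (N j) a) (\<phi> j a s) (\<phi> j a t) else 0)"
    "\<forall>a b. \<forall>j<Suc k. \<forall>t\<in>X j a. a \<le> b \<longrightarrow> transport M b a (\<psi> j a t) = \<psi> j b (\<tau> j b a t)"
    by (rule exE[OF direct_sum_exists[of N X \<phi> \<tau> "Suc k", OF N tot]],
        erule \<tau>, assumption, erule \<tau>\<phi>, assumption) (elim exE conjE, rule that)
  have "net_iso (net_ext k (net_sum E F)) M"
  proof (rule net_iso_gram[OF net_ext_bundle[OF S] M(1), where X = "\<lambda>a. SIGMA j:{..<Suc k}. X j a"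
        and \<phi> = "\<lambda>a (j, t). \<chi> j a t" and \<psi> = "\<lambda>a (j, t). \<psi> j a t" and \<tau> = "\<lambda>b a (j, t). (j, \<tau> j b a t)"])
    show "is_total (fibre (net_ext k (net_sum E F)) a) (SIGMA j:{..<Suc k}. X j a) (\<lambda>(j, t). \<chi> j a t)" for a
      using join_tuples_total[OF E(1) F(1), of k a a] unfolding \<chi>_def X_def net_simps net_ext_simps .
    show "is_total (fibre M a) (SIGMA j:{..<Suc k}. X j a) (\<lambda>(j, t). \<psi> j a t)" for a by (rule M(3)[rule_format])
  next
    fix a s t assume st: "s \<in> (SIGMA j:{..<Suc k}. X j a)" "t \<in> (SIGMA j:{..<Suc k}. X j a)"
    obtain i us vs where s: "s = (i, us, vs)" "i \<le> k" "us \<in> tuples i (carrier (fibre E a))" "vs \<in> tuples (k - i) (carrier (fibre F a))"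
      using st(1) by (auto simp: X_def less_Suc_eq_le)
    obtain j us' vs' where t: "t = (j, us', vs')" "j \<le> k" "us' \<in> tuples j (carrier (fibre E a))" "vs' \<in> tuples (k - j) (carrier (fibre F a))"
      using st(2) by (auto simp: X_def less_Suc_eq_le)
    show "ip (fibre (net_ext k (net_sum E F)) a) (case s of (j, t) \<Rightarrow> \<chi> j a t) (case t of (j, t) \<Rightarrow> \<chi> j a t) =
        ip (fibre M a) (case s of (j, t) \<Rightarrow> \<psi> j a t) (case t of (j, t) \<Rightarrow> \<psi> j a t)"
      using join_tuples_gram[OF E(1) F(1) s(2-4) t(2-4)] M(4)[rule_format, of i j "(us, vs)" a "(us', vs')"] s t
      by (simp add: \<chi>_def \<phi>_def N_def X_def)
  next
    fix a b t assume ab: "a \<le> b" and "t \<in> (SIGMA j:{..<Suc k}. X j a)"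
    then obtain j us vs where t: "t = (j, us, vs)" "j \<le> k" "us \<in> tuples j (carrier (fibre E a))" "vs \<in> tuples (k - j) (carrier (fibre F a))"
      by (auto simp: X_def less_Suc_eq_le)
    show "(case t of (j, t) \<Rightarrow> (j, \<tau> j b a t)) \<in> (SIGMA j:{..<Suc k}. X j b)"
      using t tup[OF ab t(3,4)] by (simp add: \<tau>_def X_def)
    show "transport M b a (case t of (j, t) \<Rightarrow> \<psi> j a t) = (case case t of (j, t) \<Rightarrow> (j, \<tau> j b a t) of (j, t) \<Rightarrow> \<psi> j b t)"
      using M(5)[rule_format, of j "(us, vs)" a b] t ab by (simp add: X_def)
    \<comment> \<open>Transports preserve the zeros that pad a joined list, so they act separately
      on its two parts.\<close>
    have z: "transport E b a \<zero>\<^bsub>fibre E a\<^esub> = \<zero>\<^bsub>fibre E b\<^esub>" "transport F b a \<zero>\<^bsub>fibre F a\<^esub> = \<zero>\<^bsub>fibre F b\<^esub>"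
      by (rule unitary_zero[OF E(1) E(1) E(2)[OF ab]], rule unitary_zero[OF F(1) F(1) F(2)[OF ab]])
    have "map (transport (net_sum E F) b a) (join_tuples (fibre E a) (fibre F a) us vs) =
        join_tuples (fibre E b) (fibre F b) (map (transport E b a) us) (map (transport F b a) vs)"
      by (simp add: join_tuples_def z)
    thus "transport (net_ext k (net_sum E F)) b a (case t of (j, t) \<Rightarrow> \<chi> j a t) =
        (case case t of (j, t) \<Rightarrow> (j, \<tau> j b a t) of (j, t) \<Rightarrow> \<chi> j b t)"
      using tensor_power_map(2)[OF SD(1) SD(1) SD(2)[OF ab], of "join_tuples (fibre E a) (fibre F a) us vs" k]
        join_tuples_carrier[OF E(1) F(1) t(2-4)] t(1) by (simp add: \<chi>_def \<tau>_def)
  qed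
  hence "iso_class (net_ext k (net_sum E F)) = (\<Sum>j<Suc k. iso_class (N j))"
    using iso_class_eq_iff[OF net_ext_bundle[OF S] M(1)] M(2) by simp
  thus ?thesis by (simp add: N_def iso_class_tensor[OF Ej Fj])
qed


section \<open>The Grothendieck ring\<close>

text \<open>The canonical semiring homomorphism into the Grothendieck ring, through which
  \<open>K0_class\<close> factors; it carries identities of isomorphism classes over to the
  ring.\<close>

definition of_vclass :: "'k::order vclass \<Rightarrow> 'k K0" where
  "of_vclass x = abs_K0 (x, 0)"

lemma K0_class_of_vclass: "K0_class E = of_vclass (iso_class E)"
  by (simp add: K0_class_def of_vclass_def)

lemma of_vclass_0 [simp]: "of_vclass 0 = 0"
  by (simp add: of_vclass_def zero_K0_def)

lemma of_vclass_1 [simp]: "of_vclass 1 = 1"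
  by (simp add: of_vclass_def one_K0_def)

lemma of_vclass_add: "of_vclass (x + y) = of_vclass x + of_vclass y"
  by (simp add: of_vclass_def plus_K0.abs_eq)

lemma of_vclass_mult: "of_vclass (x * y) = of_vclass x * of_vclass y"
  by (simp add: of_vclass_def times_K0.abs_eq)

lemma of_vclass_sum: "of_vclass (sum f A) = (\<Sum>a\<in>A. of_vclass (f a))"
  by (induction A rule: infinite_finite_induct) (simp_all add: of_vclass_add)

lemma K0_class_sum:
  assumes "net_bundle E" "net_bundle F"
  shows "K0_class (net_sum E F) = K0_class E + K0_class F"
  by (simp add: K0_class_of_vclass iso_class_sum[OF assms] of_vclass_add)

lemma K0_class_trivial_0: "K0_class (trivial_net 0 :: ('k::order, complex vec) net) = 0"
  by (simp add: K0_class_of_vclass flip: zero_vclass_def)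

lemma K0_class_trivial_1: "K0_class (trivial_net 1 :: ('k::order, complex vec) net) = 1"
  unfolding K0_class_of_vclass one_vclass_def[symmetric] by (rule of_vclass_1)

text \<open>\<open>K0_rank\<close> and \<open>K0_pullback\<close> are specified on differences of
  classes only, so statements about arbitrary elements start from such a presentation.\<close>

lemma K0_cases:
  obtains E F :: "('k::order, complex vec) net"
  where "net_bundle E" "net_bundle F" "x = K0_class E - K0_class F"
proof -
  obtain a b where x: "x = abs_K0 (a, b)"
    using Quotient3_abs_rep[OF Quotient3_K0, of x] by (metis surj_pair)
  obtain E :: "('k, complex vec) net" where E: "net_bundle E" "a = iso_class E" by (rule iso_class_cases)
  obtain F :: "('k, complex vec) net" where F: "net_bundle F" "b = iso_class F" by (rule iso_class_cases)
  show ?thesis using that[OF E(1) F(1)] by (simp add: K0_class_diff x E(2) F(2))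
qed

section \<open>Pullback on the Grothendieck ring\<close>

lemma K0_pullback_class:
  assumes "mono \<eta>" "net_bundle E"
  shows "K0_pullback \<eta> (K0_class E) = K0_class (net_pullback \<eta> E)"
proof -
  have "net_pullback \<eta> (trivial_net 0) = trivial_net 0" by (simp add: net_pullback_def trivial_net_def)
  thus ?thesis
    using K0_pullback_diff[OF assms trivial_net_bundle[of 0]] by (simp add: K0_class_trivial_0)
qed

lemma K0_pullback_0: "mono \<eta> \<Longrightarrow> K0_pullback \<eta> 0 = 0"
  using K0_pullback_diff[OF _ trivial_net_bundle[of 0] trivial_net_bundle[of 0], of \<eta>] by simp

lemma K0_pullback_1:
  assumes "mono \<eta>"
  shows "K0_pullback \<eta> 1 = 1"
proof -
  have "net_pullback \<eta> (trivial_net 1) = trivial_net 1" by (simp add: net_pullback_def trivial_net_def)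
  thus ?thesis using K0_pullback_class[OF assms trivial_net_bundle[of 1]] by (simp only: K0_class_trivial_1)
qed

lemma K0_pullback_add:
  fixes \<eta> :: "'k2::order \<Rightarrow> 'k::order"
  assumes \<eta>: "mono \<eta>"
  shows "K0_pullback \<eta> (x + y) = K0_pullback \<eta> x + K0_pullback \<eta> y"
proof -
  obtain E F :: "('k, complex vec) net" where x: "net_bundle E" "net_bundle F" "x = K0_class E - K0_class F"
    by (rule K0_cases)
  obtain G H :: "('k, complex vec) net" where y: "net_bundle G" "net_bundle H" "y = K0_class G - K0_class H"
    by (rule K0_cases)
  have "x + y = K0_class (net_sum E G) - K0_class (net_sum F H)"
    using x y by (simp add: K0_class_sum)
  hence "K0_pullback \<eta> (x + y) = K0_class (net_pullback \<eta> (net_sum E G)) - K0_class (net_pullback \<eta> (net_sum F H))"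
    by (simp only: K0_pullback_diff[OF \<eta> net_sum_bundle[OF x(1) y(1)] net_sum_bundle[OF x(2) y(2)]])
  also have "\<dots> = K0_pullback \<eta> x + K0_pullback \<eta> y"
    unfolding x(3) y(3) K0_pullback_diff[OF \<eta> x(1,2)] K0_pullback_diff[OF \<eta> y(1,2)]
    using x y by (simp add: net_pullback_sum K0_class_sum net_pullback_bundle[OF _ \<eta>])
  finally show ?thesis .
qed

lemma K0_pullback_uminus: "mono \<eta> \<Longrightarrow> K0_pullback \<eta> (- x) = - K0_pullback \<eta> x"
  using K0_pullback_add[of \<eta> x "- x"] by (simp add: K0_pullback_0 eq_neg_iff_add_eq_0 add.commute)

lemma K0_pullback_sum:
  assumes "mono \<eta>"
  shows "K0_pullback \<eta> (sum f A) = (\<Sum>a\<in>A. K0_pullback \<eta> (f a))"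
  by (induction A rule: infinite_finite_induct) (simp_all add: K0_pullback_add[OF assms] K0_pullback_0[OF assms])

text \<open>Together with the next lemma this lets pullback pass through the binomial coefficients
  and signs of a Chern class, an integer combination of bundle classes.\<close>

lemma K0_pullback_of_nat_mult: "mono \<eta> \<Longrightarrow> K0_pullback \<eta> (of_nat n * x) = of_nat n * K0_pullback \<eta> x"
  by (induction n) (simp_all add: K0_pullback_add K0_pullback_0 distrib_right)

lemma K0_pullback_sign_mult: "mono \<eta> \<Longrightarrow> K0_pullback \<eta> ((- 1) ^ n * x) = (- 1) ^ n * K0_pullback \<eta> x"
  by (induction n) (simp_all add: K0_pullback_uminus)

section \<open>Chern classes\<close>

text \<open>\<open>[:1, 1:]\<close> is 1 + h; the induction step is Pascal's rule.\<close>

lemma coeff_linear_one_power: "Polynomial.coeff ([:1, 1:] ^ n :: 'r::comm_ring_1 poly) i = of_nat (n choose i)"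
proof (induction n arbitrary: i)
  case 0
  show ?case by (cases i) auto
next
  case (Suc n)
  show ?case by (cases i) (simp_all add: Suc.IH)
qed

lemma coeff_total_chern_K: "Polynomial.coeff (total_chern_K E) i = chern_K E i"
proof -
  have "Polynomial.coeff (total_chern_K E) i =
      (if i = 0 then 1 else 0) + (\<Sum>j=1..rank E. if j = i then chern_K E j else 0)"
    by (simp add: total_chern_K_def coeff_sum)
  also have "\<dots> = chern_K E i" by (auto simp: chern_K_def)
  finally show ?thesis .
qed

lemma K0_class_ext_eq_0:
  fixes E :: "('k::order, 'v) net"
  assumes "pathwise_connected TYPE('k)" "net_bundle E" "rank E < k"
  shows "K0_class (net_ext k E) = 0"
  using iso_class_ext_eq_0[OF assms(2), of k] rank_eq[OF assms(1,2)] assms(3) by (simp add: K0_class_of_vclass)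

text \<open>The polynomial below is \<open>\<Sum>k (-h)\<^sup>k (1 + h)\<^bsup>d - k\<^esup> [\<lambda>\<^sup>k E]\<close>, that is \<open>(1 + h)\<^sup>d\<close> times the generating
  function of the exterior powers evaluated at \<open>- h / (1 + h)\<close>.\<close>

lemma total_chern_K_alt:
  assumes "net_bundle E"
  shows "total_chern_K E =
    (\<Sum>k\<le>rank E. Polynomial.monom ((- 1) ^ k * K0_class (net_ext k E)) k * [:1, 1:] ^ (rank E - k))"
proof (rule poly_eqI)
  fix i
  let ?d = "rank E" and ?t = "\<lambda>k. (- 1) ^ k * of_nat ((rank E - k) choose (i - k)) * K0_class (net_ext k E)"
  have "Polynomial.coeff (\<Sum>k\<le>?d. Polynomial.monom ((- 1) ^ k * K0_class (net_ext k E)) k * [:1, 1:] ^ (?d - k)) i =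
      (\<Sum>k\<le>?d. if k \<le> i then ?t k else 0)"
    by (auto simp: coeff_sum coeff_monom_mult coeff_linear_one_power intro!: sum.cong)
  also have "\<dots> = (\<Sum>k\<in>{..?d} \<inter> {..i}. ?t k)" 
    using sum.inter_restrict[of "{..?d}" ?t "{..i}"] by (simp only: finite_atMost atMost_iff)
  also have "\<dots> = chern_K E i"
  proof (cases "i = 0")
    case True
    hence "{..?d} \<inter> {..i} = {0}" by auto
    \<comment> \<open>Only \<open>k = 0\<close> remains, and the class of the zeroth exterior power
      is the 1 prescribed for the class of index 0.\<close>
    thus ?thesis using True by (simp add: chern_K_def K0_class_of_vclass iso_class_ext_0[OF assms])
  next
    case False
    show ?thesis
    proof (cases "i \<le> ?d")
      case True
      hence "{..?d} \<inter> {..i} = {0..i}" by auto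
      thus ?thesis using True False by (simp add: chern_K_def)
    next
      case False
      \<comment> \<open>Here \<open>i > ?d\<close>, so \<open>i - k\<close> exceeds
        \<open>?d - k\<close> and each binomial coefficient is 0.\<close>
      have "(\<Sum>k\<in>{..?d} \<inter> {..i}. ?t k) = 0"
        using False by (intro sum.neutral) (auto simp: binomial_eq_0)
      thus ?thesis using False by (simp add: chern_K_def)
    qed
  qed
  finally show "Polynomial.coeff (total_chern_K E) i =
      Polynomial.coeff (\<Sum>k\<le>?d. Polynomial.monom ((- 1) ^ k * K0_class (net_ext k E)) k * [:1, 1:] ^ (?d - k)) i"
    by (simp add: coeff_total_chern_K)
qed

section \<open>Multiplicativity and stable invariance of the total class\<close>

lemma rank_net_sum:
  fixes E :: "('k::order, 'v) net" and F :: "('k, 'w) net"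
  assumes "pathwise_connected TYPE('k)" "net_bundle E" "net_bundle F"
  shows "rank (net_sum E F) = rank E + rank F"
  using rank_eq[OF assms(1) net_sum_bundle[OF assms(2,3)], of undefined] rank_eq[OF assms(1,2), of undefined]
    rank_eq[OF assms(1,3), of undefined] hsum_dim[OF net_bundleD(1)[OF assms(2)] net_bundleD(1)[OF assms(3)]]
  by simp

lemma total_chern_K_sum:
  fixes E :: "('k::order, 'v) net" and F :: "('k, 'w) net"
  assumes conn: "pathwise_connected TYPE('k)" and EF: "net_bundle E" "net_bundle F"
  shows "total_chern_K (net_sum E F) = total_chern_K E * total_chern_K F"
proof -
  define P where "P = ([:1, 1:] :: 'k K0 poly)"
  define d where "d = rank E"
  define d' where "d' = rank F"
  define a where "a k = (- 1) ^ k * K0_class (net_ext k E)" for k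
  define b where "b k = (- 1) ^ k * K0_class (net_ext k F)" for k
  have a0: "a k = 0" if "d < k" for k
    using K0_class_ext_eq_0[OF conn EF(1)] that by (simp add: a_def d_def)
  have b0: "b k = 0" if "d' < k" for k
    using K0_class_ext_eq_0[OF conn EF(2)] that by (simp add: b_def d'_def)
  define g where "g i j = Polynomial.monom (a i * b j) (i + j) * P ^ (d + d' - (i + j))" for i j
  have c: "(- 1) ^ k * K0_class (net_ext k (net_sum E F)) = (\<Sum>i\<le>k. a i * b (k - i))" for k
  proof -
    have "K0_class (net_ext k (net_sum E F)) = (\<Sum>i\<le>k. K0_class (net_ext i E) * K0_class (net_ext (k - i) F))"
      by (simp only: K0_class_of_vclass iso_class_ext_sum[OF EF] of_vclass_sum of_vclass_mult lessThan_Suc_atMost)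
    moreover have "a i * b (k - i) = (- 1) ^ k * (K0_class (net_ext i E) * K0_class (net_ext (k - i) F))" if "i \<le> k" for i
    proof -
      have "(- 1) ^ k = (- 1) ^ i * ((- 1) ^ (k - i) :: 'k K0)" using that by (simp flip: power_add)
      thus ?thesis by (simp add: a_def b_def mult_ac)
    qed
    ultimately show ?thesis by (simp add: sum_distrib_left)
  qed
  have "total_chern_K (net_sum E F) = (\<Sum>k\<le>d + d'. Polynomial.monom (\<Sum>i\<le>k. a i * b (k - i)) k * P ^ (d + d' - k))"
    unfolding total_chern_K_alt[OF net_sum_bundle[OF EF]] c rank_net_sum[OF conn EF] P_def d_def d'_def ..
  also have "\<dots> = (\<Sum>k\<le>d + d'. \<Sum>i\<le>k. g i (k - i))"
    by (intro sum.cong refl) (simp add: g_def monom_sum sum_distrib_right)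
  also have "\<dots> = (\<Sum>(i, j)\<in>{(i, j). i + j \<le> d + d'}. g i j)"
    by (rule sum.triangle_reindex_eq[symmetric])
  \<comment> \<open>The triangle contains the rectangle of the two ranks. Outside the rectangle one
    of the exterior powers exceeds the rank, so its class is 0.\<close>
  also have "\<dots> = (\<Sum>(i, j)\<in>{..d} \<times> {..d'}. g i j)"
  proof (rule sum.mono_neutral_right)
    show "finite {(i, j). i + j \<le> d + d'}"
      by (rule finite_subset[of _ "{..d + d'} \<times> {..d + d'}"]) auto
    have "g i j = 0" if "\<not> (i \<le> d \<and> j \<le> d')" for i j
      using that a0[of i] b0[of j] by (auto simp: g_def not_le)
    thus "\<forall>p\<in>{(i, j). i + j \<le> d + d'} - {..d} \<times> {..d'}. (case p of (i, j) \<Rightarrow> g i j) = 0"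
      by auto
  qed auto
  also have "\<dots> = (\<Sum>i\<le>d. \<Sum>j\<le>d'. g i j)" by (rule sum.cartesian_product[symmetric])
  also have "\<dots> = (\<Sum>i\<le>d. \<Sum>j\<le>d'. (Polynomial.monom (a i) i * P ^ (d - i)) * (Polynomial.monom (b j) j * P ^ (d' - j)))"
  proof (intro sum.cong refl)
    fix i j assume ij: "i \<in> {..d}" "j \<in> {..d'}"
    \<comment> \<open>Inside the rectangle no subtraction is truncated, so the exponents add
      up.\<close>
    hence "P ^ (d + d' - (i + j)) = P ^ (d - i) * P ^ (d' - j)" by (simp flip: power_add)
    thus "g i j = (Polynomial.monom (a i) i * P ^ (d - i)) * (Polynomial.monom (b j) j * P ^ (d' - j))"
      by (simp add: g_def mult_monom[symmetric] mult_ac)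
  qed
  also have "\<dots> = total_chern_K E * total_chern_K F"
    unfolding total_chern_K_alt[OF EF(1)] total_chern_K_alt[OF EF(2)] sum_product a_def b_def d_def d'_def P_def ..
  finally show ?thesis .
qed

lemma total_chern_K_iso:
  fixes E :: "('k::order, 'v) net" and F :: "('k, 'w) net"
  assumes conn: "pathwise_connected TYPE('k)" and EF: "net_bundle E" "net_bundle F" and iso: "net_iso E F"
  shows "total_chern_K E = total_chern_K F"
proof -
  have "rank E = rank F"
    using net_iso_dim[OF EF iso, of undefined] rank_eq[OF conn EF(1)] rank_eq[OF conn EF(2)] by simp
  moreover have "iso_class (net_ext k E) = iso_class (net_ext k F)" for k
    using iso_class_eq_iff[OF net_ext_bundle[OF EF(1)] net_ext_bundle[OF EF(2)]] net_ext_cong[OF EF iso] by blast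
  ultimately show ?thesis by (simp add: total_chern_K_def chern_K_def K0_class_of_vclass)
qed

lemma rank_trivial_net:
  assumes "pathwise_connected TYPE('k::order)"
  shows "rank (trivial_net n :: ('k, complex vec) net) = n"
  using rank_eq[OF assms trivial_net_bundle[of n], of undefined] by (simp add: Cspace_dim)

lemma total_chern_K_trivial:
  assumes conn: "pathwise_connected TYPE('k::order)"
  shows "total_chern_K (trivial_net n :: ('k, complex vec) net) = 1"
proof (induction n)
  case 0
  show ?case by (simp add: total_chern_K_def rank_trivial_net[OF conn])
next
  case (Suc n)
  let ?T = "\<lambda>n. trivial_net n :: ('k, complex vec) net"
  note b = trivial_net_bundle[where ?'a = 'k]
  have "iso_class (net_ext 0 (?T 1)) = 1" "iso_class (net_ext 1 (?T 1)) = 1"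
    using iso_class_ext_0[OF b] iso_class_ext_1[OF b] by (auto simp: one_vclass_def)
  \<comment> \<open>In rank one the first class is the class of the zeroth minus that of the first
    exterior power, here 1 - 1.\<close>
  hence "chern_K (?T 1) 1 = 0"
    by (simp add: chern_K_def rank_trivial_net[OF conn] K0_class_of_vclass)
  hence 1: "total_chern_K (?T 1) = 1"
    by (simp add: total_chern_K_def rank_trivial_net[OF conn])
  have "iso_class (?T (Suc n)) = iso_class (net_sum (?T 1) (?T n))"
    by (simp add: iso_class_sum[OF b b] iso_class_trivial)
  hence "net_iso (?T (Suc n)) (net_sum (?T 1) (?T n))"
    using iso_class_eq_iff[OF b net_sum_bundle[OF b b]] by blast
  thus ?case
    using total_chern_K_iso[OF conn b net_sum_bundle[OF b b]] total_chern_K_sum[OF conn b b, of 1 n] 1 Suc.IH by simp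
qed

lemma total_chern_K_stable:
  fixes E :: "('k::order, 'v) net" and F :: "('k, 'w) net"
  assumes conn: "pathwise_connected TYPE('k)" and EF: "net_bundle E" "net_bundle F"
    and "stable_class E = stable_class F"
  shows "total_chern_K E = total_chern_K F"
proof -
  note b = trivial_net_bundle[where ?'a = 'k]
  obtain j k where "net_iso (net_sum E (trivial_net j)) (net_sum F (trivial_net k))"
    using assms(4) stable_class_eq_iff[OF EF] by blast
  from total_chern_K_iso[OF conn net_sum_bundle[OF EF(1) b] net_sum_bundle[OF EF(2) b] this]
  show ?thesis by (simp add: total_chern_K_sum[OF conn _ b] EF total_chern_K_trivial[OF conn])
qed

section \<open>Naturality, and vanishing rank of the Chern classes\<close>

lemma rank_net_pullback:
  fixes E :: "('k::order, 'v) net" and \<eta> :: "'k2::order \<Rightarrow> 'k"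
  assumes "pathwise_connected TYPE('k)" "pathwise_connected TYPE('k2)" "mono \<eta>" "net_bundle E"
  shows "rank (net_pullback \<eta> E) = rank E"
  using rank_eq[OF assms(2) net_pullback_bundle[OF assms(4,3)], of undefined] rank_eq[OF assms(1,4), of "\<eta> undefined"]
  by (simp add: net_pullback_def)

lemma K0_pullback_chern_K:
  fixes E :: "('k::order, 'v) net" and \<eta> :: "'k2::order \<Rightarrow> 'k"
  assumes "pathwise_connected TYPE('k)" "pathwise_connected TYPE('k2)" and \<eta>: "mono \<eta>" and E: "net_bundle E"
  shows "K0_pullback \<eta> (chern_K E i) = chern_K (net_pullback \<eta> E) i"
proof -
  have "K0_pullback \<eta> (K0_class (net_ext k E)) = K0_class (net_ext k (net_pullback \<eta> E))" for k
    using K0_pullback_class[OF \<eta> net_ext_bundle[OF E]] by (simp add: net_pullback_ext)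
  thus ?thesis
    by (simp add: chern_K_def rank_net_pullback[OF assms] K0_pullback_sum[OF \<eta>] K0_pullback_of_nat_mult[OF \<eta>]
      K0_pullback_sign_mult[OF \<eta>] K0_pullback_0[OF \<eta>] K0_pullback_1[OF \<eta>] mult.assoc)
qed

lemma K0_rank_pullback:
  fixes \<eta> :: "'k2::order \<Rightarrow> 'k::order"
  assumes "pathwise_connected TYPE('k)" "pathwise_connected TYPE('k2)" and \<eta>: "mono \<eta>"
  shows "K0_rank (K0_pullback \<eta> x) = K0_rank x"
proof -
  obtain E F :: "('k, complex vec) net" where x: "net_bundle E" "net_bundle F" "x = K0_class E - K0_class F"
    by (rule K0_cases)
  thus ?thesis
    by (simp add: K0_pullback_diff[OF \<eta>] K0_rank_diff[OF assms(1)] K0_rank_diff[OF assms(2)]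
      net_pullback_bundle[OF _ \<eta>] rank_net_pullback[OF assms])
qed

text \<open>Ranks do not change under pullback along a constant map, and such a pullback is trivial.\<close>

lemma chern_K_reduced:
  fixes E :: "('k::order, 'v) net"
  assumes conn: "pathwise_connected TYPE('k)" and E: "net_bundle E" and i: "i > 0"
  shows "chern_K E i \<in> reduced_K0"
proof -
  \<comment> \<open>\<open>undefined\<close> serves as an arbitrary base point of the poset.\<close>
  define \<eta> :: "'k \<Rightarrow> 'k" where "\<eta> = (\<lambda>_. undefined)"
  have \<eta>: "mono \<eta>" by (simp add: \<eta>_def mono_def)
  obtain n U where U: "unitary (fibre E undefined) (Cspace n) U"
    using coordinates[OF net_bundleD(1)[OF E]] by blast
  \<comment> \<open>Every transport of the pulled back bundle is the transport from the base point
    to itself, the identity on the fibre; hence the same coordinate map \<open>U\<close> works at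
    every point.\<close>
  have "net_iso (net_pullback \<eta> E) (trivial_net n)"
    unfolding net_iso_def using U net_bundleD(3)[OF E]
    by (intro exI[of _ "\<lambda>a. U"]) (simp add: net_pullback_def \<eta>_def)
  from total_chern_K_iso[OF conn net_pullback_bundle[OF E \<eta>] trivial_net_bundle this]
  have "total_chern_K (net_pullback \<eta> E) = 1" by (simp add: total_chern_K_trivial[OF conn])
  hence "chern_K (net_pullback \<eta> E) i = 0"
    using i by (simp flip: coeff_total_chern_K)
  hence "K0_rank (chern_K E i) = K0_rank (0 :: 'k K0)"
    using K0_rank_pullback[OF conn conn \<eta>, of "chern_K E i"] K0_pullback_chern_K[OF conn conn \<eta> E] by simp
  also have "\<dots> = 0"
    using K0_rank_diff[OF conn trivial_net_bundle[of 0] trivial_net_bundle[of 0]] by simp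
  finally show ?thesis by (simp add: reduced_K0_def)
qed

lemma chern_K_sum:
  fixes E :: "('k::order, 'v) net" and F :: "('k, 'w) net"
  assumes conn: "pathwise_connected TYPE('k)" and EF: "net_bundle E" "net_bundle F"
  shows "chern_K (net_sum E F) i = (\<Sum>(l, m) | l + m = i. chern_K E l * chern_K F m)"
proof -
  have "chern_K (net_sum E F) i = (\<Sum>l\<le>i. chern_K E l * chern_K F (i - l))"
    using arg_cong[OF total_chern_K_sum[OF assms], of "\<lambda>p. Polynomial.coeff p i"]
    by (simp add: coeff_mult coeff_total_chern_K)
  also have "\<dots> = (\<Sum>(l, m) | l + m = i. chern_K E l * chern_K F m)"
    by (rule sum.reindex_bij_witness[of _ fst "\<lambda>l. (l, i - l)"]) auto
  finally show ?thesis .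
qed

lemma total_chern_K_in_one_plus_h:
  fixes E :: "('k::order, 'v) net"
  assumes "pathwise_connected TYPE('k)" "net_bundle E"
  shows "total_chern_K E \<in> one_plus_h reduced_K0"
  using chern_K_reduced[OF assms] by (simp add: one_plus_h_def coeff_total_chern_K chern_K_def[of E 0])

section \<open>The morphism on stable equivalence classes\<close>

lemma stable_class_sum:
  assumes "net_bundle E" "net_bundle F"
  shows "stable_class (net_sum E F) = stable_class E + stable_class F"
  by (simp add: stable_class_def iso_class_sum[OF assms] plus_stable.abs_eq)

lemma stable_class_rep: "stable_class (rep_vclass (rep_stable s)) = s"
  by (simp add: stable_class_def rep_vclass(2) Quotient3_abs_rep[OF Quotient3_stable])

text \<open>A chosen representative stands for the class; over a pathwise connected poset
  \<open>total_chern_K_stable\<close> makes the choice immaterial.\<close>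

definition stable_chern_K :: "'k::order stable \<Rightarrow> 'k K0 poly" where
  "stable_chern_K s = total_chern_K (rep_vclass (rep_stable s))"

text \<open>The representative has fibres in \<open>complex vec\<close> and \<open>E\<close> in an
  arbitrary type; \<open>total_chern_K_stable\<close> compares bundles with different fibre
  types.\<close>

lemma stable_chern_K_class:
  fixes E :: "('k::order, 'v) net"
  assumes "pathwise_connected TYPE('k)" "net_bundle E"
  shows "stable_chern_K (stable_class E) = total_chern_K E"
  unfolding stable_chern_K_def
  by (rule total_chern_K_stable[OF assms(1) rep_vclass(1) assms(2) stable_class_rep])

lemma stable_chern_K_add:
  assumes "pathwise_connected TYPE('k::order)"
  shows "stable_chern_K (s + t :: 'k stable) = stable_chern_K s * stable_chern_K t"
proof -
  let ?E = "rep_vclass (rep_stable s)" and ?F = "rep_vclass (rep_stable t)"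
  have "s + t = stable_class (net_sum ?E ?F)"
    by (simp add: stable_class_sum[OF rep_vclass(1) rep_vclass(1)] stable_class_rep)
  hence "stable_chern_K (s + t) = total_chern_K (net_sum ?E ?F)"
    using stable_chern_K_class[OF assms net_sum_bundle[OF rep_vclass(1) rep_vclass(1)]] by simp
  thus ?thesis using total_chern_K_sum[OF assms rep_vclass(1) rep_vclass(1)] by (simp add: stable_chern_K_def)
qed

theorem proposition5p17:
  assumes "pathwise_connected TYPE('k::order)"
  shows
    "(\<forall>(E :: ('k, 'v) net) (E' :: ('k, 'w) net). net_bundle E \<and> net_bundle E' \<longrightarrow>
        (\<forall>i\<in>{1..rank E + rank E'}.
           chern_K (net_sum E E') i = (\<Sum>(l, m) | l + m = i. chern_K E l * chern_K E' m)))
     \<and>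
     (\<exists>\<kappa> :: 'k stable \<Rightarrow> 'k K0 poly.
        range \<kappa> \<subseteq> one_plus_h reduced_K0 \<and>
        (\<forall>s t. \<kappa> (s + t) = \<kappa> s * \<kappa> t) \<and>
        (\<forall>E :: ('k, complex vec) net. net_bundle E \<longrightarrow> \<kappa> (stable_class E) = total_chern_K E) \<and>
        (\<forall>E :: ('k, 'v) net. net_bundle E \<longrightarrow> \<kappa> (stable_class E) = total_chern_K E))
     \<and>
     (\<forall>(E :: ('k, 'v) net) (E' :: ('k, 'w) net). net_bundle E \<and> net_bundle E' \<longrightarrow>
        total_chern_K (net_sum E E') = total_chern_K E * total_chern_K E')
     \<and>
     (\<forall>\<eta> :: 'k2::order \<Rightarrow> 'k. pathwise_connected TYPE('k2) \<and> mono \<eta> \<longrightarrow>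
        (\<forall>E :: ('k, 'v) net. net_bundle E \<longrightarrow>
           map_poly (K0_pullback \<eta>) (total_chern_K E) = total_chern_K (net_pullback \<eta> E)))"
proof (intro conjI exI[of _ stable_chern_K] allI impI ballI)
  note conn = assms
  show "range (stable_chern_K :: 'k stable \<Rightarrow> 'k K0 poly) \<subseteq> one_plus_h reduced_K0"
    using total_chern_K_in_one_plus_h[OF conn rep_vclass(1)] by (auto simp: stable_chern_K_def)
  show "chern_K (net_sum E E') i = (\<Sum>(l, m) | l + m = i. chern_K E l * chern_K E' m)"
    if "net_bundle E \<and> net_bundle E'" for E :: "('k, 'v) net" and E' :: "('k, 'w) net" and i
    using that by (intro chern_K_sum[OF conn]) auto
  show "total_chern_K (net_sum E E') = total_chern_K E * total_chern_K E'"
    if "net_bundle E \<and> net_bundle E'" for E :: "('k, 'v) net" and E' :: "('k, 'w) net"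
    using that by (intro total_chern_K_sum[OF conn]) auto
  show "map_poly (K0_pullback \<eta>) (total_chern_K E) = total_chern_K (net_pullback \<eta> E)"
    if "pathwise_connected TYPE('k2) \<and> mono \<eta>" "net_bundle E" for \<eta> :: "'k2 \<Rightarrow> 'k" and E :: "('k, 'v) net"
  proof (rule poly_eqI)
    fix i
    have "pathwise_connected TYPE('k2)" "mono \<eta>" using that(1) by auto
    \<comment> \<open>Reading coefficients through \<open>map_poly\<close> relies on pullback
      preserving 0; the claim then is naturality of each Chern class.\<close>
    thus "Polynomial.coeff (map_poly (K0_pullback \<eta>) (total_chern_K E)) i =
        Polynomial.coeff (total_chern_K (net_pullback \<eta> E)) i"
      using that(2) by (simp add: coeff_map_poly K0_pullback_0 coeff_total_chern_K K0_pullback_chern_K[OF conn])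
  qed
qed (auto intro: stable_chern_K_add[OF assms] stable_chern_K_class[OF assms])

end
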